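(* Let $\xi(s)=\frac{s(s-1)}{2}\pi^{-s/2}\Gamma(s/2)\zeta(s)$ be the Riemann xi function and let $F(x,y)=|\xi(x+iy)|^2/2$. Consider the dynamics (on $\mathbf{C}\cong\mathbf{R}^2$) of Backtracking New Q-Newton's method (BNQN) applied to $F$, as described in the context. The following three statements are equivalent: (1) The Riemann hypothesis is true, i.e. every zero of $\xi$ lies on the critical line $\{s:\mathcal{R}(s)=1/2\}$. (2) All attractors of the dynamics of BNQN applied to $F$ are contained in the critical line $\{s:\mathcal{R}(s)=1/2\}$. (3) For every initial point $z_0\in\mathbf{C}$, the sequence $\{z_n\}$ constructed by BNQN applied to $F$ either converges to a point on the critical line or satisfies $\lim_{n\to\infty}|z_n|=+\infty$.
   Context: The Riemann xi function $\xi$ is entire, and its zeros are exactly the non-trivial zeros of the Riemann zeta function. BNQN applied to a $C^2$ function $F:\mathbf{R}^2\to\mathbf{R}$: fix parameters $\delta_0,\delta_1,\delta_2\in\mathbf{R}$ (pairwise distinct), $\theta>0$, $\tau>0$, and set $\kappa=\frac12\min_{i\neq j}|\delta_i-\delta_j|$. For a symmetric matrix $A$, let $\mathrm{minsp}(A)$ denote the minimum of the absolute values of its eigenvalues, and for invertible symmetric $A$ let $pr_{A,+}$ and $pr_{A,-}$ denote the orthogonal projections onto the span of eigenvectors of $A$ with positive, respectively negative, eigenvalues. Given $z_k$: let $j$ be the smallest index in $\{0,1,2\}$ with $\mathrm{minsp}(\nabla^2F(z_k)+\delta_j\|\nabla F(z_k)\|^{\tau}\mathrm{Id})\ge\kappa\|\nabla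 F(z_k)\|^{\tau}$ (with $j=0$ if $\nabla F(z_k)=0$); put $A_k=\nabla^2F(z_k)+\delta_j\|\nabla F(z_k)\|^{\tau}\mathrm{Id}$, $v_k=A_k^{-1}\nabla F(z_k)$, $w_k=pr_{A_k,+}(v_k)-pr_{A_k,-}(v_k)$, $\widehat{w_k}=w_k/\max\{1,\theta\|w_k\|\}$. Start with $\gamma=1$ and, if $\nabla F(z_k)\ne0$, halve $\gamma$ repeatedly while $F(z_k-\gamma\widehat{w_k})-F(z_k)>-\gamma\langle\widehat{w_k},\nabla F(z_k)\rangle/3$ (Armijo's condition). Set $z_{k+1}=z_k-\gamma\widehat{w_k}$. This defines a map $\phi:\mathbf{C}\to\mathbf{C}$, $z_k\mapsto z_{k+1}$. Attractor: an attractor of $\phi$ is a non-empty compact set $S\subset\mathbf{C}$ with $\phi(S)=S$ having an open neighbourhood $U\supset S$ such that $\lim_{n\to\infty}\mathrm{dist}(\phi^n(x),S)=0$ for all $x\in U$, and which is minimal (contains no smaller non-empty subset with this property). *)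

theory Defs
  imports "HOL-Analysis.Analysis"
begin

text \<open>The Riemann zeta function: the holomorphic function on C minus 1 that agrees with
the Dirichlet series sum 1/n^s for Re s > 1 (unique by the identity theorem).\<close>
definition riemann_zeta :: "complex \<Rightarrow> complex" where
  "riemann_zeta = (SOME f. f holomorphic_on (- {1}) \<and>
      (\<forall>s. 1 < Re s \<longrightarrow> (\<lambda>n. 1 / (of_nat (Suc n)) powr s) sums f s))"

text \<open>The Riemann xi function: the entire function equal to
s(s-1)/2 pi^(-s/2) Gamma(s/2) zeta(s) (on Re s > 1, hence everywhere by analytic continuation,
the removable singularities being filled in).\<close>
definition riemann_xi :: "complex \<Rightarrow> complex" where
  "riemann_xi = (SOME g. g holomorphic_on UNIV \<and>
      (\<forall>s. 1 < Re s \<longrightarrow>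
         g s = s * (s - 1) / 2 * (of_real pi) powr (- s / 2) * Gamma (s / 2) * riemann_zeta s))"

definition xiF :: "complex \<Rightarrow> real" where
  "xiF z = (cmod (riemann_xi z))\<^sup>2 / 2"

definition grad :: "(complex \<Rightarrow> real) \<Rightarrow> complex \<Rightarrow> complex" where
  "grad F z = Complex (frechet_derivative F (at z) 1) (frechet_derivative F (at z) \<i>)"

definition hess :: "(complex \<Rightarrow> real) \<Rightarrow> complex \<Rightarrow> complex \<Rightarrow> complex" where
  "hess F z = frechet_derivative (grad F) (at z)"

definition eigvals :: "(complex \<Rightarrow> complex) \<Rightarrow> real set" where
  "eigvals L = {e. \<exists>v. v \<noteq> 0 \<and> L v = e *\<^sub>R v}"

definition minsp :: "(complex \<Rightarrow> complex) \<Rightarrow> real" where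
  "minsp L = Inf (abs ` eigvals L)"

definition orth_proj :: "complex set \<Rightarrow> complex \<Rightarrow> complex" where
  "orth_proj S x = (THE p. p \<in> S \<and> (\<forall>u\<in>S. inner (x - p) u = 0))"

definition pr_pos :: "(complex \<Rightarrow> complex) \<Rightarrow> complex \<Rightarrow> complex" where
  "pr_pos L = orth_proj (span {v. \<exists>e>0. L v = e *\<^sub>R v})"

definition pr_neg :: "(complex \<Rightarrow> complex) \<Rightarrow> complex \<Rightarrow> complex" where
  "pr_neg L = orth_proj (span {v. \<exists>e<0. L v = e *\<^sub>R v})"

definition bnqn_step ::
  "real \<Rightarrow> real \<Rightarrow> real \<Rightarrow> real \<Rightarrow> real \<Rightarrow> (complex \<Rightarrow> real) \<Rightarrow> complex \<Rightarrow> complex" where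
  "bnqn_step d0 d1 d2 \<theta> \<tau> F z =
    (let \<delta> = (\<lambda>j::nat. if j = 0 then d0 else if j = 1 then d1 else d2);
         \<kappa> = Min {\<bar>d0 - d1\<bar>, \<bar>d0 - d2\<bar>, \<bar>d1 - d2\<bar>} / 2;
         g = grad F z; H = hess F z; c = norm g powr \<tau>;
         j = (if g = 0 then 0 else
                (LEAST j. j \<in> {0,1,2} \<and> minsp (\<lambda>h. H h + (\<delta> j * c) *\<^sub>R h) \<ge> \<kappa> * c));
         A = (\<lambda>h. H h + (\<delta> j * c) *\<^sub>R h);
         v = (THE v. A v = g);
         w = pr_pos A v - pr_neg A v;
         wh = (1 / max 1 (\<theta> * norm w)) *\<^sub>R w;
         armijo = (\<lambda>\<gamma>::real. F (z - \<gamma> *\<^sub>R wh) - F z \<le> - \<gamma> * inner wh g / 3);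
         \<gamma> = (if g = 0 then 1 else (1/2) ^ (LEAST m. armijo ((1/2) ^ m)))
     in z - \<gamma> *\<^sub>R wh)"

definition attracting_set :: "(complex \<Rightarrow> complex) \<Rightarrow> complex set \<Rightarrow> bool" where
  "attracting_set \<phi> S \<longleftrightarrow> S \<noteq> {} \<and> compact S \<and> \<phi> ` S = S \<and>
     (\<exists>U. open U \<and> S \<subseteq> U \<and>
        (\<forall>x\<in>U. (\<lambda>n. infdist ((\<phi> ^^ n) x) S) \<longlonglongrightarrow> 0))"

definition attractor :: "(complex \<Rightarrow> complex) \<Rightarrow> complex set \<Rightarrow> bool" where
  "attractor \<phi> S \<longleftrightarrow> attracting_set \<phi> S \<and> \<not> (\<exists>S'. S' \<subset> S \<and> attracting_set \<phi> S')"

end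

theory Submission
  imports Defs "HOL-Probability.Characteristic_Functions" "HOL-Complex_Analysis.Complex_Analysis"
begin

text \<open>For an entire function \<open>f\<close> and \<open>F = \<bar>f\<bar>\<^sup>2 / 2\<close>, the gradient is \<open>f \<cdot> cnj f'\<close> and the Hessian is
  \<open>h \<mapsto> \<bar>f'\<bar>\<^sup>2 h + f \<cdot> cnj f'' \<cdot> cnj h\<close>, so the critical points are the zeros of \<open>f\<close> and \<open>f'\<close>. Near a
  noncritical point a BNQN step decreases \<open>F\<close> by a fixed amount, and near a critical point the step
  is short because the shifted Hessian is large compared with the gradient. As critical points are
  isolated, every orbit converges to a critical point or escapes to infinity. Zeros of \<open>f\<close> are
  attracting, and by the open mapping theorem the minimum of \<open>F\<close> on an attracting set is \<open>0\<close>; hence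
  the attractors are exactly the singletons of zeros, and (1) is equivalent to (2).

  Zeros of \<open>\<xi>\<close> are fixed points, so (3) implies (1). Conversely, (1) implies (3) because under the
  Riemann hypothesis the zeros of \<open>\<xi>'\<close> lie on the critical line as well: for small \<open>a > 0\<close> the
  quotient \<open>\<xi>(s - a) / \<xi>(s + a)\<close> has modulus \<open>1\<close> on the line and, by the Phragmen--Lindeloef principle,
  at most \<open>1\<close> to the right of it. Hence \<open>Re (\<xi>' / \<xi>) \<ge> 0\<close> there, and the open mapping theorem excludes
  zeros of \<open>\<xi>'\<close>.

  The functions \<open>\<zeta>\<close> and \<open>\<xi>\<close>, the functional equation and the bounds on \<open>\<xi>\<close> come from the Mellin
  transform of the Jacobi theta function.\<close>

section \<open>The theta function\<close>

text \<open>\<open>riemann_zeta\<close> and \<open>riemann_xi\<close> are Hilbert choices, so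
  existence comes first: \<open>entire_xi\<close> is built explicitly, and a zeta function is
  obtained by dividing the other factors out of it. The Phragmen--Lindeloef argument needs a bound
  for \<xi>(s - a) / \<xi>(s + a) far to the right, which comes from a factorwise comparison of
  Gauss products, and a lower bound for \<xi> near the line, where exponential quality is enough and
  Borel--Caratheodory suffices.

  In the dynamics the obstacle is that the step map is not known to be continuous: the choice of the
  shift and the number of halvings can jump. Continuity is shown at critical points only, and the
  other limit arguments run through the continuous function \<open>F\<close>, which does not
  increase along orbits. Three shifts always leave a choice, because each of the two eigenvalues of
  the Hessian can spoil at most one of them. As the exponent \<tau> is an arbitrary positive number,
  the shift may be larger or smaller than the gradient near a critical point, and the step length
  needs two different estimates.\<close>

lemma gaussian_fourier:
  fixes a b :: real
  assumes a: "a > 0"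
  shows "integrable lborel (\<lambda>t. exp (-pi * a * t\<^sup>2) * cos (2 * pi * b * t))"
    and "(LINT t|lborel. exp (-pi * a * t\<^sup>2) * cos (2 * pi * b * t)) = exp (-pi * b\<^sup>2 / a) / sqrt a"
proof -
  \<comment> \<open>At this scale \<open>x = c * t\<close> turns the integrand into a multiple of
    the standard normal density times \<open>cos (s * x)\<close>; its integral is the real part of
    the characteristic function at \<open>s\<close>.\<close>
  define c where "c = sqrt (2 * pi * a)"
  have c: "c > 0" and c2: "c\<^sup>2 = 2 * pi * a"
    using a by (simp_all add: c_def)
  define s where "s = 2 * pi * b / c"
  let ?h = "\<lambda>x. std_normal_density x * cos (s * x)"
  interpret std: real_distribution std_normal_distribution by (rule real_dist_normal_dist)
  have hint: "integrable lborel ?h"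
  proof (rule Bochner_Integration.integrable_bound)
    show "integrable lborel std_normal_density" by simp
    show "AE x in lborel. norm (?h x) \<le> norm (std_normal_density x)"
      by (auto simp: abs_mult mult_left_le)
  qed simp
  have "complex_of_real (exp (- s\<^sup>2 / 2)) = char std_normal_distribution s"
    by (simp add: char_std_normal_distribution)
  also have "\<dots> = (CLINT x|std_normal_distribution. iexp (s * x))"
    by (simp add: char_def)
  finally have "exp (- s\<^sup>2 / 2) = Re (CLINT x|std_normal_distribution. iexp (s * x))"
    by (metis Re_complex_of_real)
  also have "\<dots> = (LINT x|std_normal_distribution. Re (iexp (s * x)))"
    by (rule integral_Re [symmetric], rule std.integrable_iexp) auto
  also have "\<dots> = (LINT x|std_normal_distribution. cos (s * x))"
    by (simp add: Re_exp)
  also have "\<dots> = (LINT x|lborel. ?h x)"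
    by (subst integral_density) auto
  finally have val: "(LINT x|lborel. ?h x) = exp (- s\<^sup>2 / 2)" by simp
  have hc: "?h (0 + c * t) = (1 / sqrt (2 * pi)) * (exp (-pi * a * t\<^sup>2) * cos (2 * pi * b * t))" for t
    using c c2 by (simp add: std_normal_density_def s_def power_mult_distrib mult.assoc)
  have "integrable lborel (\<lambda>t. ?h (0 + c * t))"
    by (rule lborel_integrable_real_affine[OF hint]) (use c in auto)
  then have *: "integrable lborel (\<lambda>t. (1 / sqrt (2 * pi)) * (exp (-pi * a * t\<^sup>2) * cos (2 * pi * b * t)))"
    by (simp only: hc)
  from integrable_mult_right[OF this, of "sqrt (2 * pi)"]
  show "integrable lborel (\<lambda>t. exp (-pi * a * t\<^sup>2) * cos (2 * pi * b * t))"
    by simp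
  have "exp (- s\<^sup>2 / 2) = \<bar>c\<bar> *\<^sub>R (LINT t|lborel. ?h (0 + c * t))"
    using lborel_integral_real_affine[of c ?h 0] c val by simp
  also have "\<dots> = c / sqrt (2 * pi) * (LINT t|lborel. exp (-pi * a * t\<^sup>2) * cos (2 * pi * b * t))"
    using c by (simp only: hc) simp
  also have "c / sqrt (2 * pi) = sqrt a"
    by (simp add: c_def real_sqrt_mult)
  also have "- s\<^sup>2 / 2 = - pi * b\<^sup>2 / a"
    using a by (simp add: s_def power_divide power_mult_distrib c2) (simp add: power2_eq_square)
  finally show "(LINT t|lborel. exp (-pi * a * t\<^sup>2) * cos (2 * pi * b * t)) = exp (-pi * b\<^sup>2 / a) / sqrt a"
    using a by (simp add: field_simps)
qed

text \<open>The half-integer end points are those of \<open>[-1/2, 1/2]\<close> together with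
  \<open>M\<close> of its translates on either side, as they occur when
  \<open>theta_tail_inverse\<close> unfolds the periodised Gaussian.\<close>

lemma gaussian_fourier_limit:
  fixes a b :: real
  assumes a: "a > 0"
  shows "(\<lambda>M. integral {-(real M + 1/2)..real M + 1/2} (\<lambda>t. exp (-pi * a * t\<^sup>2) * cos (2 * pi * b * t)))
           \<longlonglongrightarrow> exp (-pi * b\<^sup>2 / a) / sqrt a"
proof -
  let ?f = "\<lambda>t::real. exp (-pi * a * t\<^sup>2) * cos (2 * pi * b * t)"
  let ?I = "\<lambda>M::nat. {-(real M + 1/2)..real M + 1/2}"
  have "(\<lambda>M. LINT t|lborel. indicator (?I M) t *\<^sub>R ?f t) \<longlonglongrightarrow> (LINT t|lborel. ?f t)"
  proof (rule integral_dominated_convergence)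
    show "integrable lborel (\<lambda>t. norm (?f t))"
      using gaussian_fourier(1)[OF a, of b] by (rule integrable_norm)
    show "AE t in lborel. (\<lambda>M. indicator (?I M) t *\<^sub>R ?f t) \<longlonglongrightarrow> ?f t"
    proof (rule AE_I2)
      fix t :: real
      have "eventually (\<lambda>M. indicator (?I M) t *\<^sub>R ?f t = ?f t) sequentially"
        using eventually_ge_at_top[of "nat \<lceil>\<bar>t\<bar>\<rceil>"]
      proof eventually_elim
        case (elim M)
        then have "\<bar>t\<bar> \<le> real M" by linarith
        then show ?case by (auto simp: indicator_def)
      qed
      then show "(\<lambda>M. indicator (?I M) t *\<^sub>R ?f t) \<longlonglongrightarrow> ?f t"
        by (rule tendsto_eventually)
    qed
    show "AE t in lborel. norm (indicator (?I M) t *\<^sub>R ?f t) \<le> norm (?f t)" for M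
      by (auto simp: indicator_def)
  qed auto
  moreover have "(LINT t|lborel. indicator (?I M) t *\<^sub>R ?f t) = integral (?I M) ?f" for M
  proof -
    have "set_integrable lborel (?I M) ?f"
      by (rule borel_integrable_atLeastAtMost') (auto intro!: continuous_intros)
    then show ?thesis
      using set_borel_integral_eq_integral(2)[of "?I M" ?f] by (simp add: set_lebesgue_integral_def)
  qed
  ultimately show ?thesis
    using gaussian_fourier(2)[OF a, of b] by simp
qed

lemma integral_cos_multiple:
  fixes k :: int
  shows "((\<lambda>t::real. cos (2 * pi * of_int k * t)) has_integral (if k = 0 then 1 else 0)) {-1/2..1/2}"
proof (cases "k = 0")
  case True
  then show ?thesis using has_integral_const_real[of "1::real" "-1/2" "1/2"] by simp
next
  case False
  let ?F = "\<lambda>t::real. sin (2 * pi * of_int k * t) / (2 * pi * of_int k)"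
  have "((\<lambda>t::real. cos (2 * pi * of_int k * t)) has_integral (?F (1/2) - ?F (-1/2))) {-1/2..1/2}"
    using False by (intro fundamental_theorem_of_calculus)
       (auto intro!: derivative_eq_intros simp flip: has_real_derivative_iff_has_vector_derivative)
  moreover have "sin (pi * of_int k) = 0"
    by (metis mult.commute sin_integer_2pi sin_times_pi_eq_0 Ints_of_int)
  ultimately show ?thesis using False by simp
qed

text \<open>By Bessel's inequality the sine coefficients are square summable.\<close>

lemma riemann_lebesgue_odd_sines:
  fixes h :: "real \<Rightarrow> real"
  assumes h: "continuous_on {-1/2..1/2} h"
  shows "(\<lambda>N. integral {-1/2..1/2} (\<lambda>t. h t * sin ((2 * real N + 1) * pi * t))) \<longlonglongrightarrow> 0"
proof -
  let ?I = "{-1/2..1/2::real}"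
  let ?e = "\<lambda>N t. sin ((2 * real N + 1) * pi * t)"
  define c where "c N = integral ?I (\<lambda>t. h t * ?e N t)" for N
  have hi: "((\<lambda>t. h t * ?e N t) has_integral c N) ?I" for N
    unfolding c_def
    by (intro integrable_integral integrable_continuous_real continuous_intros h)
  \<comment> \<open>Product to sum leaves the integer frequencies \<open>j - k\<close> and
    \<open>j + k + 1\<close>, and the second is never 0.\<close>
  have ortho: "((\<lambda>t. ?e j t * ?e k t) has_integral (if j = k then 1/2 else 0)) ?I" for j k
  proof -
    have eq: "?e j t * ?e k t = (1/2) * (cos (2 * pi * of_int (int j - int k) * t) - cos (2 * pi * of_int (int j + int k + 1) * t))" for t
    proof -
      have "2 * (?e j t * ?e k t) = cos ((2 * real j + 1) * pi * t - (2 * real k + 1) * pi * t) - cos ((2 * real j + 1) * pi * t + (2 * real k + 1) * pi * t)"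
        by (simp add: cos_diff cos_add)
      also have "(2 * real j + 1) * pi * t - (2 * real k + 1) * pi * t = 2 * pi * of_int (int j - int k) * t"
        by (simp add: algebra_simps)
      also have "(2 * real j + 1) * pi * t + (2 * real k + 1) * pi * t = 2 * pi * of_int (int j + int k + 1) * t"
        by (simp add: algebra_simps)
      finally show ?thesis by simp
    qed
    have "((\<lambda>t. (1/2) * (cos (2 * pi * of_int (int j - int k) * t) - cos (2 * pi * of_int (int j + int k + 1) * t)))
        has_integral ((1/2) * ((if int j - int k = 0 then 1 else 0) - (if int j + int k + 1 = 0 then 1 else (0::real))))) ?I"
      by (intro has_integral_mult_right has_integral_diff integral_cos_multiple)
    then show ?thesis
      by (simp only: eq) (auto split: if_splits)
  qed
  define H where "H = integral ?I (\<lambda>t. h t * h t)"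
  have Hi: "((\<lambda>t. h t * h t) has_integral H) ?I"
    unfolding H_def by (intro integrable_integral integrable_continuous_real continuous_intros h)
  have bessel: "(\<Sum>j<N. (c j)\<^sup>2) \<le> H / 2" for N
  proof -
    \<comment> \<open>The factor 2 is the inverse of the squared norm \<open>1/2\<close> of each
      sine, which makes \<open>?S\<close> the orthogonal projection of \<open>h\<close>.\<close>
    let ?S = "\<lambda>t. \<Sum>j<N. 2 * c j * ?e j t"
    have eq: "(h t - ?S t)\<^sup>2 = h t * h t - (\<Sum>j<N. 4 * c j * (h t * ?e j t))
        + (\<Sum>j<N. \<Sum>k<N. 4 * c j * c k * (?e j t * ?e k t))" for t
    proof -
      have "(h t - ?S t)\<^sup>2 = h t * h t - 2 * h t * ?S t + ?S t * ?S t"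
        by (simp add: power2_eq_square algebra_simps)
      also have "?S t * ?S t = (\<Sum>j<N. \<Sum>k<N. 4 * c j * c k * (?e j t * ?e k t))"
        unfolding sum_product by (simp add: algebra_simps)
      also have "2 * h t * ?S t = (\<Sum>j<N. 4 * c j * (h t * ?e j t))"
        unfolding sum_distrib_left by (simp add: algebra_simps)
      finally show ?thesis .
    qed
    have "((\<lambda>t. (h t - ?S t)\<^sup>2) has_integral (H - (\<Sum>j<N. 4 * c j * c j)
        + (\<Sum>j<N. \<Sum>k<N. 4 * c j * c k * (if j = k then 1/2 else 0)))) ?I"
      unfolding eq
      by (intro has_integral_add has_integral_diff Hi has_integral_sum has_integral_mult_right hi ortho) auto
    then have "0 \<le> H - (\<Sum>j<N. 4 * c j * c j) + (\<Sum>j<N. \<Sum>k<N. 4 * c j * c k * (if j = k then 1/2 else 0))"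
      by (rule has_integral_nonneg) auto
    also have "(\<Sum>j<N. \<Sum>k<N. 4 * c j * c k * (if j = k then 1/2 else 0)) = (\<Sum>j<N. 2 * (c j)\<^sup>2)"
      by (rule sum.cong) (auto simp: power2_eq_square if_distrib[of "\<lambda>x. _ * x"] cong: if_cong)
    also have "(\<Sum>j<N. 4 * c j * c j) = (\<Sum>j<N. 2 * (c j)\<^sup>2) + (\<Sum>j<N. 2 * (c j)\<^sup>2)"
      by (simp add: sum.distrib[symmetric] power2_eq_square mult.assoc)
    finally show ?thesis by (simp add: sum_distrib_left[symmetric])
  qed
  have "summable (\<lambda>j. (c j)\<^sup>2)"
    by (rule summableI_nonneg_bounded[where x = "H/2"]) (use bessel in auto)
  then have "(\<lambda>j. (c j)\<^sup>2) \<longlonglongrightarrow> 0"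
    by (rule summable_LIMSEQ_zero)
  then have "c \<longlonglongrightarrow> 0"
    using tendsto_real_sqrt[of "\<lambda>j. (c j)\<^sup>2" 0] by (simp add: tendsto_rabs_zero_iff)
  then show ?thesis unfolding c_def .
qed

text \<open>This is (\<theta> - 1) / 2 for the Jacobi theta function \<theta>(x), the sum of
  \<open>exp (- pi * n^2 * x)\<close> over all integers \<open>n\<close>. Without the term
  \<open>n = 0\<close> it decays exponentially at infinity, as the Mellin integral requires.\<close>

definition theta_tail :: "real \<Rightarrow> real" where
  "theta_tail x = (\<Sum>n. exp (- pi * (real (Suc n))\<^sup>2 * x))"

text \<open>Majorant for the differentiated series of translated Gaussians: the derivative brings
  down a factor \<open>t + (n + 1)\<close> or \<open>t - (n + 1)\<close>, of modulus at most
  \<open>n + 2\<close> for \<open>|t| <= 1\<close>.\<close>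

lemma summable_linear_geometric:
  fixes r :: real
  assumes "0 \<le> r" "r < 1"
  shows "summable (\<lambda>n. (real n + 2) * r ^ n)"
proof -
  have "summable (\<lambda>n. of_nat (Suc n) * r ^ n)"
    using geometric_deriv_sums[of r] assms by (auto simp: sums_iff)
  moreover have "summable (\<lambda>n. r ^ n)"
    using assms by (simp add: summable_geometric)
  ultimately have "summable (\<lambda>n. of_nat (Suc n) * r ^ n + r ^ n)"
    by (rule summable_add)
  then show ?thesis by (simp add: algebra_simps)
qed

lemma dirichlet_kernel_sin:
  fixes t :: real
  shows "(1 + 2 * (\<Sum>j<N. cos (2 * pi * real (Suc j) * t))) * sin (pi * t) = sin ((2 * real N + 1) * pi * t)"
proof (induction N)
  case (Suc N)
  have "2 * (cos (2 * pi * real (Suc N) * t) * sin (pi * t))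
      = sin (2 * pi * real (Suc N) * t + pi * t) - sin (2 * pi * real (Suc N) * t - pi * t)"
    by (simp add: sin_add sin_diff)
  also have "2 * pi * real (Suc N) * t + pi * t = (2 * real (Suc N) + 1) * pi * t"
    by (simp add: algebra_simps)
  also have "2 * pi * real (Suc N) * t - pi * t = (2 * real N + 1) * pi * t"
    by (simp add: algebra_simps)
  finally show ?case using Suc by (simp add: algebra_simps)
qed simp

lemma gaussian_le_geometric:
  fixes a s :: real
  assumes a: "a > 0" and s: "real n \<le> \<bar>s\<bar>"
  shows "exp (- pi * a * s\<^sup>2) \<le> exp (- pi * a) ^ n"
proof -
  have "real n \<le> (real n)\<^sup>2" by (cases n) (auto simp: power2_eq_square)
  also have "\<dots> \<le> s\<^sup>2" using s by (metis abs_of_nat abs_le_square_iff)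
  finally have "pi * a * real n \<le> pi * a * s\<^sup>2" using a by (intro mult_left_mono) auto
  then show ?thesis by (simp add: exp_of_nat_mult[symmetric] algebra_simps)
qed

lemma theta_tail_term_bound:
  assumes "0 < a" "a \<le> x"
  shows "exp (- pi * (real (Suc n))\<^sup>2 * x) \<le> exp (- pi * a) ^ n"
proof -
  have "pi * (real (Suc n))\<^sup>2 * a \<le> pi * (real (Suc n))\<^sup>2 * x"
    using assms by (intro mult_left_mono) auto
  then have "exp (- pi * (real (Suc n))\<^sup>2 * x) \<le> exp (- pi * (real (Suc n))\<^sup>2 * a)"
    by simp
  also have "\<dots> \<le> exp (- pi * a) ^ n"
    using gaussian_le_geometric[of a n "real (Suc n)"] assms by (simp add: mult_ac)
  finally show ?thesis .
qed

lemma summable_theta_tail: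
  assumes "x > 0"
  shows "summable (\<lambda>n. exp (- pi * (real (Suc n))\<^sup>2 * x))"
proof (rule summable_comparison_test')
  show "summable (\<lambda>n. exp (- pi * x) ^ n)"
    using assms by (intro summable_geometric) auto
  show "norm (exp (- pi * (real (Suc n))\<^sup>2 * x)) \<le> exp (- pi * x) ^ n" for n
    using theta_tail_term_bound[of x x n] assms by simp
qed

text \<open>Poisson summation for the Gaussian. Only the value at \<open>0\<close> of the Fourier series of the
  periodised Gaussian \<open>G\<close> is needed, and the Dirichlet kernel turns the error into the sine
  coefficients of the continuous function \<open>(G t - G 0) / sin (\<pi> t)\<close>.\<close>

theorem theta_tail_inverse:
  assumes a: "a > 0"
  shows "1 + 2 * theta_tail a = (1 + 2 * theta_tail (1 / a)) / sqrt a"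
proof -
  let ?I = "{-1/2..1/2::real}"
  define \<phi> where "\<phi> = (\<lambda>t::real. exp (- pi * a * t\<^sup>2))"
  define r where "r = exp (- pi * a)"
  have r: "0 \<le> r" "r < 1" using a by (auto simp: r_def)
  \<comment> \<open>The translates by \<open>n + 1\<close> and \<open>- (n + 1)\<close> are paired,
    so that a series over the naturals runs through all nonzero integers.\<close>
  define f where "f n t = \<phi> (t + real (Suc n)) + \<phi> (t - real (Suc n))" for n t
  define f' where "f' n t = - 2 * pi * a * ((t + real (Suc n)) * \<phi> (t + real (Suc n))
     + (t - real (Suc n)) * \<phi> (t - real (Suc n)))" for n t
  define G where "G t = \<phi> t + (\<Sum>n. f n t)" for t
  have \<phi>c: "continuous_on S \<phi>" for S
    unfolding \<phi>_def by (intro continuous_intros)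
  have fc: "continuous_on S (f n)" for S n
    unfolding f_def \<phi>_def by (intro continuous_intros)
  have \<phi>b: "\<bar>\<phi> (t + real (Suc n))\<bar> \<le> r ^ n" "\<bar>\<phi> (t - real (Suc n))\<bar> \<le> r ^ n" if "\<bar>t\<bar> \<le> 1" for t n
    using gaussian_le_geometric[OF a, of n "t + real (Suc n)"] gaussian_le_geometric[OF a, of n "t - real (Suc n)"] that
    by (auto simp: \<phi>_def r_def)
  have fb: "norm (f n t) \<le> 2 * r ^ n" if "\<bar>t\<bar> \<le> 1" for t n
    using \<phi>b[OF that, of n] unfolding f_def real_norm_def by linarith
  have f'b: "norm (f' n t) \<le> 4 * pi * a * ((real n + 2) * r ^ n)" if t: "\<bar>t\<bar> \<le> 1" for t n
  proof -
    have "\<bar>(t + real (Suc n)) * \<phi> (t + real (Suc n))\<bar> \<le> (real n + 2) * r ^ n"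
         "\<bar>(t - real (Suc n)) * \<phi> (t - real (Suc n))\<bar> \<le> (real n + 2) * r ^ n"
      unfolding abs_mult using t by (intro mult_mono \<phi>b; simp; linarith)+
    then have *: "\<bar>(t + real (Suc n)) * \<phi> (t + real (Suc n)) + (t - real (Suc n)) * \<phi> (t - real (Suc n))\<bar>
        \<le> 2 * ((real n + 2) * r ^ n)" by linarith
    have "norm (f' n t) = 2 * pi * a * \<bar>(t + real (Suc n)) * \<phi> (t + real (Suc n)) + (t - real (Suc n)) * \<phi> (t - real (Suc n))\<bar>"
      using a by (simp add: f'_def abs_mult)
    also have "\<dots> \<le> 2 * pi * a * (2 * ((real n + 2) * r ^ n))"
      using a by (intro mult_left_mono *) auto
    finally show ?thesis by (simp add: algebra_simps)
  qed
  have sr: "summable (\<lambda>n. 2 * r ^ n)"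
    using r by (intro summable_mult) (simp add: summable_geometric)
  have sr': "summable (\<lambda>n. 4 * pi * a * ((real n + 2) * r ^ n))"
    by (intro summable_mult summable_linear_geometric r)
  have fs: "summable (\<lambda>n. f n t)" if "\<bar>t\<bar> \<le> 1" for t
    by (rule summable_comparison_test'[OF sr]) (use fb that in auto)
  have fder: "(f n has_field_derivative f' n t) (at t within S)" for n t S
    unfolding f_def[abs_def] f'_def \<phi>_def
    by (auto intro!: derivative_eq_intros simp: algebra_simps)
  have Gder: "(G has_field_derivative (- 2 * pi * a * t * \<phi> t + (\<Sum>n. f' n t))) (at t)" if "\<bar>t\<bar> < 1" for t
  proof -
    have 1: "((\<lambda>t. \<Sum>n. f n t) has_field_derivative (\<Sum>n. f' n t)) (at t)"
    proof (rule has_field_derivative_series'(2)[of "{-1..1}" f f' 0])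
      show "uniformly_convergent_on {-1..1} (\<lambda>n x. \<Sum>i<n. f' i x)"
        by (rule Weierstrass_m_test'[OF _ sr']) (rule f'b, simp add: abs_le_iff)
      show "t \<in> interior {-1..1}" using that by (simp add: abs_less_iff)
      show "summable (\<lambda>n. f n 0)" by (rule fs) simp
    qed (simp_all add: fder)
    have 2: "(\<phi> has_field_derivative (- 2 * pi * a * t * \<phi> t)) (at t)"
      unfolding \<phi>_def by (auto intro!: derivative_eq_intros)
    show ?thesis unfolding G_def[abs_def] by (rule DERIV_add[OF 2 1])
  qed
  have Gc: "continuous_on ?I G"
  proof (rule continuous_at_imp_continuous_on, rule ballI)
    fix t assume "t \<in> ?I"
    then have "\<bar>t\<bar> < 1" by (simp add: abs_less_iff)
    then show "isCont G t" by (rule DERIV_isCont[OF Gder])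
  qed

  have coeff: "((\<lambda>t. G t * cos (2 * pi * real j * t)) has_integral (exp (- pi * (real j)\<^sup>2 / a) / sqrt a)) ?I" for j
  proof -
    let ?c = "\<lambda>t. cos (2 * pi * real j * t)"
    let ?P = "\<lambda>M t. \<phi> t + (\<Sum>n<M. f n t)"
    let ?J = "\<lambda>M::nat. {-(real M + 1/2)..real M + 1/2}"
    have per1: "?c (t + real m) = ?c t" for t m
    proof -
      have "?c (t + real m) = cos (2 * pi * real j * t + 2 * pi * of_nat (j * m))"
        by (simp add: algebra_simps)
      then show "?c (t + real m) = ?c t"
        using cos_integer_2pi[of "of_nat (j * m)"] sin_integer_2pi[of "of_nat (j * m)"]
        by (simp add: cos_add Ints_of_nat)
    qed
    then have per2: "?c (t - real m) = ?c t" for t m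
      by (metis diff_add_cancel)
    have \<phi>ci: "((\<lambda>t. \<phi> t * ?c t) has_integral (integral {x..y} (\<lambda>t. \<phi> t * ?c t))) {x..y}" for x y
      by (intro integrable_integral integrable_continuous_real continuous_intros \<phi>c)
    \<comment> \<open>Unfolding: the cosine has period 1, so integrating a translate of \<phi> over
      \<open>?I\<close> is integrating \<phi> over a translate of \<open>?I\<close>, and each
      \<open>f M\<close> extends the interval by one unit at both ends.\<close>
    have part: "((\<lambda>t. ?P M t * ?c t) has_integral integral (?J M) (\<lambda>t. \<phi> t * ?c t)) ?I" for M
    proof (induction M)
      case 0
      then show ?case using \<phi>ci[of "-1/2" "1/2"] by simp
    next
      case (Suc M)
      let ?m = "real (Suc M)"
      let ?A = "integral {?m - 1/2..?m + 1/2} (\<lambda>t. \<phi> t * ?c t)"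
      let ?B = "integral {- ?m - 1/2..- ?m + 1/2} (\<lambda>t. \<phi> t * ?c t)"
      have A: "((\<lambda>t. \<phi> (t + ?m) * ?c t) has_integral ?A) ?I"
        using has_integral_shift_real_ivl[OF \<phi>ci[of "?m - 1/2" "?m + 1/2"], of ?m] per1[of _ "Suc M"]
        by (simp add: add.commute)
      have B: "((\<lambda>t. \<phi> (t - ?m) * ?c t) has_integral ?B) ?I"
        using has_integral_shift_real_ivl[OF \<phi>ci[of "- ?m - 1/2" "- ?m + 1/2"], of "- ?m"] per2[of _ "Suc M"]
        by (simp add: algebra_simps)
      have "((\<lambda>t. ?P M t * ?c t + (\<phi> (t + ?m) * ?c t + \<phi> (t - ?m) * ?c t)) has_integral
          (integral (?J M) (\<lambda>t. \<phi> t * ?c t) + (?A + ?B))) ?I"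
        by (intro has_integral_add Suc A B)
      moreover have "?P M t * ?c t + (\<phi> (t + ?m) * ?c t + \<phi> (t - ?m) * ?c t) = ?P (Suc M) t * ?c t" for t
        by (simp add: f_def algebra_simps)
      moreover have "integral (?J M) (\<lambda>t. \<phi> t * ?c t) + (?A + ?B) = integral (?J (Suc M)) (\<lambda>t. \<phi> t * ?c t)"
      proof -
        have "((\<lambda>t. \<phi> t * ?c t) has_integral (?B + (integral (?J M) (\<lambda>t. \<phi> t * ?c t) + ?A))) {-?m - 1/2..?m + 1/2}"
        proof (rule has_integral_combine)
          show "((\<lambda>t. \<phi> t * ?c t) has_integral ?B) {-?m - 1/2..-(real M + 1/2)}"
          proof -
            have e: "-(real M + 1/2) = - ?m + 1/2" by simp
            show ?thesis unfolding e by (rule \<phi>ci)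
          qed
          show "((\<lambda>t. \<phi> t * ?c t) has_integral (integral (?J M) (\<lambda>t. \<phi> t * ?c t) + ?A)) {-(real M + 1/2)..?m + 1/2}"
          proof (rule has_integral_combine)
            show "((\<lambda>t. \<phi> t * ?c t) has_integral ?A) {real M + 1/2..?m + 1/2}"
            proof -
              have e: "real M + 1/2 = ?m - 1/2" by simp
              show ?thesis unfolding e by (rule \<phi>ci)
            qed
            show "((\<lambda>t. \<phi> t * ?c t) has_integral integral (?J M) (\<lambda>t. \<phi> t * ?c t)) (?J M)"
              by (rule \<phi>ci)
          qed auto
        qed auto
        then have "integral {-?m - 1/2..?m + 1/2} (\<lambda>t. \<phi> t * ?c t) = ?B + (integral (?J M) (\<lambda>t. \<phi> t * ?c t) + ?A)"
          by (rule integral_unique)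
        then show ?thesis by (simp add: algebra_simps)
      qed
      ultimately show ?case by simp
    qed
    have "uniform_limit ?I (\<lambda>M t. \<Sum>n<M. f n t) (\<lambda>t. \<Sum>n. f n t) sequentially"
      by (rule Weierstrass_m_test[OF _ sr]) (rule fb, simp add: abs_le_iff)
    then have u0: "uniform_limit ?I ?P G sequentially"
      unfolding G_def by (intro uniform_limit_intros)
    have "uniform_limit ?I (\<lambda>M t. ?P M t * ?c t) (\<lambda>t. G t * ?c t) sequentially"
    proof (rule uniform_lim_mult[OF u0 uniform_limit_const])
      show "bounded (G ` ?I)"
        using compact_continuous_image[OF Gc] by (simp add: compact_imp_bounded)
      show "bounded ((\<lambda>t. ?c t) ` ?I)"
        by (rule boundedI[of _ 1]) auto
    qed
    then obtain I J where IJ: "\<And>M. ((\<lambda>t. ?P M t * ?c t) has_integral I M) ?I"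
        "((\<lambda>t. G t * ?c t) has_integral J) ?I" "I \<longlonglongrightarrow> J"
      by (rule uniform_limit_integral) (auto intro!: continuous_intros \<phi>c fc)
    have "I = (\<lambda>M. integral (?J M) (\<lambda>t. \<phi> t * ?c t))"
      using has_integral_unique[OF IJ(1) part] by auto
    then have "I \<longlonglongrightarrow> exp (- pi * (real j)\<^sup>2 / a) / sqrt a"
      using gaussian_fourier_limit[OF a, of "real j"] by (simp add: \<phi>_def)
    with IJ(3) have "J = exp (- pi * (real j)\<^sup>2 / a) / sqrt a"
      by (rule LIMSEQ_unique)
    with IJ(2) show ?thesis by simp
  qed

  define d where "d = (\<Sum>n. f' n 0)"
  \<comment> \<open>At 0 the quotient is continued by its limit \<open>d / pi\<close>;
    \<open>d\<close> is the derivative of \<open>G\<close> at 0, to which \<phi> itself contributes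
    0.\<close>
  define h where "h t = (if t = 0 then d / pi else (G t - G 0) / sin (pi * t))" for t
  have snz: "sin (pi * t) \<noteq> 0" if "t \<in> ?I" "t \<noteq> 0" for t
  proof
    assume "sin (pi * t) = 0"
    then obtain i :: int where "pi * t = of_int i * pi" by (auto simp: sin_zero_iff_int2)
    then have "t = of_int i" by simp
    with that have "i = 0" by (auto simp: field_simps)
    with \<open>t = of_int i\<close> that show False by simp
  qed
  have hc: "continuous_on ?I h"
  proof (rule continuous_at_imp_continuous_on, rule ballI)
    fix t assume t: "t \<in> ?I"
    show "isCont h t"
    proof (cases "t = 0")
      case False
      have "isCont G t" using t by (intro DERIV_isCont[OF Gder]) auto
      then have "isCont (\<lambda>t. (G t - G 0) / sin (pi * t)) t"
        using snz[OF t False] by (intro continuous_intros) auto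
      moreover have "eventually (\<lambda>s. s \<noteq> 0) (nhds t)"
        using False by (rule t1_space_nhds)
      then have "eventually (\<lambda>s. h s = (G s - G 0) / sin (pi * s)) (nhds t)"
        by eventually_elim (simp add: h_def)
      ultimately show ?thesis by (subst isCont_cong)
    next
      case True
      have "((\<lambda>t. (G t - G 0) / (t - 0)) \<longlongrightarrow> d) (at 0)"
        using Gder[of 0] by (simp add: has_field_derivative_iff d_def)
      moreover have "((\<lambda>t. sin (pi * t)) has_field_derivative pi) (at 0)"
        by (auto intro!: derivative_eq_intros)
      then have "((\<lambda>t. (sin (pi * t) - sin (pi * 0)) / (t - 0)) \<longlongrightarrow> pi) (at 0)"
        by (simp add: has_field_derivative_iff)
      ultimately have "((\<lambda>t. ((G t - G 0) / (t - 0)) / ((sin (pi * t) - sin (pi * 0)) / (t - 0))) \<longlongrightarrow> d / pi) (at 0)"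
        by (rule tendsto_divide) simp
      moreover have "\<forall>\<^sub>F t in at 0. ((G t - G 0) / (t - 0)) / ((sin (pi * t) - sin (pi * 0)) / (t - 0)) = h t"
        unfolding eventually_at by (rule exI[of _ 1]) (auto simp: h_def)
      ultimately have "(h \<longlongrightarrow> d / pi) (at 0)"
        by (rule Lim_transform_eventually)
      then show ?thesis unfolding True isCont_def by (simp add: h_def)
    qed
  qed

  \<comment> \<open>The partial sums at 0 of the Fourier series of \<open>G\<close>, with the
    coefficients from \<open>coeff\<close>.\<close>
  define S where "S N = (1 + 2 * (\<Sum>j<N. exp (- pi * (real (Suc j))\<^sup>2 * (1 / a)))) / sqrt a" for N
  have err: "S N - G 0 = integral ?I (\<lambda>t. h t * sin ((2 * real N + 1) * pi * t))" for N
  proof -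
    have 1: "((\<lambda>t. G t * (1 + 2 * (\<Sum>j<N. cos (2 * pi * real (Suc j) * t)))) has_integral S N) ?I"
    proof -
      have "((\<lambda>t. G t * cos (2 * pi * real 0 * t) + 2 * (\<Sum>j<N. G t * cos (2 * pi * real (Suc j) * t))) has_integral
        (exp (- pi * (real 0)\<^sup>2 / a) / sqrt a + 2 * (\<Sum>j<N. exp (- pi * (real (Suc j))\<^sup>2 / a) / sqrt a))) ?I"
        by (intro has_integral_add has_integral_mult_right has_integral_sum coeff) auto
      then show ?thesis
        by (simp add: S_def sum_distrib_left sum_divide_distrib add_divide_distrib algebra_simps)
    qed
    have "((\<lambda>t. G 0 * (cos (2 * pi * of_int 0 * t) + 2 * (\<Sum>j<N. cos (2 * pi * of_int (int (Suc j)) * t)))) has_integral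
       (G 0 * ((if (0::int) = 0 then 1 else 0) + 2 * (\<Sum>j<N. if int (Suc j) = 0 then 1 else 0)))) ?I"
      by (intro has_integral_add has_integral_mult_right has_integral_sum integral_cos_multiple) auto
    then have 2: "((\<lambda>t. G 0 * (1 + 2 * (\<Sum>j<N. cos (2 * pi * real (Suc j) * t)))) has_integral G 0) ?I"
      by simp
    have "((\<lambda>t. h t * sin ((2 * real N + 1) * pi * t)) has_integral (S N - G 0)) ?I"
    proof (rule has_integral_eq[OF _ has_integral_diff[OF 1 2]])
      fix t assume t: "t \<in> ?I"
      have "G t - G 0 = h t * sin (pi * t)"
        using snz[OF t] by (auto simp: h_def)
      then have "(G t - G 0) * K = h t * (K * sin (pi * t))" for K by (simp add: mult_ac)
      then have "G t * K - G 0 * K = h t * (K * sin (pi * t))" for K by (simp add: left_diff_distrib)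
      then show "G t * (1 + 2 * (\<Sum>j<N. cos (2 * pi * real (Suc j) * t))) - G 0 * (1 + 2 * (\<Sum>j<N. cos (2 * pi * real (Suc j) * t)))
         = h t * sin ((2 * real N + 1) * pi * t)"
        by (simp only: dirichlet_kernel_sin)
    qed
    then show ?thesis by (rule integral_unique[symmetric])
  qed
  have "(\<lambda>N. S N - G 0) \<longlonglongrightarrow> 0"
    unfolding err by (rule riemann_lebesgue_odd_sines[OF hc])
  then have lim1: "S \<longlonglongrightarrow> G 0"
    by (simp add: LIM_zero_iff)
  have "S \<longlonglongrightarrow> (1 + 2 * theta_tail (1 / a)) / sqrt a"
    unfolding S_def theta_tail_def
    by (intro tendsto_intros summable_LIMSEQ summable_theta_tail) (use a in auto)
  with lim1 have "G 0 = (1 + 2 * theta_tail (1 / a)) / sqrt a"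
    by (rule LIMSEQ_unique)
  moreover have "G 0 = 1 + 2 * theta_tail a"
  proof -
    have f0: "f n 0 = 2 * exp (- pi * (real (Suc n))\<^sup>2 * a)" for n
      by (simp add: f_def \<phi>_def power2_eq_square algebra_simps)
    then have "(\<Sum>n. f n 0) = (\<Sum>n. 2 * exp (- pi * (real (Suc n))\<^sup>2 * a))" by (simp only: f0)
    also have "\<dots> = 2 * theta_tail a"
      unfolding theta_tail_def
      by (rule suminf_mult[OF summable_theta_tail[OF a]])
    finally show ?thesis by (simp add: G_def \<phi>_def)
  qed
  ultimately show ?thesis by simp
qed

section \<open>The Riemann xi function\<close>

lemma Gamma_exp_substitution:
  fixes z :: complex
  assumes z: "Re z > 0"
  shows "integrable lborel (\<lambda>u. exp (of_real u * z) * of_real (exp (- exp u)))"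
    and "(LINT u|lborel. exp (of_real u * z) * of_real (exp (- exp u))) = Gamma z"
proof -
  let ?f = "\<lambda>u::real. exp (of_real u * z) * of_real (exp (- exp u)) :: complex"
  let ?n = "\<lambda>u::real. exp (u * Re z) * exp (- exp u)"
  let ?h = "\<lambda>t. complex_of_real t powr (z - 1) / of_real (exp t)"
  have nf: "norm (?f u) = ?n u" for u
    by (simp add: norm_mult)
  \<comment> \<open>The substitution \<open>t = exp u\<close> in Euler's integral. It turns scaling
    of \<open>t\<close> into translation of \<open>u\<close>, and inversion of \<open>t\<close> into
    the sign change used by \<open>mellin_folding\<close>.\<close>
  have h_eq: "?h t = (1 / t) *\<^sub>R ?f (ln t)" if "t > 0" for t :: real
  proof -
    have "complex_of_real t powr (z - 1) = exp ((z - 1) * of_real (ln t))"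
      using that by (simp add: powr_def Ln_of_real)
    also have "\<dots> = exp (of_real (ln t) * z) * exp (- of_real (ln t))"
      by (simp add: exp_add[symmetric] algebra_simps)
    also have "exp (- complex_of_real (ln t)) = of_real (1 / t)"
      using that by (metis exp_ln exp_minus exp_of_real inverse_eq_divide of_real_minus)
    finally show ?thesis
      using that by (simp add: exp_minus scaleR_conv_of_real field_simps)
  qed
  have "?h absolutely_integrable_on {0<..}"
    by (rule absolutely_integrable_Gamma_integral'[OF z])
  then have habs: "set_integrable lebesgue {0<..} ?h" .
  have hcont: "continuous_on {0<..} ?h"
    by (intro continuous_intros) (auto simp: complex_nonpos_Reals_iff)
  have hlb: "set_integrable lborel {0<..} ?h"
  proof -
    have "set_borel_measurable borel {0<..} ?h"
      by (rule borel_measurable_continuous_on_indicator[unfolded set_borel_measurable_def[symmetric]]) (use hcont in auto)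
    then show ?thesis
      using habs unfolding set_integrable_def set_borel_measurable_def
      by (subst (asm) integrable_completion) auto
  qed
  have lim0: "((ereal \<circ> ln \<circ> real_of_ereal) \<longlongrightarrow> - \<infinity>) (at_right 0)"
    unfolding zero_ereal_def ereal_tendsto_simps1 by (simp add: ereal_tendsto_simps ln_at_0)
  have liminf: "((ereal \<circ> ln \<circ> real_of_ereal) \<longlongrightarrow> \<infinity>) (at_left \<infinity>)"
    unfolding ereal_tendsto_simps1 by (simp add: ereal_tendsto_simps ln_at_top)
  have ei: "einterval 0 \<infinity> = {0<..}"
    by (auto simp: einterval_def)
  have h1: "set_integrable lborel (einterval 0 \<infinity>) (\<lambda>t. (1 / t) *\<^sub>R ?f (ln t))"
    unfolding ei using hlb by (rule set_integrable_cong[THEN iffD1, rotated -1]) (auto simp: h_eq)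
  have "set_integrable lborel (einterval 0 \<infinity>) (\<lambda>t. norm ((1 / t) *\<^sub>R ?f (ln t)))"
    using h1 by (rule set_integrable_norm)
  then have h2: "set_integrable lborel (einterval 0 \<infinity>) (\<lambda>t. ?n (ln t) * (1 / t))"
    unfolding ei by (rule set_integrable_cong[THEN iffD1, rotated -1]) (auto simp: norm_mult)
  \<comment> \<open>The substitution rule for the complex integrand presupposes integrability on
    both sides; the rule for nonnegative functions, applied to the norm, supplies it.\<close>
  have "set_integrable lborel (einterval (-\<infinity>) \<infinity>) ?n"
    by (rule interval_integral_substitution_nonneg(1)[of 0 \<infinity> ln "\<lambda>t. 1 / t" ?n, OF _ _ _ _ _ _ lim0 liminf h2])
       (auto intro!: derivative_eq_intros continuous_intros)
  then have nint: "integrable lborel ?n"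
    by (simp add: set_integrable_def)
  show fint: "integrable lborel ?f"
    by (rule Bochner_Integration.integrable_bound[OF nint]) (auto simp: nf)
  have "(LBINT u=-\<infinity>..\<infinity>. ?f u) = (LBINT t=0..\<infinity>. (1 / t) *\<^sub>R ?f (ln t))"
    by (rule interval_integral_substitution_integrable[of 0 \<infinity> ln "\<lambda>t. 1 / t" ?f, OF _ _ _ _ _ lim0 liminf h1])
       (auto intro!: derivative_eq_intros continuous_intros simp: set_integrable_def fint)
  also have "\<dots> = (LINT t:{0<..}|lborel. (1 / t) *\<^sub>R ?f (ln t))"
    by (simp add: interval_lebesgue_integral_def ei)
  also have "\<dots> = (LINT t:{0<..}|lborel. ?h t)"
    by (rule set_lebesgue_integral_cong) (auto simp: h_eq)
  also have "\<dots> = integral {0<..} ?h"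
    by (rule set_borel_integral_eq_integral(2)[OF hlb])
  also have "\<dots> = Gamma z"
    using Gamma_integral_complex'[OF z] by (rule integral_unique)
  finally show "(LINT u|lborel. ?f u) = Gamma z"
    by (simp add: interval_lebesgue_integral_def set_lebesgue_integral_def)
qed

lemma Gamma_exp_substitution_scaled:
  fixes z :: complex
  assumes z: "Re z > 0" and c: "c > 0"
  shows "integrable lborel (\<lambda>u. exp (of_real u * z) * of_real (exp (- c * exp u)))"
    and "(LINT u|lborel. exp (of_real u * z) * of_real (exp (- c * exp u))) = exp (- z * of_real (ln c)) * Gamma z"
proof -
  let ?f = "\<lambda>u::real. exp (of_real u * z) * of_real (exp (- exp u)) :: complex"
  have eq: "?f (ln c + 1 * u) = exp (z * of_real (ln c)) * (exp (of_real u * z) * of_real (exp (- c * exp u)))" for u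
    using c by (simp add: exp_add algebra_simps)
  have "integrable lborel (\<lambda>u. ?f (ln c + 1 * u))"
    by (rule lborel_integrable_real_affine[OF Gamma_exp_substitution(1)[OF z]]) simp
  then show "integrable lborel (\<lambda>u. exp (of_real u * z) * of_real (exp (- c * exp u)))"
    using integrable_mult_right[of "exp (- (z * of_real (ln c)))" lborel "\<lambda>u. ?f (ln c + 1 * u)"]
    unfolding eq by (simp add: mult.assoc[symmetric] exp_add[symmetric])
  have "Gamma z = (LINT u|lborel. ?f (ln c + 1 * u))"
    using lborel_integral_real_affine[of 1 ?f "ln c"] Gamma_exp_substitution(2)[OF z] by simp
  also have "\<dots> = exp (z * of_real (ln c)) * (LINT u|lborel. exp (of_real u * z) * of_real (exp (- c * exp u)))"
    unfolding eq by simp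
  finally show "(LINT u|lborel. exp (of_real u * z) * of_real (exp (- c * exp u))) = exp (- z * of_real (ln c)) * Gamma z"
    by (simp add: exp_minus field_simps)
qed

lemma theta_tail_nonneg: "x > 0 \<Longrightarrow> theta_tail x \<ge> 0"
  unfolding theta_tail_def by (intro suminf_nonneg summable_theta_tail) auto

lemma continuous_on_theta_tail: "continuous_on {0<..} theta_tail"
proof (rule continuous_at_imp_continuous_on, rule ballI)
  fix x :: real assume "x \<in> {0<..}"
  then have x: "x > 0" by simp
  have "continuous_on {x/2..} theta_tail"
    unfolding theta_tail_def[abs_def]
  proof (rule uniform_limit_theorem)
    show "uniform_limit {x/2..} (\<lambda>N x. \<Sum>n<N. exp (- pi * (real (Suc n))\<^sup>2 * x)) (\<lambda>x. \<Sum>n. exp (- pi * (real (Suc n))\<^sup>2 * x)) sequentially"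
    proof (rule Weierstrass_m_test)
      show "summable (\<lambda>n. exp (- pi * (x/2)) ^ n)"
        using x by (intro summable_geometric) auto
      show "norm (exp (- pi * (real (Suc n))\<^sup>2 * y)) \<le> exp (- pi * (x/2)) ^ n" if "y \<in> {x/2..}" for y n
        using theta_tail_term_bound[of "x/2" y n] x that by simp
    qed
  qed (auto intro!: always_eventually continuous_intros)
  then show "isCont theta_tail x"
    by (rule continuous_on_interior) (use x in auto)
qed

lemma continuous_on_theta_tail_exp: "continuous_on S (\<lambda>u. theta_tail (exp u))"
  by (rule continuous_on_compose2[OF continuous_on_theta_tail]) (auto intro!: continuous_intros)

lemma dirichlet_term:
  fixes s :: complex
  shows
  "exp (- (s / 2) * of_real (ln (pi * (real (Suc n))\<^sup>2))) = of_real pi powr (- s / 2) * (1 / of_nat (Suc n) powr s)"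
proof -
  have "ln (pi * (real (Suc n))\<^sup>2) = ln pi + 2 * ln (real (Suc n))"
    by (simp add: ln_mult ln_realpow del: of_nat_Suc)
  then have "exp (- (s / 2) * of_real (ln (pi * (real (Suc n))\<^sup>2))) = exp (- (s / 2) * of_real (ln pi)) * exp (- (s * of_real (ln (real (Suc n)))))"
    by (simp add: exp_add[symmetric] algebra_simps del: of_nat_Suc)
  moreover have "of_nat (Suc n) powr s = exp (s * complex_of_real (ln (real (Suc n))))"
    by (simp add: powr_def Ln_of_nat del: of_nat_Suc)
  moreover have "complex_of_real pi powr (- s / 2) = exp (- (s / 2) * of_real (ln pi))"
    by (simp add: powr_def Ln_of_real)
  ultimately show ?thesis by (simp add: exp_minus field_simps del: of_nat_Suc)
qed

text \<open>The Mellin integrand of \<open>theta_tail\<close> at \<open>s / 2\<close> after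
  \<open>x = exp u\<close>, where \<open>dx / x\<close> becomes \<open>du\<close>.\<close>

definition xi_integrand :: "complex \<Rightarrow> real \<Rightarrow> complex" where
  "xi_integrand s u = of_real (theta_tail (exp u)) * exp (of_real u * (s / 2))"

text \<open>Termwise integration: each Gaussian contributes a Gamma integral scaled by
  \<open>pi * (n + 1)^2\<close>. The interchange is justified by the convergence of the Dirichlet
  series at \<open>Re s\<close>.\<close>

lemma theta_mellin:
  fixes s :: complex
  assumes s: "Re s > 1"
  shows "integrable lborel (xi_integrand s)"
    and "(\<lambda>n. of_real pi powr (- s / 2) * Gamma (s / 2) * (1 / of_nat (Suc n) powr s)) sums
           (LINT u|lborel. xi_integrand s u)"
proof -
  define c where "c n = pi * (real (Suc n))\<^sup>2" for n
  have c: "c n > 0" for n by (auto simp: c_def)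
  define f where "f n u = exp (of_real u * (s/2)) * complex_of_real (exp (- c n * exp u))" for n u
  define g where "g n u = exp (of_real u * of_real (Re s/2)) * complex_of_real (exp (- c n * exp u))" for n u
  have s2: "Re (s/2) > 0" "Re (of_real (Re s/2)) > 0" using s by auto
  have fint: "integrable lborel (f n)" for n
    unfolding f_def by (rule Gamma_exp_substitution_scaled(1)[OF s2(1) c])
  have fval: "(LINT u|lborel. f n u) = of_real pi powr (- s / 2) * Gamma (s / 2) * (1 / of_nat (Suc n) powr s)" for n
    unfolding f_def Gamma_exp_substitution_scaled(2)[OF s2(1) c]
    by (simp only: c_def dirichlet_term) (simp add: mult_ac)
  have gn: "complex_of_real (norm (f n u)) = g n u" for n u
    by (simp add: f_def g_def norm_mult exp_of_real[symmetric])
  \<comment> \<open>The norm of \<open>f n\<close> is the same integrand at the real exponent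
    \<open>Re s\<close>, so the complex formula also evaluates the integral of the norm.\<close>
  have nval: "(LINT u|lborel. norm (f n u)) = pi powr (- Re s / 2) * Gamma (Re s / 2) * real (Suc n) powr (- Re s)" for n
  proof -
    have "complex_of_real (LINT u|lborel. norm (f n u)) = (LINT u|lborel. g n u)"
      by (simp only: integral_complex_of_real[symmetric] gn)
    also have "\<dots> = exp (- of_real (Re s / 2) * of_real (ln (c n))) * Gamma (of_real (Re s/2))"
      unfolding g_def by (rule Gamma_exp_substitution_scaled(2)[OF s2(2) c])
    also have "\<dots> = of_real (exp (- (Re s / 2) * ln (c n)) * Gamma (Re s / 2))"
      using Gamma_complex_of_real[of "Re s / 2"] by (simp flip: exp_of_real)
    finally have "(LINT u|lborel. norm (f n u)) = exp (- (Re s / 2) * ln (c n)) * Gamma (Re s / 2)"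
      by (simp only: of_real_eq_iff)
    also have "ln (c n) = ln pi + 2 * ln (real (Suc n))"
      by (simp add: c_def ln_mult ln_realpow del: of_nat_Suc)
    also have "exp (- (Re s / 2) * (ln pi + 2 * ln (real (Suc n)))) = pi powr (- Re s / 2) * real (Suc n) powr (- Re s)"
      by (simp add: powr_def exp_add[symmetric] algebra_simps del: of_nat_Suc)
    finally show ?thesis by (simp add: mult_ac)
  qed
  have fsum: "(\<lambda>n. f n u) sums xi_integrand s u" for u
  proof -
    have "(\<lambda>n. exp (- pi * (real (Suc n))\<^sup>2 * exp u)) sums theta_tail (exp u)"
      unfolding theta_tail_def by (intro summable_sums summable_theta_tail) simp
    then have "(\<lambda>n. complex_of_real (exp (- pi * (real (Suc n))\<^sup>2 * exp u))) sums of_real (theta_tail (exp u))"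
      by (rule sums_of_real)
    from sums_mult2[OF this, of "exp (of_real u * (s / 2))"] show ?thesis
      by (simp add: f_def c_def xi_integrand_def mult_ac)
  qed
  have fnorm: "summable (\<lambda>n. norm (f n u))" for u
  proof -
    have "norm (f n u) = exp (u * Re s / 2) * exp (- pi * (real (Suc n))\<^sup>2 * exp u)" for n
      by (simp add: f_def c_def norm_mult)
    then show ?thesis using summable_theta_tail[of "exp u"] by (simp only: summable_mult) (simp add: summable_mult)
  qed
  have "summable (\<lambda>n. real (Suc n) powr (- Re s))"
    using s by (subst summable_Suc_iff) (simp add: summable_real_powr_iff)
  then have nsum: "summable (\<lambda>n. LINT u|lborel. norm (f n u))"
    unfolding nval by (intro summable_mult)
  have eq: "(\<lambda>u. \<Sum>n. f n u) = xi_integrand s"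
    using fsum by (auto simp: sums_iff)
  show "integrable lborel (xi_integrand s)"
    using integrable_suminf[OF fint _ nsum] fnorm by (simp add: eq)
  show "(\<lambda>n. of_real pi powr (- s / 2) * Gamma (s / 2) * (1 / of_nat (Suc n) powr s)) sums
           (LINT u|lborel. xi_integrand s u)"
    using sums_integral[OF fint _ nsum] fnorm by (simp only: eq fval) simp
qed

section \<open>The half-line Mellin integral and xi as an entire function\<close>

lemma set_borel_measurable_lborel_continuous_on:
  fixes f :: "real \<Rightarrow> 'a::real_normed_vector"
  assumes "A \<in> sets borel" "continuous_on A f"
  shows "set_borel_measurable lborel A f"
  using borel_measurable_continuous_on_indicator[OF assms] by (simp add: set_borel_measurable_def)

text \<open>The part of the Mellin integral with \<open>exp u >= 1\<close>; there
  \<open>theta_tail\<close> decays so fast that every \<open>s\<close> is admissible.\<close>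

definition xi_mellin :: "complex \<Rightarrow> complex" where
  "xi_mellin s = (LINT u:{0..}|lborel. xi_integrand s u)"

text \<open>What \<open>mellin_folding\<close> gives after multiplication by
  \<open>s * (s - 1) / 2\<close>: the polar term \<open>1 / (s * (s - 1))\<close> becomes the
  constant \<open>1 / 2\<close>. In this form holomorphy and the symmetry under
  \<open>s -> 1 - s\<close> are visible.\<close>

definition entire_xi :: "complex \<Rightarrow> complex" where
  "entire_xi s = 1 / 2 + s * (s - 1) / 2 * (xi_mellin s + xi_mellin (1 - s))"

text \<open>The norm of \<open>xi_integrand s\<close> for \<open>Re s\<close> equal to \<sigma>. It
  grows with \<sigma> when \<open>u >= 0\<close>, so one integrable weight dominates the integrand
  on a whole left half plane, uniformly in \<open>Im s\<close>.\<close>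

definition mellin_weight :: "real \<Rightarrow> real \<Rightarrow> real" where
  "mellin_weight \<sigma> u = theta_tail (exp u) * exp (u * (\<sigma> / 2))"

lemma continuous_on_xi_integrand: "continuous_on S (xi_integrand s)"
  unfolding xi_integrand_def by (intro continuous_intros continuous_on_theta_tail_exp)

lemma norm_xi_integrand: "norm (xi_integrand s u) = mellin_weight (Re s) u"
  using theta_tail_nonneg[of "exp u"] by (simp add: norm_mult mellin_weight_def xi_integrand_def)

lemma mellin_weight_nonneg: "mellin_weight \<sigma> u \<ge> 0"
  using theta_tail_nonneg[of "exp u"] by (simp add: mellin_weight_def)

lemma mellin_weight_mono: "u \<ge> 0 \<Longrightarrow> \<sigma> \<le> \<sigma>' \<Longrightarrow> mellin_weight \<sigma> u \<le> mellin_weight \<sigma>' u"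
  using theta_tail_nonneg[of "exp u"] unfolding mellin_weight_def
  by (intro mult_left_mono) (auto intro!: mult_left_mono)

lemma set_integrable_xi_integrand: "set_integrable lborel {0..} (xi_integrand s)"
proof (rule set_integrable_bound)
  \<comment> \<open>The exponent is raised to at least 2 to enter the range of
    \<open>theta_mellin\<close>; on \<open>u >= 0\<close> this only enlarges the norm.\<close>
  let ?s = "complex_of_real (max 2 (Re s))"
  show "set_integrable lborel {0..} (xi_integrand ?s)"
    unfolding set_integrable_def by (rule integrable_mult_indicator, simp, rule theta_mellin(1)) simp
  show "set_borel_measurable lborel {0..} (xi_integrand s)"
    by (rule set_borel_measurable_lborel_continuous_on) (simp, rule continuous_on_xi_integrand)
  show "AE u in lborel. u \<in> {0..} \<longrightarrow> norm (xi_integrand s u) \<le> norm (xi_integrand ?s u)"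
    unfolding norm_xi_integrand by (auto intro!: mellin_weight_mono)
qed

lemma set_integrable_mellin_weight: "set_integrable lborel {0..} (mellin_weight \<sigma>)"
  using set_integrable_norm[OF set_integrable_xi_integrand[of "of_real \<sigma>"]]
  unfolding norm_xi_integrand by simp

lemma norm_xi_mellin_le:
  assumes "Re s \<le> \<sigma>"
  shows "norm (xi_mellin s) \<le> (LINT u:{0..}|lborel. mellin_weight \<sigma> u)"
proof -
  have "norm (xi_mellin s) \<le> (LINT u:{0..}|lborel. norm (xi_integrand s u))"
    unfolding xi_mellin_def by (rule set_integral_norm_bound[OF set_integrable_xi_integrand])
  also have "\<dots> \<le> (LINT u:{0..}|lborel. mellin_weight \<sigma> u)"
    unfolding norm_xi_integrand
    by (rule set_integral_mono[OF set_integrable_mellin_weight set_integrable_mellin_weight])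
       (use assms in \<open>auto intro: mellin_weight_mono\<close>)
  finally show ?thesis .
qed

text \<open>The truncations to \<open>[0, N]\<close> are holomorphic by differentiation under the
  integral sign, and they converge uniformly on unit discs, since the remainder is at most the tail
  of the integral of a single \<open>mellin_weight\<close>.\<close>

lemma holomorphic_xi_mellin: "xi_mellin holomorphic_on A"
proof (rule holomorphic_on_subset)
  let ?g = xi_integrand
  let ?f = "\<lambda>N::nat. \<lambda>s. integral (cbox 0 (real N)) (?g s)"
  show "xi_mellin holomorphic_on UNIV"
  proof (rule holomorphic_uniform_sequence[of UNIV ?f])
    show "?f N holomorphic_on UNIV" for N
    proof (rule leibniz_rule_holomorphic)
      show "((\<lambda>s. ?g s u) has_field_derivative of_real (theta_tail (exp u)) * (exp (complex_of_real u * (s / 2)) * (of_real u / 2))) (at s within UNIV)" for s u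
        unfolding xi_integrand_def by (auto intro!: derivative_eq_intros)
      show "?g s integrable_on cbox 0 (real N)" for s
        by (rule integrable_continuous) (rule continuous_on_xi_integrand)
      have "continuous_on (UNIV \<times> cbox 0 (real N)) (\<lambda>p. complex_of_real (theta_tail (exp (snd p))) * (exp (of_real (snd p) * (fst p / 2)) * (of_real (snd p) / 2)))"
        by (intro continuous_intros continuous_on_compose2[OF continuous_on_theta_tail_exp[of UNIV]]) auto
      then show "continuous_on (UNIV \<times> cbox 0 (real N)) (\<lambda>(s, u). complex_of_real (theta_tail (exp u)) * (exp (of_real u * (s / 2)) * (of_real u / 2)))"
        by (simp add: case_prod_beta)
    qed auto
    show "\<exists>d>0. cball s0 d \<subseteq> UNIV \<and> uniform_limit (cball s0 d) ?f xi_mellin sequentially" for s0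
    proof (intro exI[of _ 1] conjI)
      define \<sigma> where "\<sigma> = Re s0 + 1"
      define T where "T N = (LINT u:{real N<..}|lborel. mellin_weight \<sigma> u)" for N :: nat
      have bound: "norm (?f N s - xi_mellin s) \<le> T N" if "s \<in> cball s0 1" for s N
      proof -
        have "\<bar>Re (s - s0)\<bar> \<le> 1"
          using that abs_Re_le_cmod[of "s - s0"] by (simp add: dist_norm norm_minus_commute)
        then have \<sigma>: "Re s \<le> \<sigma>" by (simp add: \<sigma>_def)
        have i1: "set_integrable lborel {0..real N} (?g s)" and i2: "set_integrable lborel {real N<..} (?g s)"
          by (rule set_integrable_subset[OF set_integrable_xi_integrand]; force)+
        have w2: "set_integrable lborel {real N<..} (mellin_weight x)" for x
          by (rule set_integrable_subset[OF set_integrable_mellin_weight]) auto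
        have "{0..} = {0..real N} \<union> {real N<..}" by auto
        then have "xi_mellin s = (LINT u:{0..real N}|lborel. ?g s u) + (LINT u:{real N<..}|lborel. ?g s u)"
          unfolding xi_mellin_def by (simp only:) (rule set_integral_Un[OF _ i1 i2], auto)
        also have "(LINT u:{0..real N}|lborel. ?g s u) = ?f N s"
          using set_borel_integral_eq_integral(2)[OF i1] by simp
        finally have "norm (?f N s - xi_mellin s) = norm (LINT u:{real N<..}|lborel. ?g s u)"
          by (simp add: norm_minus_commute)
        also have "\<dots> \<le> (LINT u:{real N<..}|lborel. norm (?g s u))"
          by (rule set_integral_norm_bound[OF i2])
        also have "\<dots> \<le> T N"
          unfolding norm_xi_integrand T_def
          by (rule set_integral_mono[OF w2 w2]) (use \<sigma> in \<open>auto intro!: mellin_weight_mono\<close>)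
        finally show ?thesis .
      qed
      have "T \<longlonglongrightarrow> (LINT u::real|lborel. 0)"
        unfolding T_def set_lebesgue_integral_def
      proof (rule Bochner_Integration.integral_dominated_convergence[where M = lborel and f = "\<lambda>u. 0"
            and s = "\<lambda>N u. indicat_real {real N<..} u *\<^sub>R mellin_weight \<sigma> u"
            and w = "\<lambda>u. indicat_real {0..} u *\<^sub>R mellin_weight \<sigma> u"])
        show "integrable lborel (\<lambda>u. indicator {0..} u *\<^sub>R mellin_weight \<sigma> u)"
          using set_integrable_mellin_weight unfolding set_integrable_def .
        show "AE u in lborel. (\<lambda>N. indicator {real N<..} u *\<^sub>R mellin_weight \<sigma> u) \<longlonglongrightarrow> 0"
        proof (rule AE_I2)
          fix u :: real
          have "eventually (\<lambda>N. indicator {real N<..} u *\<^sub>R mellin_weight \<sigma> u = 0) sequentially"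
            using eventually_ge_at_top[of "nat \<lceil>u\<rceil>"]
            by eventually_elim (auto simp: indicator_def)
          then show "(\<lambda>N. indicator {real N<..} u *\<^sub>R mellin_weight \<sigma> u) \<longlonglongrightarrow> 0"
            by (rule tendsto_eventually)
        qed
        show "AE u in lborel. norm (indicator {real N<..} u *\<^sub>R mellin_weight \<sigma> u) \<le> indicator {0..} u *\<^sub>R mellin_weight \<sigma> u" for N
          using mellin_weight_nonneg by (auto simp: indicator_def)
        have "set_integrable lborel {real N<..} (mellin_weight \<sigma>)" for N
          by (rule set_integrable_subset[OF set_integrable_mellin_weight]) auto
        then show "(\<lambda>u. indicator {real N<..} u *\<^sub>R mellin_weight \<sigma> u) \<in> borel_measurable lborel" for N
          unfolding set_integrable_def by (rule borel_measurable_integrable)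
      qed simp
      then have "T \<longlonglongrightarrow> 0" by simp
      show "uniform_limit (cball s0 1) ?f xi_mellin sequentially"
      proof (rule uniform_limitI)
        fix e :: real assume "e > 0"
        with \<open>T \<longlonglongrightarrow> 0\<close> have "eventually (\<lambda>N. T N < e) sequentially"
          by (rule order_tendstoD(2))
        then show "\<forall>\<^sub>F N in sequentially. \<forall>s\<in>cball s0 1. dist (?f N s) (xi_mellin s) < e"
        proof eventually_elim
          case (elim N)
          have "dist (?f N s) (xi_mellin s) < e" if "s \<in> cball s0 1" for s
            unfolding dist_norm using bound[OF that, of N] elim by (rule le_less_trans)
          then show ?case by blast
        qed
      qed
    qed auto
  qed auto
qed auto

lemma holomorphic_entire_xi: "entire_xi holomorphic_on A"
proof -
  have "(\<lambda>s. 1 - s) holomorphic_on A" by (intro holomorphic_intros)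
  from holomorphic_on_compose_gen[OF this holomorphic_xi_mellin[of UNIV]]
  have "(\<lambda>s. xi_mellin (1 - s)) holomorphic_on A" by (simp add: o_def)
  then show ?thesis
    unfolding entire_xi_def by (intro holomorphic_intros holomorphic_xi_mellin) auto
qed

lemma entire_xi_reflect: "entire_xi (1 - s) = entire_xi s"
  by (simp add: entire_xi_def algebra_simps)

lemma cnj_xi_mellin: "cnj (xi_mellin s) = xi_mellin (cnj s)"
proof -
  let ?f = "\<lambda>u. indicat_real {0..} u *\<^sub>R xi_integrand s u"
  have "xi_mellin (cnj s) = (LINT u|lborel. cnj (?f u))"
    unfolding xi_mellin_def set_lebesgue_integral_def
    by (rule Bochner_Integration.integral_cong) (simp_all add: xi_integrand_def exp_cnj)
  also have "\<dots> = cnj (LINT u|lborel. ?f u)"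
    by (rule Bochner_Integration.integral_cnj)
  finally show ?thesis by (simp add: xi_mellin_def set_lebesgue_integral_def)
qed

lemma cnj_entire_xi: "cnj (entire_xi s) = entire_xi (cnj s)"
  by (simp add: entire_xi_def cnj_xi_mellin)

section \<open>Folding the Mellin integral at \<open>u = 0\<close>\<close>

lemma exp_primitive_limits:
  fixes c :: "'a::{real_normed_field,banach}"
  assumes c: "c \<noteq> 0" and lim: "((\<lambda>u. exp (of_real u * c)) \<longlongrightarrow> 0) at_top"
  shows "(((\<lambda>u. exp (of_real u * c) / c) \<circ> real_of_ereal) \<longlongrightarrow> 1 / c) (at_right 0)"
    and "(((\<lambda>u. exp (of_real u * c) / c) \<circ> real_of_ereal) \<longlongrightarrow> 0) (at_left \<infinity>)"
proof -
  have "isCont (\<lambda>u. exp (of_real u * c) / c) 0"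
    by (intro continuous_intros) (use c in auto)
  then have "((\<lambda>u. exp (of_real u * c) / c) \<longlongrightarrow> 1 / c) (at_right 0)"
    by (simp add: isCont_def filterlim_at_split)
  then show "(((\<lambda>u. exp (of_real u * c) / c) \<circ> real_of_ereal) \<longlongrightarrow> 1 / c) (at_right 0)"
    unfolding zero_ereal_def by (simp add: ereal_tendsto_simps)
  show "(((\<lambda>u. exp (of_real u * c) / c) \<circ> real_of_ereal) \<longlongrightarrow> 0) (at_left \<infinity>)"
    using tendsto_divide_zero[OF lim, of c] by (simp add: ereal_tendsto_simps)
qed

lemma exp_decay_integral:
  fixes c :: complex
  assumes c: "Re c < 0"
  shows "set_integrable lborel {0..} (\<lambda>u. exp (complex_of_real u * c))"
    and "(LINT u:{0..}|lborel. exp (complex_of_real u * c)) = - 1 / c"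
proof -
  have ei: "einterval 0 \<infinity> = {0<..}"
    by (auto simp: einterval_def)
  have c0: "c \<noteq> 0" using c by auto
  have lim: "((\<lambda>u. exp (u * Re c)) \<longlongrightarrow> 0) at_top"
    using c by (auto intro!: filterlim_compose[OF exp_at_bot] filterlim_tendsto_neg_mult_at_bot simp: filterlim_ident mult.commute[of _ "Re c"])
  have "((\<lambda>u. norm (exp (complex_of_real u * c))) \<longlongrightarrow> 0) at_top" using lim by simp
  then have clim: "((\<lambda>u. exp (complex_of_real u * c)) \<longlongrightarrow> 0) at_top" by (rule tendsto_norm_zero_cancel)
  \<comment> \<open>The real primitive yields integrability of the norm
    \<open>exp (u * Re c)\<close>; only then does the complex primitive give the value.\<close>
  have rlim: "(((\<lambda>u. exp (u * Re c) / Re c) \<circ> real_of_ereal) \<longlongrightarrow> 1 / Re c) (at_right 0)"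
    "(((\<lambda>u. exp (u * Re c) / Re c) \<circ> real_of_ereal) \<longlongrightarrow> 0) (at_left \<infinity>)"
    using exp_primitive_limits[of "Re c"] c lim by simp_all
  have "set_integrable lborel (einterval 0 \<infinity>) (\<lambda>u. exp (u * Re c))"
    by (rule interval_integral_FTC_nonneg(1)[OF _ _ _ _ rlim])
       (use c in \<open>auto intro!: derivative_eq_intros continuous_intros\<close>)
  then have nint: "set_integrable lborel {0<..} (\<lambda>u. exp (u * Re c))"
    unfolding ei .
  have fint: "set_integrable lborel {0<..} (\<lambda>u. exp (complex_of_real u * c))"
  proof (rule set_integrable_bound[OF nint])
    show "set_borel_measurable lborel {0<..} (\<lambda>u. exp (complex_of_real u * c))"
      by (rule set_borel_measurable_lborel_continuous_on) (auto intro!: continuous_intros)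
  qed auto
  have s0: "set_integrable lborel {0..0} (\<lambda>u. exp (complex_of_real u * c))"
    by (rule borel_integrable_atLeastAtMost') (auto intro!: continuous_intros)
  have un: "{0..} = {0..0} \<union> {(0::real)<..}" by auto
  show "set_integrable lborel {0..} (\<lambda>u. exp (complex_of_real u * c))"
    unfolding un by (rule set_integrable_Un[OF s0 fint]) auto
  have der: "((\<lambda>u. exp (complex_of_real u * c) / c) has_vector_derivative exp (complex_of_real u * c)) (at u)" for u
  proof -
    have "((\<lambda>w. exp (w * c) / c) has_field_derivative exp (of_real u * c)) (at (of_real u))"
      using c0 by (auto intro!: derivative_eq_intros)
    from has_vector_derivative_real_field[OF this] show ?thesis .
  qed
  have "(LBINT u=0..\<infinity>. exp (complex_of_real u * c)) = 0 - 1 / c"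
    by (rule interval_integral_FTC_integrable[OF _ der _ _ exp_primitive_limits[OF c0 clim]])
       (use fint ei in \<open>auto intro!: continuous_intros\<close>)
  then have "(LINT u:{0<..}|lborel. exp (complex_of_real u * c)) = - 1 / c"
    by (simp add: interval_lebesgue_integral_def ei)
  moreover have "(LINT u:{0..}|lborel. exp (complex_of_real u * c)) = (LINT u:{0..0}|lborel. exp (complex_of_real u * c)) + (LINT u:{0<..}|lborel. exp (complex_of_real u * c))"
    unfolding un by (rule set_integral_Un[OF _ s0 fint]) auto
  moreover have "(LINT u:{0..0}|lborel. exp (complex_of_real u * c)) = 0"
    using set_borel_integral_eq_integral(2)[OF s0] by simp
  ultimately show "(LINT u:{0..}|lborel. exp (complex_of_real u * c)) = - 1 / c" by simp
qed

text \<open>In the variable \<open>u = ln x\<close> the functional equation of the theta function relates the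
  integrand at \<open>u\<close> and \<open>- u\<close>, which folds the Mellin integral onto the half line.\<close>

lemma theta_tail_exp_minus:
  "theta_tail (exp (- u)) = exp (u / 2) * theta_tail (exp u) + (exp (u / 2) - 1) / 2"
proof -
  have 1: "sqrt (exp (- u)) = inverse (exp (u / 2))"
    by (intro real_sqrt_unique) (simp_all add: power2_eq_square exp_minus[symmetric] exp_add[symmetric])
  have 2: "1 / exp (- u) = exp u"
    by (simp add: exp_minus field_simps)
  have "1 + 2 * theta_tail (exp (- u)) = (1 + 2 * theta_tail (exp u)) / inverse (exp (u / 2))"
    using theta_tail_inverse[OF exp_gt_zero, of "- u"] unfolding 1 2 .
  also have "\<dots> = (1 + 2 * theta_tail (exp u)) * exp (u / 2)"
    by (simp only: divide_inverse inverse_inverse_eq)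
  finally have "2 * theta_tail (exp (- u)) = exp (u / 2) + 2 * (theta_tail (exp u) * exp (u / 2)) - 1"
    by (simp add: distrib_right)
  moreover have "a = x * b + (x - 1) / 2" if "2 * a = x + 2 * (b * x) - 1" for a b x :: real
    using that by (simp add: field_simps)
  ultimately show ?thesis by blast
qed

text \<open>The negative half line is reflected to \<open>xi_integrand (1 - s)\<close> plus the two
  exponentials from \<open>theta_tail_exp_minus\<close>. Their integrals \<open>2 / (s - 1)\<close>
  and \<open>2 / s\<close> converge for \<open>Re s > 1\<close>, and half their difference is the
  rational term.\<close>

lemma mellin_folding:
  assumes s: "Re s > 1"
  shows "(LINT u|lborel. xi_integrand s u) = xi_mellin s + xi_mellin (1 - s) + 1 / (s * (s - 1))"
proof -
  let ?g = "xi_integrand s"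
  let ?h = "xi_integrand (1 - s)"
  let ?e = "\<lambda>c u. exp (complex_of_real u * c)"
  have int: "integrable lborel ?g" by (rule theta_mellin(1)[OF s])
  have sint: "set_integrable lborel A ?g" if "A \<in> sets lborel" for A
    unfolding set_integrable_def using that int by (rule integrable_mult_indicator)
  have un: "UNIV = {0..} \<union> {..0::real}" by auto
  have "(LINT u|lborel. ?g u) = (LINT u:UNIV|lborel. ?g u)"
    by (simp add: set_lebesgue_integral_def)
  also have "\<dots> = (LINT u:{0..}|lborel. ?g u) + (LINT u:{..0}|lborel. ?g u)"
    unfolding un
  proof (rule set_integral_Un_AE)
    show "AE x in lborel. \<not> (x \<in> {0..} \<and> x \<in> {..0::real})"
      using AE_lborel_singleton[of "0::real"] by eventually_elim auto
    show "set_integrable lborel {0..} ?g" "set_integrable lborel {..0} ?g"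
      by (rule sint, simp)+
  qed auto
  also have "(LINT u:{..0}|lborel. ?g u) = (LINT u:{0..}|lborel. ?g (- u))"
    unfolding set_lebesgue_integral_def
    by (subst lborel_integral_real_affine[of "-1" _ 0]) (auto intro!: Bochner_Integration.integral_cong simp: indicator_def)
  also have "\<dots> = (LINT u:{0..}|lborel. ?h u + (1/2) * (?e ((1 - s) / 2) u - ?e (- s / 2) u))"
  proof (rule set_lebesgue_integral_cong)
    show "\<forall>u. u \<in> {0..} \<longrightarrow> ?g (- u) = ?h u + (1/2) * (?e ((1 - s) / 2) u - ?e (- s / 2) u)"
    proof (intro allI impI)
      fix u :: real
      have "?g (- u) = of_real (exp (u / 2) * theta_tail (exp u) + (exp (u / 2) - 1) / 2) * ?e (- s / 2) u"
        by (simp only: xi_integrand_def theta_tail_exp_minus) simp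
      also have "\<dots> = of_real (theta_tail (exp u)) * (exp (of_real u / 2) * ?e (- s / 2) u) + (1/2) * (exp (of_real u / 2) * ?e (- s / 2) u - ?e (- s / 2) u)"
        by (simp add: algebra_simps exp_of_real[symmetric] diff_divide_distrib)
      also have "exp (of_real u / 2) * ?e (- s / 2) u = ?e ((1 - s) / 2) u"
        by (simp add: exp_add[symmetric] algebra_simps diff_divide_distrib)
      finally show "?g (- u) = ?h u + (1/2) * (?e ((1 - s) / 2) u - ?e (- s / 2) u)"
        by (simp only: xi_integrand_def)
    qed
  qed auto
  also have "\<dots> = (LINT u:{0..}|lborel. ?h u) + (1/2) * ((LINT u:{0..}|lborel. ?e ((1 - s) / 2) u) - (LINT u:{0..}|lborel. ?e (- s / 2) u))"
  proof -
    have e: "set_integrable lborel {0..} (?e ((1 - s) / 2))" "set_integrable lborel {0..} (?e (- s / 2))"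
      by (rule exp_decay_integral(1); use s in simp)+
    have d: "set_integrable lborel {0..} (\<lambda>u. ?e ((1 - s) / 2) u - ?e (- s / 2) u)"
      by (rule set_integral_diff(1)[OF e])
    show ?thesis
      by (simp only: set_integral_add(2)[OF set_integrable_xi_integrand set_integrable_mult_right[OF d]] set_integral_mult_right set_integral_diff(2)[OF e])
  qed
  also have "(LINT u:{0..}|lborel. ?e ((1 - s) / 2) u) = - 1 / ((1 - s) / 2)"
    by (rule exp_decay_integral(2)) (use s in simp)
  also have "(LINT u:{0..}|lborel. ?e (- s / 2) u) = - 1 / (- s / 2)"
    by (rule exp_decay_integral(2)) (use s in simp)
  also have "(1/2) * (- 1 / ((1 - s) / 2) - - 1 / (- s / 2)) = 1 / (s * (s - 1))"
  proof -
    have "s \<noteq> 0" "s \<noteq> 1" using s by auto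
    then show ?thesis by (simp add: divide_simps)
  qed
  finally show ?thesis by (simp add: xi_mellin_def add.assoc)
qed

text \<open>The Dirichlet sum is only called \<open>D\<close>, because nothing can be said about the
  choice \<open>riemann_zeta\<close> before \<open>riemann_zeta_exists\<close>.\<close>

lemma entire_xi_eq:
  assumes s: "Re s > 1"
  obtains D where "(\<lambda>n. 1 / of_nat (Suc n) powr s) sums D"
    and "entire_xi s = s * (s - 1) / 2 * of_real pi powr (- s / 2) * Gamma (s / 2) * D"
proof -
  let ?c = "of_real pi powr (- s / 2) * Gamma (s / 2)"
  let ?I = "LINT u|lborel. xi_integrand s u"
  have nz: "s \<noteq> 0" "s - 1 \<noteq> 0" using s by auto
  have "s / 2 \<notin> \<int>\<^sub>\<le>\<^sub>0"
    using s by (auto elim!: nonpos_Ints_cases simp: complex_eq_iff)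
  then have c: "?c \<noteq> 0" by (auto simp: Gamma_eq_zero_iff)
  have "(\<lambda>n. ?c * (1 / of_nat (Suc n) powr s) / ?c) sums (?I / ?c)"
    by (intro sums_divide theta_mellin(2)[OF s])
  then have 1: "(\<lambda>n. 1 / of_nat (Suc n) powr s) sums (?I / ?c)"
    unfolding nonzero_mult_div_cancel_left[OF c] .
  have "entire_xi s = s * (s - 1) / 2 * ?I"
    unfolding mellin_folding[OF s] entire_xi_def using nz by (simp add: distrib_left add.commute)
  then have "entire_xi s = s * (s - 1) / 2 * of_real pi powr (- s / 2) * Gamma (s / 2) * (?I / ?c)"
    using c by simp
  with 1 show ?thesis by (rule that)
qed

text \<open>The witness solves the product formula of xi for zeta. The factor \<open>s / 2\<close>
  is absorbed into \<open>rGamma (s / 2 + 1)\<close>, which is entire, so that \<open>s = 1\<close>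
  is the only possible singularity.\<close>

lemma riemann_zeta_exists:
  "\<exists>f. f holomorphic_on (- {1}) \<and> (\<forall>s. 1 < Re s \<longrightarrow> (\<lambda>n. 1 / (of_nat (Suc n)) powr s) sums f s)"
proof -
  define f where "f s = entire_xi s * of_real pi powr (s / 2) * rGamma (s / 2 + 1) / (s - 1)" for s
  have "f holomorphic_on (- {1})"
    unfolding f_def by (intro holomorphic_intros holomorphic_entire_xi) auto
  moreover have "(\<lambda>n. 1 / (of_nat (Suc n)) powr s) sums f s" if s: "1 < Re s" for s
  proof -
    from entire_xi_eq[OF s] obtain D where D: "(\<lambda>n. 1 / of_nat (Suc n) powr s) sums D"
      and xi: "entire_xi s = s * (s - 1) / 2 * of_real pi powr (- s / 2) * Gamma (s / 2) * D" .
    have nz: "s \<noteq> 0" "s - 1 \<noteq> 0" using s by auto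
    have G: "Gamma (s / 2) * rGamma (s / 2) = 1"
    proof -
      have "s / 2 \<notin> \<int>\<^sub>\<le>\<^sub>0"
        using s by (auto elim!: nonpos_Ints_cases simp: complex_eq_iff)
      then show ?thesis by (simp add: rGamma_inverse_Gamma Gamma_eq_zero_iff)
    qed
    have p: "complex_of_real pi powr (- s / 2) * of_real pi powr (s / 2) = 1"
      by (simp add: powr_def exp_add[symmetric])
    have "f s = (complex_of_real pi powr (- s / 2) * of_real pi powr (s / 2)) * (Gamma (s / 2) * (s / 2 * rGamma (s / 2 + 1))) * ((s - 1) / (s - 1)) * D"
    proof -
      have "(s * (s - 1) / 2 * P * G * D) * P' * R / (s - 1) = (P * P') * (G * (s / 2 * R)) * ((s - 1) / (s - 1)) * D" for P G P' R
        using nz by (simp add: field_simps)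
      then show ?thesis unfolding f_def xi .
    qed
    also have "\<dots> = D"
      by (simp only: p rGamma_plus1 G divide_self[OF nz(2)]) simp
    finally show ?thesis using D by simp
  qed
  ultimately show ?thesis by blast
qed

lemma riemann_zeta_sums:
  assumes "1 < Re s"
  shows "(\<lambda>n. 1 / (of_nat (Suc n)) powr s) sums riemann_zeta s"
  using someI_ex[OF riemann_zeta_exists] assms unfolding riemann_zeta_def by blast

lemma entire_xi_zeta:
  assumes "1 < Re s"
  shows "entire_xi s = s * (s - 1) / 2 * of_real pi powr (- s / 2) * Gamma (s / 2) * riemann_zeta s"
  using entire_xi_eq[OF assms] sums_unique2[OF riemann_zeta_sums[OF assms]] by metis

lemma riemann_xi_eq_entire_xi: "riemann_xi = entire_xi"
proof
  fix s
  have "\<exists>g. g holomorphic_on UNIV \<and> (\<forall>s. 1 < Re s \<longrightarrow>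
         g s = s * (s - 1) / 2 * (of_real pi) powr (- s / 2) * Gamma (s / 2) * riemann_zeta s)"
    using holomorphic_entire_xi entire_xi_zeta by blast
  from someI_ex[OF this] have *: "riemann_xi holomorphic_on UNIV"
    "\<forall>s. 1 < Re s \<longrightarrow> riemann_xi s = s * (s - 1) / 2 * (of_real pi) powr (- s / 2) * Gamma (s / 2) * riemann_zeta s"
    unfolding riemann_xi_def by blast+
  show "riemann_xi s = entire_xi s"
  proof (rule analytic_continuation_open[of "{s. Re s > 1}" UNIV riemann_xi entire_xi])
    show "{s. Re s > 1} \<noteq> {}" by (auto intro: exI[of _ 2])
    show "riemann_xi z = entire_xi z" if "z \<in> {s. Re s > 1}" for z
    proof -
      have "1 < Re z" using that by simp
      then show ?thesis using *(2) entire_xi_zeta by metis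
    qed
  qed (use * holomorphic_entire_xi in \<open>auto simp: open_halfspace_Re_gt\<close>)
qed

lemmas holomorphic_riemann_xi = holomorphic_entire_xi[folded riemann_xi_eq_entire_xi]
lemmas riemann_xi_zeta = entire_xi_zeta[folded riemann_xi_eq_entire_xi]
lemmas riemann_xi_reflect = entire_xi_reflect[folded riemann_xi_eq_entire_xi]
lemmas cnj_riemann_xi = cnj_entire_xi[folded riemann_xi_eq_entire_xi]

lemma riemann_xi_0: "riemann_xi 0 = 1 / 2"
  by (simp add: riemann_xi_eq_entire_xi entire_xi_def)

text \<open>Since \<pi> > 3, this differs from the value \<open>1 / 2\<close> at 0 and, by
  reflection, at 1. So xi is not constant, not even on the half plane to the right of the critical
  line.\<close>

lemma riemann_xi_2: "riemann_xi 2 = of_real (pi / 6)"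
proof -
  have "(\<lambda>n. complex_of_real (1 / real ((n + 1)\<^sup>2))) sums of_real (pi\<^sup>2 / 6)"
    using inverse_squares_sums by (rule sums_of_real)
  moreover have "1 / of_nat (Suc n) powr 2 = complex_of_real (1 / real ((n + 1)\<^sup>2))" for n
  proof -
    have "(of_nat (Suc n) :: complex) powr of_nat 2 = of_nat (Suc n) ^ 2"
      by (rule powr_nat') simp
    then show ?thesis by (simp add: add.commute)
  qed
  ultimately have "(\<lambda>n. 1 / of_nat (Suc n) powr 2) sums complex_of_real (pi\<^sup>2 / 6)"
    by (simp only:)
  moreover have "(\<lambda>n. 1 / of_nat (Suc n) powr 2) sums riemann_zeta 2"
    by (rule riemann_zeta_sums) simp
  ultimately have z: "riemann_zeta 2 = of_real (pi\<^sup>2 / 6)"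
    by (metis sums_unique2)
  have "complex_of_real pi powr (- 1) = of_real (1 / pi)"
    by (simp add: powr_minus inverse_eq_divide)
  then show ?thesis
    using riemann_xi_zeta[of 2] z by (simp add: power2_eq_square)
qed

text \<open>On a vertical strip both Mellin terms are bounded independently of \<open>Im s\<close>,
  so only the factor \<open>s * (s - 1)\<close> grows.\<close>

lemma riemann_xi_strip_bound:
  fixes a b :: real
  obtains C where "C > 0" "\<And>s. a \<le> Re s \<Longrightarrow> Re s \<le> b \<Longrightarrow> norm (riemann_xi s) \<le> C * (1 + norm s)\<^sup>2"
proof -
  define A where "A = (LINT u:{0..}|lborel. mellin_weight b u) + (LINT u:{0..}|lborel. mellin_weight (1 - a) u)"
  have bd: "norm (riemann_xi s) \<le> (1 + \<bar>A\<bar>) * (1 + norm s)\<^sup>2" if "a \<le> Re s" "Re s \<le> b" for s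
  proof -
    have "norm (xi_mellin s + xi_mellin (1 - s)) \<le> A"
      unfolding A_def using that by (intro norm_triangle_le add_mono norm_xi_mellin_le) auto
    then have A: "norm (xi_mellin s + xi_mellin (1 - s)) \<le> \<bar>A\<bar>" by simp
    have n1: "norm (s - 1) \<le> 1 + norm s"
      using norm_triangle_ineq4[of s 1] by simp
    have "norm (riemann_xi s) \<le> 1/2 + norm s * norm (s - 1) / 2 * norm (xi_mellin s + xi_mellin (1 - s))"
      unfolding riemann_xi_eq_entire_xi entire_xi_def
      by (rule order_trans[OF norm_triangle_ineq]) (simp add: norm_mult norm_divide)
    also have "\<dots> \<le> (1 + norm s)\<^sup>2 + (1 + norm s)\<^sup>2 * \<bar>A\<bar>"
    proof (intro add_mono mult_mono A)
      show "1 / 2 \<le> (1 + norm s)\<^sup>2"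
        by (rule order_trans[of _ "1\<^sup>2"]) (auto intro!: power_mono)
      have "norm s * norm (s - 1) \<le> (1 + norm s) * (1 + norm s)"
        by (intro mult_mono n1) auto
      moreover have "0 \<le> norm s * norm (s - 1)" by simp
      ultimately show "norm s * norm (s - 1) / 2 \<le> (1 + norm s)\<^sup>2"
        unfolding power2_eq_square by linarith
    qed auto
    finally show ?thesis by (simp add: algebra_simps)
  qed
  show ?thesis by (rule that[of "1 + \<bar>A\<bar>"]) (use bd in auto)
qed

section \<open>Phragmen--Lindeloef principles and bounds for zeta and xi\<close>

text \<open>The frontier of \<open>R\<close> misses every open \<open>T\<close> inside
  \<open>R\<close>. A bound on \<open>R - T\<close> is therefore enough, and no frontier has to be
  computed.\<close>

lemma maximum_modulus_closed:
  assumes g: "g holomorphic_on S" and R: "closed R" "bounded R" "R \<subseteq> S"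
    and T: "open T" "T \<subseteq> R" "\<And>z. z \<in> R \<Longrightarrow> z \<notin> T \<Longrightarrow> norm (g z) \<le> B" and w: "w \<in> R"
  shows "norm (g w) \<le> B"
proof (rule maximum_modulus_frontier[of g R])
  have gR: "g holomorphic_on R" using g R(3) by (rule holomorphic_on_subset)
  then show "g holomorphic_on interior R" using interior_subset by (rule holomorphic_on_subset)
  show "continuous_on (closure R) g" using gR R(1) by (simp add: holomorphic_on_imp_continuous_on)
  show "norm (g z) \<le> B" if "z \<in> frontier R" for z
  proof -
    have "z \<in> R" "z \<notin> T" using that R(1) interior_maximal[OF T(2,1)] by (auto simp: frontier_def)
    then show ?thesis by (rule T(3))
  qed
qed (use R w in auto)

text \<open>The factor \<open>exp (\<epsilon> * z^2)\<close> has norm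
  \<open>exp (\<epsilon> * (x^2 - y^2))\<close> at \<open>x + i y\<close>: it beats the growth
  \<open>exp (c * |y|)\<close> on high rectangles and costs at most
  \<open>exp (\<epsilon> * b^2)\<close>, which tends to 1 as \<epsilon> tends to 0.\<close>

lemma phragmen_lindelof_strip:
  fixes Q :: "complex \<Rightarrow> complex"
  assumes hol: "Q holomorphic_on S" and S: "open S" "{w. 0 \<le> Re w \<and> Re w \<le> b} \<subseteq> S"
    and B: "B > 0"
    and left: "\<And>w. Re w = 0 \<Longrightarrow> norm (Q w) \<le> B"
    and right: "\<And>w. Re w = b \<Longrightarrow> norm (Q w) \<le> B"
    and growth: "\<And>w. 0 \<le> Re w \<Longrightarrow> Re w \<le> b \<Longrightarrow> \<bar>Im w\<bar> \<ge> T \<Longrightarrow> norm (Q w) \<le> C * exp (c * \<bar>Im w\<bar>)"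
    and w: "0 \<le> Re w" "Re w \<le> b"
  shows "norm (Q w) \<le> B"
proof -
  have b: "b \<ge> 0" using w by linarith
  have key: "norm (Q w) * exp (\<epsilon> * ((Re w)\<^sup>2 - (Im w)\<^sup>2)) \<le> B * exp (\<epsilon> * b\<^sup>2)" if \<epsilon>: "\<epsilon> > 0" for \<epsilon>
  proof -
    define g where "g z = Q z * exp (of_real \<epsilon> * z\<^sup>2)" for z
    have ng: "norm (g z) = norm (Q z) * exp (\<epsilon> * ((Re z)\<^sup>2 - (Im z)\<^sup>2))" for z
      by (simp add: g_def norm_mult Re_power2)
    have le_b: "exp (\<epsilon> * ((Re z)\<^sup>2 - (Im z)\<^sup>2)) \<le> exp (\<epsilon> * b\<^sup>2)" if "0 \<le> Re z" "Re z \<le> b" for z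
    proof -
      have "(Re z)\<^sup>2 \<le> b\<^sup>2" using that by (intro power_mono) auto
      then have "(Re z)\<^sup>2 - (Im z)\<^sup>2 \<le> b\<^sup>2" using zero_le_power2[of "Im z"] by linarith
      then show ?thesis using \<epsilon> by (simp add: mult_left_mono)
    qed
    \<comment> \<open>The first two entries put the horizontal edges into the range of
      \<open>growth\<close> and \<open>w\<close> below them. The third makes the quadratic term
      exceed the linear one by at least \<open>Y\<close>, and the fourth lets the resulting factor
      \<open>exp (- Y)\<close> absorb \<open>C\<close>, as
      \<open>|C| <= B * Y <= B * exp Y\<close>.\<close>
    define Y where "Y = max (max T (\<bar>Im w\<bar> + 1)) (max ((\<bar>c\<bar> + 1) / \<epsilon>) (\<bar>C\<bar> / B))"
    have Y: "Y \<ge> T" "Y \<ge> \<bar>Im w\<bar> + 1" "Y \<ge> (\<bar>c\<bar> + 1) / \<epsilon>" "Y \<ge> \<bar>C\<bar> / B"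
      by (auto simp: Y_def)
    have Y0: "Y > 0" using Y(2) by linarith
    have YC: "\<bar>C\<bar> * exp (c * Y) * exp (\<epsilon> * (b\<^sup>2 - Y\<^sup>2)) \<le> B * exp (\<epsilon> * b\<^sup>2)"
    proof -
      have "\<bar>c\<bar> + 1 \<le> \<epsilon> * Y" using Y(3) \<epsilon> by (simp add: field_simps)
      then have "(\<bar>c\<bar> + 1) * Y \<le> \<epsilon> * Y * Y" using Y0 by (intro mult_right_mono) auto
      moreover have "c * Y \<le> \<bar>c\<bar> * Y" using Y0 by (intro mult_right_mono) auto
      ultimately have e: "c * Y + \<epsilon> * (b\<^sup>2 - Y\<^sup>2) + Y \<le> \<epsilon> * b\<^sup>2"
        by (simp add: algebra_simps power2_eq_square)
      have "\<bar>C\<bar> \<le> B * Y" using Y(4) B by (simp add: field_simps)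
      also have "\<dots> \<le> B * exp Y" using B exp_ge_add_one_self[of Y] by (intro mult_left_mono) linarith+
      finally have "\<bar>C\<bar> * exp (c * Y + \<epsilon> * (b\<^sup>2 - Y\<^sup>2)) \<le> B * exp Y * exp (c * Y + \<epsilon> * (b\<^sup>2 - Y\<^sup>2))"
        by (intro mult_right_mono) auto
      also have "\<dots> = B * exp (c * Y + \<epsilon> * (b\<^sup>2 - Y\<^sup>2) + Y)" by (simp add: exp_add)
      also have "\<dots> \<le> B * exp (\<epsilon> * b\<^sup>2)" using e B by simp
      finally show ?thesis by (simp add: exp_add mult.assoc)
    qed
    define R where "R = {w. 0 \<le> Re w \<and> Re w \<le> b \<and> \<bar>Im w\<bar> \<le> Y}"
    have "norm (g w) \<le> B * exp (\<epsilon> * b\<^sup>2)"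
    proof (rule maximum_modulus_closed[of g S R "{w. 0 < Re w \<and> Re w < b \<and> \<bar>Im w\<bar> < Y}"])
      show "g holomorphic_on S" unfolding g_def by (intro holomorphic_intros hol)
      show "R \<subseteq> S" using S(2) by (auto simp: R_def)
      show "closed R" unfolding R_def by (intro closed_Collect_conj closed_Collect_le continuous_intros)
      show "bounded R"
      proof (rule boundedI)
        fix z assume "z \<in> R"
        then show "norm z \<le> b + Y" using cmod_le[of z] by (auto simp: R_def)
      qed
      show "w \<in> R" using w Y(2) by (auto simp: R_def)
      show "open {w. 0 < Re w \<and> Re w < b \<and> \<bar>Im w\<bar> < Y}"
        by (intro open_Collect_conj open_Collect_less continuous_intros)
      show "{w. 0 < Re w \<and> Re w < b \<and> \<bar>Im w\<bar> < Y} \<subseteq> R" by (auto simp: R_def)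
      fix z assume zR: "z \<in> R" and zi: "z \<notin> {w. 0 < Re w \<and> Re w < b \<and> \<bar>Im w\<bar> < Y}"
      then consider "Re z = 0" | "Re z = b" | "\<bar>Im z\<bar> = Y" by (force simp: R_def)
      then show "norm (g z) \<le> B * exp (\<epsilon> * b\<^sup>2)"
      proof cases
        case 1
        show ?thesis unfolding ng using zR B by (intro mult_mono left[OF 1] le_b) (auto simp: R_def)
      next
        case 2
        show ?thesis unfolding ng using zR B by (intro mult_mono right[OF 2] le_b) (auto simp: R_def)
      next
        case 3
        have Im2: "(Im z)\<^sup>2 = Y\<^sup>2" using 3 by (metis power2_abs)
        have "norm (Q z) \<le> C * exp (c * Y)"
          using growth[of z] zR Y(1) 3 by (auto simp: R_def)
        also have "\<dots> \<le> \<bar>C\<bar> * exp (c * Y)" by simp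
        finally have q: "norm (Q z) \<le> \<bar>C\<bar> * exp (c * Y)" .
        have "(Re z)\<^sup>2 \<le> b\<^sup>2" using zR by (intro power_mono) (auto simp: R_def)
        then have e: "exp (\<epsilon> * ((Re z)\<^sup>2 - (Im z)\<^sup>2)) \<le> exp (\<epsilon> * (b\<^sup>2 - Y\<^sup>2))"
          using \<epsilon> by (simp add: Im2)
        have "norm (g z) \<le> \<bar>C\<bar> * exp (c * Y) * exp (\<epsilon> * (b\<^sup>2 - Y\<^sup>2))"
          unfolding ng by (intro mult_mono q e) auto
        with YC show ?thesis by linarith
      qed
    qed
    then show ?thesis by (simp add: ng)
  qed
  have lim1: "((\<lambda>\<epsilon>. B * exp (\<epsilon> * b\<^sup>2)) \<longlongrightarrow> B) (at_right 0)"
      by (auto intro!: tendsto_eq_intros)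
  have lim2: "((\<lambda>\<epsilon>. norm (Q w) * exp (\<epsilon> * ((Re w)\<^sup>2 - (Im w)\<^sup>2))) \<longlongrightarrow> norm (Q w)) (at_right 0)"
      by (auto intro!: tendsto_eq_intros)
  have ev: "\<forall>\<^sub>F \<epsilon> in at_right 0. norm (Q w) * exp (\<epsilon> * ((Re w)\<^sup>2 - (Im w)\<^sup>2)) \<le> B * exp (\<epsilon> * b\<^sup>2)"
      using eventually_at_right_less[of 0] by eventually_elim (rule key)
  show ?thesis by (rule tendsto_le[OF _ lim1 lim2 ev]) simp
qed

text \<open>Division by \<open>1 + \<epsilon> * w\<close>, whose norm on the right half plane is at
  least 1 and at least \<open>\<epsilon> * norm w\<close>: the first keeps the bound on the axis,
  the second pushes \<open>B\<close> below 1 on large arcs. Then \<epsilon> tends to 0.\<close>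

lemma phragmen_lindelof_half_plane_bounded:
  fixes Q :: "complex \<Rightarrow> complex"
  assumes hol: "Q holomorphic_on S" and S: "open S" "{w. 0 \<le> Re w} \<subseteq> S"
    and axis: "\<And>w. Re w = 0 \<Longrightarrow> norm (Q w) \<le> 1"
    and bound: "\<And>w. 0 \<le> Re w \<Longrightarrow> norm (Q w) \<le> B"
    and w: "0 \<le> Re w"
  shows "norm (Q w) \<le> 1"
proof -
  have key: "norm (Q w) \<le> norm (1 + of_real \<epsilon> * w)" if \<epsilon>: "\<epsilon> > 0" for \<epsilon>
  proof -
    define g where "g z = Q z / (1 + of_real \<epsilon> * z)" for z
    have den: "norm (1 + of_real \<epsilon> * z) \<ge> 1" "norm (1 + of_real \<epsilon> * z) \<ge> \<epsilon> * norm z" if "0 \<le> Re z" for z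
    proof -
      have "1 \<le> Re (1 + of_real \<epsilon> * z)" using that \<epsilon> by simp
      also have "\<dots> \<le> norm (1 + of_real \<epsilon> * z)" by (rule complex_Re_le_cmod)
      finally show "norm (1 + of_real \<epsilon> * z) \<ge> 1" .
      have "(norm (of_real \<epsilon> * z))\<^sup>2 \<le> (norm (1 + of_real \<epsilon> * z))\<^sup>2"
        unfolding cmod_power2 using that \<epsilon> by (simp add: power2_eq_square algebra_simps)
      then have "norm (of_real \<epsilon> * z) \<le> norm (1 + of_real \<epsilon> * z)"
        by (rule power2_le_imp_le) simp
      then show "norm (1 + of_real \<epsilon> * z) \<ge> \<epsilon> * norm z" using \<epsilon> by (simp add: norm_mult)
    qed
    define \<rho> where "\<rho> = max (norm w + 1) (\<bar>B\<bar> / \<epsilon>)"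
    define R where "R = {w. 0 \<le> Re w \<and> norm w \<le> \<rho>}"
    have "norm (g w) \<le> 1"
    proof (rule maximum_modulus_closed[of g R R "{w. 0 < Re w \<and> norm w < \<rho>}"])
      have "1 + of_real \<epsilon> * z \<noteq> 0" if "z \<in> R" for z
        using den(1)[of z] that by (auto simp: R_def)
      moreover have "R \<subseteq> S" using S(2) by (auto simp: R_def)
      then have "Q holomorphic_on R" by (rule holomorphic_on_subset[OF hol])
      ultimately show "g holomorphic_on R"
        unfolding g_def by (intro holomorphic_intros) auto
      show "closed R" unfolding R_def by (intro closed_Collect_conj closed_Collect_le continuous_intros)
      show "bounded R" by (rule boundedI[of _ \<rho>]) (auto simp: R_def)
      show "w \<in> R" using w by (auto simp: R_def \<rho>_def)
      show "open {w. 0 < Re w \<and> norm w < \<rho>}"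
        by (intro open_Collect_conj open_Collect_less continuous_intros)
      show "{w. 0 < Re w \<and> norm w < \<rho>} \<subseteq> R" by (auto simp: R_def)
      fix z assume "z \<in> R" "z \<notin> {w. 0 < Re w \<and> norm w < \<rho>}"
      then have cs: "Re z = 0 \<or> norm z = \<rho>" and z0: "0 \<le> Re z" by (auto simp: R_def)
      have dpos: "norm (1 + of_real \<epsilon> * z) > 0" using den(1)[OF z0] by linarith
      have "norm (Q z) \<le> norm (1 + of_real \<epsilon> * z)"
        using cs
      proof
        assume "Re z = 0"
        then show ?thesis using axis[of z] den(1)[OF z0] by linarith
      next
        assume "norm z = \<rho>"
        then have "\<bar>B\<bar> \<le> \<epsilon> * norm z" using \<epsilon> by (simp add: \<rho>_def field_simps max_def split: if_splits)
        then show ?thesis using bound[OF z0] den(2)[OF z0] by linarith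
      qed
      then show "norm (g z) \<le> 1" using dpos by (simp add: g_def norm_divide)
    qed simp
    moreover have "norm (1 + of_real \<epsilon> * w) > 0" using den(1)[OF w] by linarith
    ultimately show ?thesis by (simp add: g_def norm_divide)
  qed
  have lim1: "((\<lambda>\<epsilon>. norm (1 + of_real \<epsilon> * w)) \<longlongrightarrow> 1) (at_right 0)"
      by (auto intro!: tendsto_eq_intros)
  have lim2: "((\<lambda>\<epsilon>::real. norm (Q w)) \<longlongrightarrow> norm (Q w)) (at_right 0)" by simp
  have ev: "\<forall>\<^sub>F \<epsilon> in at_right 0. norm (Q w) \<le> norm (1 + of_real \<epsilon> * w)"
      using eventually_at_right_less[of 0] by eventually_elim (rule key)
  show ?thesis by (rule tendsto_le[OF _ lim1 lim2 ev]) simp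
qed

section \<open>Estimates for Gamma and zeta to the right, and Borel--Caratheodory\<close>

lemma Gamma_shift_ratio_bound:
  fixes z :: complex and a :: real
  assumes z: "Re z \<ge> 1" and a: "a > 0"
  shows "norm (Gamma z) * Gamma (1 + a) \<le> norm (Gamma (z + of_real a))"
proof -
  let ?a = "complex_of_real a"
  have pole: "w \<notin> \<int>\<^sub>\<le>\<^sub>0" if "Re w > 0" for w :: complex
    using that by (auto elim!: nonpos_Ints_cases)
  \<comment> \<open>Factor by factor,
    \<open>|z + a + k| / |z + k| <= 1 + a / |z + k| <= 1 + a / (1 + k)\<close>, as
    \<open>1 + k <= Re (z + k)\<close>. In the limit of Gauss's product,
    \<open>|Gamma z / Gamma (z + a)|\<close> is at most its value at \<open>z = 1\<close>.\<close>
  have poch: "norm (pochhammer (z + ?a) n) * norm (pochhammer (1::complex) n)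
      \<le> norm (pochhammer z n) * norm (pochhammer (1 + ?a) n)" for n
  proof -
    have "norm (z + ?a + of_nat k) * norm (1 + of_nat k :: complex) \<le> norm (z + of_nat k) * norm (1 + ?a + of_nat k)" for k
    proof -
      have n1: "norm (1 + of_nat k :: complex) = 1 + real k"
        by (metis norm_of_nat of_nat_Suc)
      have n2: "norm (1 + ?a + of_nat k) = 1 + a + real k"
      proof -
        have "1 + ?a + of_nat k = of_real (1 + a + real k)" by simp
        then show ?thesis using a by (simp only: norm_of_real)
      qed
      have "1 + real k \<le> Re (z + of_nat k)" using z by simp
      also have "\<dots> \<le> norm (z + of_nat k)" by (rule complex_Re_le_cmod)
      finally have ge: "1 + real k \<le> norm (z + of_nat k)" .
      have "norm (z + ?a + of_nat k) = norm ((z + of_nat k) + ?a)" by (simp add: add_ac)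
      also have "\<dots> \<le> norm (z + of_nat k) + a"
        using a norm_triangle_ineq[of "z + of_nat k" ?a] by simp
      finally have "norm (z + ?a + of_nat k) * (1 + real k) \<le> (norm (z + of_nat k) + a) * (1 + real k)"
        by (intro mult_right_mono) auto
      also have "\<dots> \<le> norm (z + of_nat k) * (1 + a + real k)"
        using mult_left_mono[OF ge, of a] a by (simp add: algebra_simps)
      finally show ?thesis unfolding n1 n2 .
    qed
    then have "(\<Prod>k<n. norm (z + ?a + of_nat k) * norm (1 + of_nat k :: complex)) \<le> (\<Prod>k<n. norm (z + of_nat k) * norm (1 + ?a + of_nat k))"
      by (intro prod_mono) auto
    then show ?thesis
      by (simp add: pochhammer_prod prod.distrib prod_norm atLeast0LessThan)
  qed
  have ser: "norm (Gamma_series z n) * norm (Gamma_series (1 + ?a) n) \<le> norm (Gamma_series (1::complex) n) * norm (Gamma_series (z + ?a) n)" for n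
  proof -
    let ?L = "complex_of_real (ln (of_nat n))"
    have nz: "norm (pochhammer w (Suc n)) > 0" if "Re w > 0" for w :: complex
    proof -
      have "w \<noteq> - of_nat k" for k using that by auto
      then have "pochhammer w (Suc n) \<noteq> 0" unfolding pochhammer_eq_0_iff by blast
      then show ?thesis by simp
    qed
    have p: "norm (pochhammer z (Suc n)) > 0" "norm (pochhammer (1 + ?a) (Suc n)) > 0" "norm (pochhammer (1::complex) (Suc n)) > 0" "norm (pochhammer (z + ?a) (Suc n)) > 0"
      using z a by (intro nz; simp)+
    have e: "norm (exp (z * ?L)) * norm (exp ((1 + ?a) * ?L)) = norm (exp (1 * ?L)) * norm (exp ((z + ?a) * ?L))"
      by (simp add: exp_add[symmetric] algebra_simps)
    have fr: "(F * X / P1) * (F * Y / P2) \<le> (F * X' / P3) * (F * Y' / P4)"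
      if "X * Y = X' * Y'" "P4 * P3 \<le> P1 * P2" "P1 > 0" "P2 > 0" "P3 > 0" "P4 > 0" "X' \<ge> 0" "Y' \<ge> 0" for F X Y X' Y' P1 P2 P3 P4 :: real
    proof -
      have "(F * X / P1) * (F * Y / P2) = (F * F) * (X * Y) / (P1 * P2)" by simp
      also have "\<dots> \<le> (F * F) * (X * Y) / (P4 * P3)"
        using that by (intro divide_left_mono) auto
      also have "\<dots> = (F * X' / P3) * (F * Y' / P4)" using that(1) by (simp add: mult_ac)
      finally show ?thesis .
    qed
    show ?thesis
      unfolding Gamma_series_def norm_divide norm_mult
      by (rule fr) (use e poch[of "Suc n"] p in \<open>auto\<close>)
  qed
  have "norm (Gamma z) * norm (Gamma (1 + ?a)) \<le> norm (Gamma (1::complex)) * norm (Gamma (z + ?a))"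
  proof (rule tendsto_le)
    show "(\<lambda>n. norm (Gamma_series (1::complex) n) * norm (Gamma_series (z + ?a) n)) \<longlonglongrightarrow> norm (Gamma (1::complex)) * norm (Gamma (z + ?a))"
      by (intro tendsto_intros pole; use z a in simp)
    show "(\<lambda>n. norm (Gamma_series z n) * norm (Gamma_series (1 + ?a) n)) \<longlonglongrightarrow> norm (Gamma z) * norm (Gamma (1 + ?a))"
      by (intro tendsto_intros pole; use z a in simp)
  qed (use ser in auto)
  moreover have "norm (Gamma (1 + ?a)) = Gamma (1 + a)"
    using Gamma_complex_of_real[of "1 + a"] a Gamma_real_nonneg[of "1 + a"] by simp
  ultimately show ?thesis by simp
qed

text \<open>Termwise comparison with the series at 2. The bound is less than 1, which keeps zeta
  away from 0 on this half plane.\<close>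

lemma riemann_zeta_minus_1_bound:
  assumes s: "Re s \<ge> 2"
  shows "norm (riemann_zeta s - 1) \<le> pi\<^sup>2 / 6 - 1"
proof -
  have "(\<lambda>n. 1 / of_nat (Suc n) powr s) sums riemann_zeta s"
    by (rule riemann_zeta_sums) (use s in simp)
  then have z: "(\<lambda>n. 1 / of_nat (Suc (Suc n)) powr s) sums (riemann_zeta s - 1)"
    using sums_Suc_iff[of "\<lambda>n. 1 / of_nat (Suc n) powr s" "riemann_zeta s - 1"] by simp
  have b: "(\<lambda>n. 1 / real ((Suc n + 1)\<^sup>2)) sums (pi\<^sup>2 / 6 - 1)"
    using inverse_squares_sums sums_Suc_iff[of "\<lambda>n. 1 / real ((n + 1)\<^sup>2)" "pi\<^sup>2 / 6 - 1"] by simp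
  have le: "norm (1 / of_nat (Suc (Suc n)) powr s) \<le> 1 / real ((Suc n + 1)\<^sup>2)" for n
  proof -
    let ?m = "real (Suc (Suc n))"
    have "norm (of_nat (Suc (Suc n)) powr s) = ?m powr Re s"
      by (subst norm_powr_real_powr) (auto simp del: of_nat_Suc)
    moreover have "?m powr 2 \<le> ?m powr Re s"
      using s by (intro powr_mono) auto
    moreover have "?m powr 2 = ?m ^ 2"
      by (simp add: powr_numeral)
    ultimately have "real ((Suc n + 1)\<^sup>2) \<le> norm (of_nat (Suc (Suc n)) powr s)"
      by simp
    then have "1 / norm (of_nat (Suc (Suc n)) powr s) \<le> 1 / real ((Suc n + 1)\<^sup>2)"
      by (rule divide_left_mono) (auto intro!: mult_pos_pos simp del: of_nat_Suc)
    then show ?thesis by (simp only: norm_divide norm_one)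
  qed
  have "norm (\<Sum>n. 1 / of_nat (Suc (Suc n)) powr s) \<le> (\<Sum>n. 1 / real ((Suc n + 1)\<^sup>2))"
    by (rule norm_suminf_le[OF le]) (use b in \<open>simp add: sums_iff\<close>)
  then show ?thesis using z b by (simp add: sums_iff)
qed

lemma riemann_zeta_bounds:
  assumes "Re s \<ge> 2"
  shows "norm (riemann_zeta s) \<le> 2" "norm (riemann_zeta s) \<ge> 1 / 4"
proof -
  have "pi < 3.2" using pi_approx by simp
  then have "pi\<^sup>2 < 3.2\<^sup>2" by (intro power_strict_mono) auto
  then have "pi\<^sup>2 / 6 - 1 \<le> 3 / 4" by (simp add: power2_eq_square)
  with riemann_zeta_minus_1_bound[OF assms] have "norm (riemann_zeta s - 1) \<le> 3 / 4" by linarith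
  moreover have "norm (riemann_zeta s) \<le> norm (riemann_zeta s - 1) + 1"
    using norm_triangle_ineq[of "riemann_zeta s - 1" 1] by simp
  moreover have "1 \<le> norm (riemann_zeta s) + norm (riemann_zeta s - 1)"
    using norm_triangle_ineq4[of "riemann_zeta s" "riemann_zeta s - 1"] by simp
  ultimately show "norm (riemann_zeta s) \<le> 2" "norm (riemann_zeta s) \<ge> 1 / 4" by linarith+
qed

text \<open>A logarithm \<open>h\<close> of \<open>g / g z0\<close>, rescaled to the unit disc,
  exists because \<open>g\<close> has no zeros, and satisfies \<open>Re h < A\<close>. Bounding
  \<open>norm h\<close> bounds \<open>Re h\<close> from below and hence
  \<open>norm g\<close>.\<close>

lemma borel_caratheodory_lower:
  fixes g :: "complex \<Rightarrow> complex"
  assumes hol: "g holomorphic_on ball z0 R" and nz: "\<And>z. z \<in> ball z0 R \<Longrightarrow> g z \<noteq> 0"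
    and M: "\<And>z. z \<in> ball z0 R \<Longrightarrow> norm (g z) \<le> M"
    and r: "0 \<le> r" "r < R" and z: "norm (z - z0) \<le> r"
    and A: "M < norm (g z0) * exp A"
  shows "norm (g z) \<ge> norm (g z0) * exp (- 2 * A * r / (R - r))"
proof -
  have R: "R > 0" using r by linarith
  have z0: "z0 \<in> ball z0 R" using R by simp
  obtain h0 where h0: "h0 holomorphic_on ball z0 R" "\<And>x. x \<in> ball z0 R \<Longrightarrow> exp (h0 x) = g x"
    by (rule holomorphic_logarithm_exists[of "ball z0 R" g z0]) (use hol nz z0 in auto)
  define h where "h w = h0 (z0 + of_real R * w) - h0 z0" for w
  have inb: "z0 + of_real R * w \<in> ball z0 R" if "norm w < 1" for w
    using that R by (simp add: dist_norm norm_mult)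
  have hh: "h holomorphic_on ball 0 1"
  proof -
    have "(\<lambda>w. z0 + of_real R * w) holomorphic_on ball 0 1" by (intro holomorphic_intros)
    moreover have "(\<lambda>w. z0 + of_real R * w) ` ball 0 1 \<subseteq> ball z0 R"
      by (intro image_subsetI inb) simp
    ultimately have "(\<lambda>w. h0 (z0 + of_real R * w)) holomorphic_on ball 0 1"
      using holomorphic_on_compose_gen[OF _ h0(1)] by (simp add: o_def)
    then show ?thesis unfolding h_def by (intro holomorphic_intros)
  qed
  have Reh: "exp (Re (h w)) = norm (g (z0 + of_real R * w)) / norm (g z0)" if "norm w < 1" for w
  proof -
    have "exp (Re (h w)) = norm (exp (h w))" by simp
    also have "exp (h w) = g (z0 + of_real R * w) / g z0"
      unfolding h_def exp_diff using h0(2)[OF inb[OF that]] h0(2)[OF z0] by simp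
    finally show ?thesis by (simp add: norm_divide)
  qed
  have ReA: "Re (h w) < A" if "norm w < 1" for w
  proof -
    have "norm (g (z0 + of_real R * w)) < norm (g z0) * exp A"
      using M[OF inb[OF that]] A by linarith
    then have "exp (Re (h w)) < exp A"
      unfolding Reh[OF that] using nz[OF z0] by (simp add: field_simps)
    then show ?thesis by simp
  qed
  have Apos: "A > 0" using ReA[of 0] by (simp add: h_def)
  \<comment> \<open>The Moebius map from the half plane \<open>Re < A\<close> to the unit disc that
    fixes 0, so that the Schwarz lemma applies.\<close>
  define \<phi> where "\<phi> w = h w / (2 * of_real A - h w)" for w
  have den: "2 * of_real A - h w \<noteq> 0" if "norm w < 1" for w
  proof
    assume "2 * of_real A - h w = 0"
    then have "Re (h w) = 2 * A" by (simp add: complex_eq_iff)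
    with ReA[OF that] Apos show False by linarith
  qed
  have hlt: "norm (h w) < norm (2 * of_real A - h w)" if "norm w < 1" for w
  proof (rule power2_less_imp_less)
    have "(norm (2 * of_real A - h w))\<^sup>2 - (norm (h w))\<^sup>2 = 4 * A * (A - Re (h w))"
      unfolding cmod_power2 by (simp add: power2_eq_square algebra_simps)
    also have "\<dots> > 0" using ReA[OF that] Apos by simp
    finally show "(norm (h w))\<^sup>2 < (norm (2 * of_real A - h w))\<^sup>2" by simp
  qed simp
  define w where "w = (z - z0) / of_real R"
  have w: "norm w \<le> r / R" "norm w < 1" "z = z0 + of_real R * w"
    using z r R by (auto simp: w_def norm_divide field_simps)
  have "norm (\<phi> w) \<le> norm w"
  proof (rule Schwarz_Lemma(1))
    show "\<phi> holomorphic_on ball 0 1"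
      unfolding \<phi>_def using den by (intro holomorphic_intros hh) auto
    show "\<phi> 0 = 0" by (simp add: \<phi>_def h_def)
    show "norm (\<phi> w) < 1" if "norm w < 1" for w
      using hlt[OF that] by (simp add: \<phi>_def norm_divide divide_simps)
  qed (rule w)
  then have "norm (h w) \<le> norm w * norm (2 * of_real A - h w)"
    using hlt[OF w(2)] by (simp add: \<phi>_def norm_divide divide_simps split: if_splits)
  also have "\<dots> \<le> norm w * (2 * A + norm (h w))"
    using norm_triangle_ineq4[of "2 * of_real A" "h w"] Apos by (intro mult_left_mono) (auto simp: norm_mult)
  also have "\<dots> \<le> r / R * (2 * A + norm (h w))"
    using w(1) Apos by (intro mult_right_mono) auto
  finally have "norm (h w) * R \<le> r * (2 * A + norm (h w))"
    using R by (simp add: field_simps)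
  then have "norm (h w) \<le> 2 * A * r / (R - r)"
    using r by (simp add: field_simps)
  then have "- 2 * A * r / (R - r) \<le> Re (h w)"
    using abs_Re_le_cmod[of "h w"] by simp
  then have "exp (- 2 * A * r / (R - r)) \<le> norm (g z) / norm (g z0)"
    using Reh[OF w(2)] w(3) by (metis exp_le_cancel_iff)
  then show ?thesis using nz[OF z0] by (simp add: field_simps)
qed

section \<open>The modulus of xi on both sides of a point\<close>

lemma riemann_xi_mirror:
  assumes "Re w = 0"
  shows "norm (riemann_xi (1/2 + w - of_real a)) = norm (riemann_xi (1/2 + w + of_real a))"
proof -
  \<comment> \<open>\<open>s -> cnj (1 - s)\<close> is the reflection in the critical line; xi takes
    conjugate values at mirror points.\<close>
  have "1/2 + w + of_real a = cnj (1 - (1/2 + w - of_real a))"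
    using assms by (simp add: complex_eq_iff)
  then have "riemann_xi (1/2 + w + of_real a) = cnj (riemann_xi (1/2 + w - of_real a))"
    by (simp only: cnj_riemann_xi[symmetric] riemann_xi_reflect)
  then show ?thesis by simp
qed

lemma norm_pi_powr: "norm (complex_of_real pi powr s) = pi powr Re s"
  by (subst norm_powr_real_powr) auto

text \<open>Factor by factor in the product formula: with this \<open>w\<close> both arguments have
  real part at least 2, the polynomial factors grow to the right, the powers of \<pi> differ by
  \<open>pi powr a\<close>, the Gamma arguments differ by exactly \<open>a\<close>, and 8 is the
  quotient of the zeta bounds 2 and 1/4.\<close>

lemma riemann_xi_ratio_right:
  assumes a: "a > 0" and w: "Re w \<ge> 3/2 + a"
  shows "norm (riemann_xi (1/2 + w - of_real a)) \<le> 8 * pi powr a / Gamma (1 + a) * norm (riemann_xi (1/2 + w + of_real a))"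
proof -
  define s where "s = 1/2 + w"
  let ?p = "s + of_real a" and ?m = "s - of_real a"
  have s: "Re s \<ge> 2 + a" using w by (simp add: s_def)
  have R: "1 < Re ?m" "1 < Re ?p" "Re ?m \<ge> 2" "Re ?p \<ge> 2" using s a by auto
  have n1: "norm ?m \<le> norm ?p"
  proof (rule power2_le_imp_le)
    show "(norm ?m)\<^sup>2 \<le> (norm ?p)\<^sup>2"
      unfolding cmod_power2 using s a by (simp add: power2_eq_square algebra_simps)
  qed simp
  have n2: "norm (?m - 1) \<le> norm (?p - 1)"
  proof (rule power2_le_imp_le)
    have "0 \<le> 4 * a * (Re s - 1)" using s a by simp
    then show "(norm (?m - 1))\<^sup>2 \<le> (norm (?p - 1))\<^sup>2"
      unfolding cmod_power2 by (simp add: power2_eq_square algebra_simps)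
  qed simp
  have n3: "norm (complex_of_real pi powr (- ?m / 2)) = pi powr a * norm (complex_of_real pi powr (- ?p / 2))"
    unfolding norm_pi_powr by (simp add: powr_add[symmetric] field_simps)
  have G0: "Gamma (1 + a) > 0" using a by (intro Gamma_real_pos) simp
  have "norm (Gamma (?m / 2)) * Gamma (1 + a) \<le> norm (Gamma (?m / 2 + of_real a))"
    by (rule Gamma_shift_ratio_bound) (use R a in simp_all)
  moreover have "?m / 2 + of_real a = ?p / 2" by (simp add: field_simps)
  ultimately have n4: "norm (Gamma (?m / 2)) \<le> norm (Gamma (?p / 2)) / Gamma (1 + a)"
    using G0 by (simp add: pos_le_divide_eq)
  have n5: "norm (riemann_zeta ?m) \<le> 8 * norm (riemann_zeta ?p)"
    using riemann_zeta_bounds(1)[OF R(3)] riemann_zeta_bounds(2)[OF R(4)] by linarith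
  have "norm (riemann_xi ?m) = norm ?m * norm (?m - 1) / 2 * norm (complex_of_real pi powr (- ?m / 2)) * norm (Gamma (?m / 2)) * norm (riemann_zeta ?m)"
    unfolding riemann_xi_zeta[OF R(1)] by (simp only: norm_mult norm_divide norm_numeral)
  also have "\<dots> \<le> norm ?p * norm (?p - 1) / 2 * (pi powr a * norm (complex_of_real pi powr (- ?p / 2))) * (norm (Gamma (?p / 2)) / Gamma (1 + a)) * (8 * norm (riemann_zeta ?p))"
    unfolding n3 using G0 by (intro mult_mono divide_right_mono n1 n2 n4 n5 order_refl) auto
  also have "\<dots> = 8 * pi powr a / Gamma (1 + a) * (norm ?p * norm (?p - 1) / 2 * norm (complex_of_real pi powr (- ?p / 2)) * norm (Gamma (?p / 2)) * norm (riemann_zeta ?p))"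
    by simp
  also have "norm ?p * norm (?p - 1) / 2 * norm (complex_of_real pi powr (- ?p / 2)) * norm (Gamma (?p / 2)) * norm (riemann_zeta ?p) = norm (riemann_xi ?p)"
    unfolding riemann_xi_zeta[OF R(2)] by (simp only: norm_mult norm_divide norm_numeral)
  finally show ?thesis by (simp add: s_def)
qed

text \<open>By the reflection formula the squared norm is \<pi> \<open>|y|\<close> divided by
  \<open>norm (sin (pi * i * y))\<close>, and that sine is at most \<open>exp (pi * |y|)\<close>.
  The assumption makes the numerator at least 1.\<close>

lemma norm_Gamma_one_plus_imaginary:
  fixes y :: real
  assumes y: "\<bar>y\<bar> \<ge> 1 / 2"
  shows "norm (Gamma (1 + \<i> * of_real y)) \<ge> exp (- pi * \<bar>y\<bar> / 2)"
proof -
  let ?z = "\<i> * complex_of_real y"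
  have y0: "y \<noteq> 0" using y by auto
  have z: "?z \<notin> \<int>\<^sub>\<le>\<^sub>0" using y0 by (auto elim!: nonpos_Ints_cases simp: complex_eq_iff)
  have c: "Gamma (1 - ?z) = cnj (Gamma (1 + ?z))"
    by (simp add: cnj_Gamma)
  have "complex_of_real ((norm (Gamma (1 + ?z)))\<^sup>2) = Gamma (1 + ?z) * Gamma (1 - ?z)"
    unfolding c by (rule complex_norm_square)
  also have "\<dots> = ?z * Gamma ?z * Gamma (1 - ?z)"
    using Gamma_plus1[OF z] by (simp add: add.commute)
  also have "?z * Gamma ?z * Gamma (1 - ?z) = ?z * (of_real pi / sin (of_real pi * ?z))"
    using Gamma_reflection_complex[of ?z] by (simp add: mult.assoc)
  finally have "norm (complex_of_real ((norm (Gamma (1 + ?z)))\<^sup>2)) = norm (?z * (of_real pi / sin (of_real pi * ?z)))"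
    by (simp only:)
  then have eq: "(norm (Gamma (1 + ?z)))\<^sup>2 = \<bar>y\<bar> * pi / norm (sin (of_real pi * ?z))"
    by (simp add: norm_mult norm_divide norm_power)
  have "norm (sin (1 *\<^sub>R (of_real pi * ?z))) \<le> exp \<bar>Im (of_real pi * ?z)\<bar>"
    by (rule cmod_sin_le_exp) auto
  then have sle: "norm (sin (of_real pi * ?z)) \<le> exp (pi * \<bar>y\<bar>)"
    by (simp add: abs_mult)
  have "1 + ?z \<notin> \<int>\<^sub>\<le>\<^sub>0" using y0 by (auto elim!: nonpos_Ints_cases simp: complex_eq_iff)
  then have "Gamma (1 + ?z) \<noteq> 0" by (simp add: Gamma_eq_zero_iff)
  then have "norm (sin (of_real pi * ?z)) \<noteq> 0" using eq by auto
  then have spos: "norm (sin (of_real pi * ?z)) > 0" by simp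
  have yp: "\<bar>y\<bar> * pi \<ge> 1"
  proof -
    have "1/2 * 2 \<le> \<bar>y\<bar> * pi" using y pi_ge_two by (intro mult_mono) auto
    then show ?thesis by simp
  qed
  have "(exp (- pi * \<bar>y\<bar> / 2))\<^sup>2 = 1 / exp (pi * \<bar>y\<bar>)"
    by (simp add: power2_eq_square exp_add[symmetric] exp_minus inverse_eq_divide)
  also have "\<dots> \<le> \<bar>y\<bar> * pi / norm (sin (of_real pi * ?z))"
    using sle spos yp by (intro frac_le) auto
  finally have "(exp (- pi * \<bar>y\<bar> / 2))\<^sup>2 \<le> (norm (Gamma (1 + ?z)))\<^sup>2" unfolding eq .
  then show ?thesis by (rule power2_le_imp_le) simp
qed

text \<open>The value at the centre of the Borel--Caratheodory discs. Half of \<open>t\<close>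
  enters the Gamma factor, whence \<open>|t| >= 1\<close>, and
  \<open>exp (- pi * |t| / 4) >= exp (- |t|)\<close> because \<pi> < 4.\<close>

lemma riemann_xi_lower_bound_2:
  fixes t :: real
  assumes t: "\<bar>t\<bar> \<ge> 1"
  shows "norm (riemann_xi (Complex 2 t)) \<ge> exp (- \<bar>t\<bar>) / (4 * pi)"
proof -
  let ?s = "Complex 2 t"
  have "2 \<le> norm ?s" "1 \<le> norm (?s - 1)"
    using complex_Re_le_cmod[of ?s] complex_Re_le_cmod[of "?s - 1"] by auto
  then have "2 * 1 \<le> norm ?s * norm (?s - 1)" by (intro mult_mono) auto
  then have n1: "1 \<le> norm ?s * norm (?s - 1) / 2" by simp
  have n2: "norm (complex_of_real pi powr (- ?s / 2)) = 1 / pi"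
    unfolding norm_pi_powr by (simp add: powr_minus inverse_eq_divide)
  have "?s / 2 = 1 + \<i> * of_real (t / 2)" by (simp add: complex_eq_iff)
  moreover have "exp (- pi * \<bar>t / 2\<bar> / 2) \<le> norm (Gamma (1 + \<i> * of_real (t / 2)))"
    by (rule norm_Gamma_one_plus_imaginary) (use t in simp)
  moreover have "exp (- \<bar>t\<bar>) \<le> exp (- pi * \<bar>t / 2\<bar> / 2)"
    using pi_less_4 mult_right_mono[of pi 4 "\<bar>t\<bar>"] by simp
  ultimately have n3: "exp (- \<bar>t\<bar>) \<le> norm (Gamma (?s / 2))" by (metis order_trans)
  have n4: "1 / 4 \<le> norm (riemann_zeta ?s)" by (rule riemann_zeta_bounds(2)) simp
  have "1 * (1 / pi) * exp (- \<bar>t\<bar>) * (1 / 4) \<le> norm ?s * norm (?s - 1) / 2 * norm (complex_of_real pi powr (- ?s / 2)) * norm (Gamma (?s / 2)) * norm (riemann_zeta ?s)"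
    unfolding n2 by (intro mult_mono n1 n3 n4 order_refl) auto
  also have "\<dots> = norm (riemann_xi ?s)"
    by (subst riemann_xi_zeta) (simp_all only: norm_mult norm_divide norm_numeral, simp)
  finally show ?thesis by (simp add: field_simps)
qed

text \<open>Brings the polynomial strip bound into exponential form, by
  \<open>(6 + t)^2 <= 72 * (1 + t + t^2 / 2)\<close> with \<open>t = |Im s|\<close>.\<close>

lemma square_le_exp:
  assumes "\<bar>Re s\<bar> \<le> 5"
  shows "(1 + norm s)\<^sup>2 \<le> 72 * exp \<bar>Im s\<bar>"
proof -
  let ?t = "\<bar>Im s\<bar>"
  have "1 + norm s \<le> 6 + ?t" using cmod_le[of s] assms by linarith
  then have "(1 + norm s)\<^sup>2 \<le> (6 + ?t)\<^sup>2" by (intro power_mono) auto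
  also have "\<dots> \<le> 72 * (1 + ?t + ?t\<^sup>2 / 2)"
    by (simp add: power2_eq_square algebra_simps)
  also have "1 + ?t + ?t\<^sup>2 / 2 \<le> exp ?t" by (rule exp_lower_Taylor_quadratic) simp
  finally show ?thesis by simp
qed

text \<open>Without zeros to the right of the critical line, Borel--Caratheodory on a disc around
  \<open>2 + i t\<close> bounds \<open>\<xi>\<close> from below up to distance \<open>a\<close> from the line.\<close>

lemma riemann_xi_lower_bound_strip:
  assumes RH: "\<And>s. riemann_xi s = 0 \<Longrightarrow> Re s = 1/2" and a: "0 < a" "a \<le> 1/2"
  obtains C c where "\<And>w. 0 \<le> Re w \<Longrightarrow> Re w \<le> 3/2 + a \<Longrightarrow> \<bar>Im w\<bar> \<ge> 1 \<Longrightarrow>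
      1 \<le> C * exp (c * \<bar>Im w\<bar>) * norm (riemann_xi (1/2 + w + of_real a))"
proof -
  obtain C1 where C1: "C1 > 0" "\<And>s. 1/2 \<le> Re s \<Longrightarrow> Re s \<le> 7/2 \<Longrightarrow> norm (riemann_xi s) \<le> C1 * (1 + norm s)\<^sup>2"
    using riemann_xi_strip_bound[of "1/2" "7/2"] by blast
  \<comment> \<open>\<open>K * exp (2 * |t|)\<close> is the quotient of the upper bound on the disc
    and the lower bound at its centre; as \<open>K < exp K\<close>, the exponent
    \<open>A = K + 2 * |t|\<close> is admissible. The disc of radius \<open>3/2\<close> about
    \<open>2 + i t\<close> touches the critical line, and \<open>r\<close> is the distance from its
    centre to real part \<open>1/2 + a\<close>.\<close>
  define K where "K = 288 * pi * C1 * exp (3/2)"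
  define r where "r = 3/2 - a"
  define d where "d = 2 * r / a"
  have "1 \<le> 4 * pi * exp (d * K) * exp ((1 + 2 * d) * \<bar>Im w\<bar>) * norm (riemann_xi (1/2 + w + of_real a))"
    if w: "0 \<le> Re w" "Re w \<le> 3/2 + a" "\<bar>Im w\<bar> \<ge> 1" for w
  proof -
    define t where "t = Im w"
    define z0 where "z0 = Complex 2 t"
    define z where "z = 1/2 + w + of_real a"
    define A where "A = K + 2 * \<bar>t\<bar>"
    have inb: "1/2 < Re x \<and> Re x < 7/2 \<and> \<bar>Im x\<bar> \<le> \<bar>t\<bar> + 3/2" if "x \<in> ball z0 (3/2)" for x
    proof -
      have "norm (x - z0) < 3/2" using that by (simp add: dist_norm norm_minus_commute)
      then have "\<bar>Re (x - z0)\<bar> < 3/2" "\<bar>Im (x - z0)\<bar> < 3/2"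
        using abs_Re_le_cmod[of "x - z0"] abs_Im_le_cmod[of "x - z0"] by linarith+
      then show ?thesis by (auto simp: z0_def abs_if split: if_splits)
    qed
    have m: "norm (riemann_xi z0) \<ge> exp (- \<bar>t\<bar>) / (4 * pi)"
      unfolding z0_def by (rule riemann_xi_lower_bound_2) (use w in \<open>simp add: t_def\<close>)
    have "norm (riemann_xi z) \<ge> norm (riemann_xi z0) * exp (- 2 * A * r / (3/2 - r))"
    proof (rule borel_caratheodory_lower[where g = riemann_xi and M = "72 * C1 * exp (3/2) * exp \<bar>t\<bar>"])
      show "riemann_xi holomorphic_on ball z0 (3/2)" by (rule holomorphic_riemann_xi)
      show "riemann_xi x \<noteq> 0" if "x \<in> ball z0 (3/2)" for x
        using inb[OF that] RH[of x] by auto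
      show "norm (riemann_xi x) \<le> 72 * C1 * exp (3/2) * exp \<bar>t\<bar>" if "x \<in> ball z0 (3/2)" for x
      proof -
        have "norm (riemann_xi x) \<le> C1 * (1 + norm x)\<^sup>2" using inb[OF that] by (intro C1(2)) auto
        also have "\<dots> \<le> C1 * (72 * exp \<bar>Im x\<bar>)"
          using inb[OF that] C1(1) by (intro mult_left_mono square_le_exp) auto
        also have "\<dots> \<le> C1 * (72 * exp (\<bar>t\<bar> + 3/2))"
          using inb[OF that] C1(1) by simp
        finally show ?thesis by (simp add: exp_add mult_ac)
      qed
      show "0 \<le> r" "r < 3/2" using a by (auto simp: r_def)
      have "z - z0 = of_real (1/2 + Re w + a - 2)" by (simp add: z_def z0_def t_def complex_eq_iff)
      then have "norm (z - z0) = \<bar>1/2 + Re w + a - 2\<bar>" by (simp only: norm_of_real)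
      then show "norm (z - z0) \<le> r" using w a by (simp add: r_def abs_le_iff)
      have "K < exp K" using exp_ge_add_one_self[of K] by linarith
      then have "72 * C1 * exp (3/2) * exp \<bar>t\<bar> < exp K / (4 * pi) * exp \<bar>t\<bar>"
        by (simp add: K_def field_simps)
      also have "\<dots> = exp (- \<bar>t\<bar>) / (4 * pi) * exp A"
        by (simp add: A_def exp_add[symmetric] algebra_simps)
      also have "\<dots> \<le> norm (riemann_xi z0) * exp A" using m by (intro mult_right_mono) auto
      finally show "72 * C1 * exp (3/2) * exp \<bar>t\<bar> < norm (riemann_xi z0) * exp A" .
    qed
    moreover have "- 2 * A * r / (3/2 - r) = - (d * A)" by (simp add: r_def d_def)
    moreover have "exp (- \<bar>t\<bar>) / (4 * pi) * exp (- (d * A)) \<le> norm (riemann_xi z0) * exp (- (d * A))"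
      using m by (intro mult_right_mono) auto
    ultimately have "exp (- \<bar>t\<bar>) / (4 * pi) * exp (- (d * A)) \<le> norm (riemann_xi z)" by simp
    then have "4 * pi * exp (d * A + \<bar>t\<bar>) * (exp (- \<bar>t\<bar>) / (4 * pi) * exp (- (d * A))) \<le> 4 * pi * exp (d * A + \<bar>t\<bar>) * norm (riemann_xi z)"
      by (intro mult_left_mono) auto
    also have "4 * pi * exp (d * A + \<bar>t\<bar>) * (exp (- \<bar>t\<bar>) / (4 * pi) * exp (- (d * A))) = 1"
      by (simp add: exp_add exp_minus field_simps)
    also have "exp (d * A + \<bar>t\<bar>) = exp (d * K) * exp ((1 + 2 * d) * \<bar>t\<bar>)"
      by (simp add: A_def exp_add[symmetric] algebra_simps)
    finally show ?thesis by (simp only: z_def t_def mult.assoc)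
  qed
  then show ?thesis by (rule that)
qed

text \<open>Two steps are needed: in the strip \<open>0 <= Re w <= 3/2 + a\<close> only exponential
  growth of the quotient \<open>Q\<close> is known, and the strip principle reduces it to the
  constant \<open>B\<close>, which also bounds \<open>Q\<close> further right. The half plane
  principle then improves \<open>B\<close> to the bound 1 on the axis.\<close>

lemma riemann_xi_norm_monotone:
  assumes RH: "\<And>s. riemann_xi s = 0 \<Longrightarrow> Re s = 1/2" and a: "0 < a" "a \<le> 1/2" and w: "Re w \<ge> 0"
  shows "norm (riemann_xi (1/2 + w - of_real a)) \<le> norm (riemann_xi (1/2 + w + of_real a))"
proof -
  define Q where "Q w = riemann_xi (1/2 + w - of_real a) / riemann_xi (1/2 + w + of_real a)" for w
  \<comment> \<open>An open neighbourhood of the closed right half plane on which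
    \<open>1/2 + w + a\<close> stays to the right of the critical line, so that the denominator of
    \<open>Q\<close> has no zeros.\<close>
  define S where "S = {w. Re w > - a}"
  define B where "B = max 1 (8 * pi powr a / Gamma (1 + a))"
  have nz: "riemann_xi (1/2 + w + of_real a) \<noteq> 0" if "Re w > - a" for w
    using RH[of "1/2 + w + of_real a"] that by auto
  have S: "open S" "{w. 0 \<le> Re w} \<subseteq> S" using a by (auto simp: S_def open_halfspace_Re_gt)
  have hol: "Q holomorphic_on S"
  proof -
    have "(\<lambda>w. riemann_xi (1/2 + w + c)) holomorphic_on S" for c
      using holomorphic_on_compose_gen[OF _ holomorphic_riemann_xi[of UNIV], of "\<lambda>w. 1/2 + w + c" S]
      by (simp add: o_def holomorphic_intros)
    from this[of "- of_real a"] this[of "of_real a"] show ?thesis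
      unfolding Q_def using nz by (intro holomorphic_on_divide) (auto simp: S_def)
  qed
  have axis: "norm (Q w) \<le> 1" if "Re w = 0" for w
    using riemann_xi_mirror[OF that, of a] nz[of w] that a by (simp add: Q_def norm_divide)
  have right: "norm (Q w) \<le> B" if "Re w \<ge> 3/2 + a" for w
  proof -
    have "norm (Q w) \<le> 8 * pi powr a / Gamma (1 + a)"
      using riemann_xi_ratio_right[OF a(1) that] nz[of w] that a by (simp add: Q_def norm_divide pos_divide_le_eq)
    then show ?thesis by (simp add: B_def)
  qed
  obtain C c where low: "\<And>w. 0 \<le> Re w \<Longrightarrow> Re w \<le> 3/2 + a \<Longrightarrow> \<bar>Im w\<bar> \<ge> 1 \<Longrightarrow>
      1 \<le> C * exp (c * \<bar>Im w\<bar>) * norm (riemann_xi (1/2 + w + of_real a))"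
    using riemann_xi_lower_bound_strip[OF RH a] by blast
  obtain C1 where C1: "C1 > 0" "\<And>s. 0 \<le> Re s \<Longrightarrow> Re s \<le> 5 \<Longrightarrow> norm (riemann_xi s) \<le> C1 * (1 + norm s)\<^sup>2"
    using riemann_xi_strip_bound[of 0 5] by blast
  have growth: "norm (Q w) \<le> (72 * C1 * C) * exp ((1 + c) * \<bar>Im w\<bar>)"
    if "0 \<le> Re w" "Re w \<le> 3/2 + a" "\<bar>Im w\<bar> \<ge> 1" for w
  proof -
    let ?s = "1/2 + w - of_real a"
    have "norm (riemann_xi ?s) \<le> C1 * (1 + norm ?s)\<^sup>2" using that a by (intro C1(2)) auto
    also have "\<dots> \<le> C1 * (72 * exp \<bar>Im ?s\<bar>)"
      using that a C1(1) by (intro mult_left_mono square_le_exp) auto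
    finally have n1: "norm (riemann_xi ?s) \<le> C1 * (72 * exp \<bar>Im w\<bar>)" by simp
    have pos: "norm (riemann_xi (1/2 + w + of_real a)) > 0" using nz[of w] that a by simp
    have n2: "1 / norm (riemann_xi (1/2 + w + of_real a)) \<le> C * exp (c * \<bar>Im w\<bar>)"
      using low[OF that] pos by (simp add: pos_divide_le_eq)
    have "norm (Q w) = norm (riemann_xi ?s) * (1 / norm (riemann_xi (1/2 + w + of_real a)))"
      by (simp add: Q_def norm_divide)
    also have "\<dots> \<le> C1 * (72 * exp \<bar>Im w\<bar>) * (C * exp (c * \<bar>Im w\<bar>))"
      using C1(1) by (intro mult_mono n1 n2) auto
    also have "\<dots> = (72 * C1 * C) * exp ((1 + c) * \<bar>Im w\<bar>)"
      unfolding distrib_right exp_add by simp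
    finally show ?thesis .
  qed
  have B1: "B \<ge> 1" by (simp add: B_def)
  have "norm (Q w) \<le> B" if "0 \<le> Re w" for w
  proof (cases "Re w \<le> 3/2 + a")
    case True
    show ?thesis
    proof (rule phragmen_lindelof_strip[OF hol S(1), where b = "3/2 + a" and T = 1 and C = "72 * C1 * C" and c = "1 + c"])
      show "norm (Q w) \<le> B" if "Re w = 0" for w using axis[OF that] B1 by linarith
      show "norm (Q w) \<le> B" if "Re w = 3/2 + a" for w using right[of w] that by simp
    qed (use S(2) B1 True that growth in auto)
  qed (use right in auto)
  then have "norm (Q w) \<le> 1"
    using phragmen_lindelof_half_plane_bounded[OF hol S axis _ w] by blast
  moreover have "norm (riemann_xi (1/2 + w + of_real a)) > 0" using nz[of w] w a by simp
  ultimately show ?thesis by (simp add: Q_def norm_divide)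
qed

section \<open>Zeros of the derivative of xi\<close>

lemma half_norm_square_has_derivative:
  assumes "(f has_field_derivative f') (at z)"
  shows "((\<lambda>z. (cmod (f z))\<^sup>2 / 2) has_derivative (\<lambda>h. inner h (f z * cnj f'))) (at z)"
proof -
  have "((\<lambda>z. inner (f z) (f z) / 2) has_derivative (\<lambda>h. (inner (f z) (f' * h) + inner (f' * h) (f z)) / 2)) (at z)"
    using assms unfolding has_field_derivative_def by (auto intro!: derivative_eq_intros)
  moreover have "(inner (f z) (f' * h) + inner (f' * h) (f z)) / 2 = inner h (f z * cnj f')" for h
    by (simp add: inner_complex_def field_simps)
  ultimately show ?thesis by (simp add: power2_norm_eq_inner)
qed

text \<open>The conclusion is the derivative of \<open>(norm f)^2 / 2\<close> in the real direction.
  Were it negative, small \<open>a\<close> would give a value at \<open>z + a\<close> below and a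
  value at \<open>z - a\<close> above the one at \<open>z\<close>.\<close>

lemma cmod_square_derivative_nonneg:
  fixes f :: "complex \<Rightarrow> complex"
  assumes der: "(f has_field_derivative f') (at z)"
    and mono: "\<And>a. 0 < a \<Longrightarrow> a \<le> 1/2 \<Longrightarrow> norm (f (z - of_real a)) \<le> norm (f (z + of_real a))"
  shows "Re (f' * cnj (f z)) \<ge> 0"
proof (rule ccontr)
  assume neg: "\<not> Re (f' * cnj (f z)) \<ge> 0"
  define h where "h x = (norm (f (z + of_real x)))\<^sup>2 / 2" for x :: real
  have "((\<lambda>x. z + of_real x) has_derivative complex_of_real) (at 0)"
    by (auto intro!: derivative_eq_intros)
  from has_derivative_compose[OF this, of "\<lambda>z. (cmod (f z))\<^sup>2 / 2"] half_norm_square_has_derivative[OF der]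
  have "(h has_derivative (\<lambda>x. inner (of_real x) (f z * cnj f'))) (at 0)"
    by (simp add: h_def[abs_def])
  moreover have "(\<lambda>x. inner (of_real x) (f z * cnj f')) = (*) (Re (f' * cnj (f z)))"
    by (auto simp: inner_complex_def)
  ultimately have hd: "(h has_real_derivative Re (f' * cnj (f z))) (at 0)"
    by (simp add: has_field_derivative_def)
  from neg have "Re (f' * cnj (f z)) < 0" by simp
  from DERIV_neg_dec_right[OF hd this] DERIV_neg_dec_left[OF hd this]
  obtain d1 d2 where d: "d1 > 0" "\<And>x. 0 < x \<Longrightarrow> x < d1 \<Longrightarrow> h (0 + x) < h 0"
    "d2 > 0" "\<And>x. 0 < x \<Longrightarrow> x < d2 \<Longrightarrow> h 0 < h (0 - x)" by blast
  define x where "x = min (1/2) (min (d1/2) (d2/2))"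
  have x: "0 < x" "x \<le> 1/2" "x < d1" "x < d2" using d(1,3) by (auto simp: x_def)
  have "h (- x) \<le> h x"
    unfolding h_def using mono[OF x(1,2)] by (intro divide_right_mono power_mono) auto
  with d(2)[OF x(1,3)] d(4)[OF x(1,4)] show False by simp
qed

theorem riemann_hypothesis_imp_deriv_zeros:
  assumes RH: "\<And>s. riemann_xi s = 0 \<Longrightarrow> Re s = 1/2" and s: "deriv riemann_xi s = 0"
  shows "Re s = 1/2"
proof -
  let ?H = "{s. Re s > 1/2}"
  have der: "(riemann_xi has_field_derivative deriv riemann_xi s) (at s)" for s
    using holomorphic_riemann_xi[of UNIV] by (simp add: holomorphic_derivI)
  have H: "open ?H" "connected ?H"
    by (rule open_halfspace_Re_gt, rule convex_connected[OF convex_halfspace_Re_gt])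
  have nz: "riemann_xi s \<noteq> 0" if "s \<in> ?H" for s using RH[of s] that by auto
  have right: "deriv riemann_xi s0 \<noteq> 0" if s0: "s0 \<in> ?H" for s0
  proof
    assume d0: "deriv riemann_xi s0 = 0"
    define L where "L s = deriv riemann_xi s / riemann_xi s" for s
    have Lhol: "L holomorphic_on ?H"
      unfolding L_def using nz
      by (intro holomorphic_on_divide holomorphic_deriv holomorphic_riemann_xi H) auto
    have Lnn: "Re (L s) \<ge> 0" if "s \<in> ?H" for s
    proof -
      have "Re (deriv riemann_xi s * cnj (riemann_xi s)) \<ge> 0"
      proof (rule cmod_square_derivative_nonneg[OF der])
        fix a :: real assume "0 < a" "a \<le> 1/2"
        then show "norm (riemann_xi (s - of_real a)) \<le> norm (riemann_xi (s + of_real a))"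
          using riemann_xi_norm_monotone[OF RH, of a "s - 1/2"] that by simp
      qed
      moreover have "L s = deriv riemann_xi s * cnj (riemann_xi s) / of_real ((norm (riemann_xi s))\<^sup>2)"
        using nz[OF that] unfolding L_def by (simp add: complex_norm_square del: of_real_power)
      ultimately show ?thesis by (simp only: Re_divide_of_real) simp
    qed
    have "L constant_on ?H"
    proof (rule ccontr)
      assume "\<not> L constant_on ?H"
      from open_mapping_thm[OF Lhol H H(1) subset_refl this] have "open (L ` ?H)" .
      moreover have "0 \<in> L ` ?H" using s0 d0 by (force simp: L_def)
      ultimately obtain e where e: "e > 0" "ball 0 e \<subseteq> L ` ?H" by (meson open_contains_ball)
      have "complex_of_real (- e / 2) \<in> ball 0 e" using e(1) by simp
      with e(2) have "complex_of_real (- e / 2) \<in> L ` ?H" by blast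
      then obtain s where "s \<in> ?H" "L s = of_real (- e / 2)" by (metis imageE)
      with Lnn[of s] e(1) show False by simp
    qed
    then have "L s = 0" if "s \<in> ?H" for s
      using that s0 d0 unfolding constant_on_def by (metis L_def div_0)
    then have d: "deriv riemann_xi s = 0" if "s \<in> ?H" for s
      using that nz[OF that] by (force simp: L_def)
    \<comment> \<open>A constant \<open>L\<close> is 0, hence xi is constant on the half plane,
      which contains 1 and 2 with the values \<open>1/2\<close> and \<open>pi / 6\<close>.\<close>
    have "\<exists>c. \<forall>s\<in>?H. riemann_xi s = c"
    proof (rule has_field_derivative_zero_constant)
      show "convex ?H" by (rule convex_halfspace_Re_gt)
      show "(riemann_xi has_field_derivative 0) (at s within ?H)" if "s \<in> ?H" for s
        using der[of s] d[OF that] by (simp add: has_field_derivative_at_within)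
    qed
    moreover have "1 \<in> ?H" "2 \<in> ?H" by simp_all
    ultimately have "riemann_xi 1 = riemann_xi 2" by metis
    moreover have "riemann_xi 1 = 1/2" using riemann_xi_reflect[of 0] riemann_xi_0 by simp
    ultimately have "complex_of_real (pi / 6) = of_real (1/2)" using riemann_xi_2 by simp
    then have "pi / 6 = 1/2" by (simp only: of_real_eq_iff)
    then show False using pi_gt3 by simp
  qed
  show ?thesis
  proof (rule ccontr)
    assume "Re s \<noteq> 1/2"
    then consider "Re s > 1/2" | "Re s < 1/2" by linarith
    then show False
    proof cases
      case 1
      then show ?thesis using right[of s] s by simp
    next
      case 2
      have "((\<lambda>s. riemann_xi (1 - s)) has_field_derivative deriv riemann_xi (1 - s) * (- 1)) (at s)"
        by (rule DERIV_chain2[OF der]) (auto intro!: derivative_eq_intros)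
      then have "(riemann_xi has_field_derivative - deriv riemann_xi (1 - s)) (at s)"
        by (simp add: riemann_xi_reflect)
      with der have "deriv riemann_xi s = - deriv riemann_xi (1 - s)" by (rule DERIV_unique)
      with s have "deriv riemann_xi (1 - s) = 0" by simp
      then show ?thesis using right[of "1 - s"] 2 by simp
    qed
  qed
qed

section \<open>Symmetric linear maps of the plane\<close>

lemma orth_proj_eqI:
  assumes S: "subspace S" and p: "p \<in> S" "\<And>u. u \<in> S \<Longrightarrow> inner (x - p) u = 0"
  shows "orth_proj S x = p"
  unfolding orth_proj_def
proof (rule the_equality)
  fix q assume q: "q \<in> S \<and> (\<forall>u\<in>S. inner (x - q) u = 0)"
  have d: "p - q \<in> S" using S p(1) q by (simp add: subspace_diff)
  have "inner (p - q) (p - q) = inner (x - q) (p - q) - inner (x - p) (p - q)"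
    by (simp add: inner_diff_left[symmetric])
  also have "\<dots> = 0" using q p(2)[OF d] d by simp
  finally show "q = p" by simp
qed (use p in blast)

text \<open>Spectral form of a symmetric map: \<open>e\<close> and \<open>i * e\<close> are an
  orthonormal eigenbasis. Spectrum, projections and the search direction are all computed in these
  coordinates.\<close>

locale symmetric_plane_map =
  fixes A :: "complex \<Rightarrow> complex" and e :: complex and l1 l2 :: real
  assumes e: "norm e = 1"
    and A: "\<And>h. A h = (l1 * inner h e) *\<^sub>R e + (l2 * inner h (\<i> * e)) *\<^sub>R (\<i> * e)"
begin

lemma inner_e [simp]: "inner e e = 1" "inner (\<i> * e) (\<i> * e) = 1" "inner e (\<i> * e) = 0" "inner (\<i> * e) e = 0"
proof -
  show 1: "inner e e = 1" using e by (simp add: dot_square_norm)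
  then show "inner (\<i> * e) (\<i> * e) = 1" by (simp add: inner_complex_def)
  show "inner e (\<i> * e) = 0" "inner (\<i> * e) e = 0" by (simp_all add: inner_complex_def)
qed

lemma nonzero_e: "e \<noteq> 0" "\<i> * e \<noteq> 0"
  using e by auto

lemma expand: "h = inner h e *\<^sub>R e + inner h (\<i> * e) *\<^sub>R (\<i> * e)"
proof -
  have n: "(Re e)\<^sup>2 + (Im e)\<^sup>2 = 1" using e by (simp add: cmod_def)
  have "Re h = Re h * ((Re e)\<^sup>2 + (Im e)\<^sup>2)" "Im h = Im h * ((Re e)\<^sup>2 + (Im e)\<^sup>2)" using n by simp_all
  then show ?thesis
    by (simp add: complex_eq_iff inner_complex_def power2_eq_square algebra_simps)
qed

lemma inner_A [simp]: "inner (A h) e = l1 * inner h e" "inner (A h) (\<i> * e) = l2 * inner h (\<i> * e)"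
  by (simp_all add: A inner_add_left)

lemma eq_iff_coords: "h = k \<longleftrightarrow> inner h e = inner k e \<and> inner h (\<i> * e) = inner k (\<i> * e)"
  by (metis expand)

lemma eigen_coords: "A v = \<epsilon> *\<^sub>R v \<longleftrightarrow> (l1 - \<epsilon>) * inner v e = 0 \<and> (l2 - \<epsilon>) * inner v (\<i> * e) = 0"
  by (simp add: eq_iff_coords left_diff_distrib)

lemma eigvals: "eigvals A = {l1, l2}"
proof
  show "eigvals A \<subseteq> {l1, l2}"
  proof
    fix \<epsilon> assume "\<epsilon> \<in> eigvals A"
    then obtain v where v: "v \<noteq> 0" "A v = \<epsilon> *\<^sub>R v" by (auto simp: eigvals_def)
    then have "(l1 - \<epsilon>) * inner v e = 0" "(l2 - \<epsilon>) * inner v (\<i> * e) = 0" by (simp_all add: eigen_coords)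
    moreover have "inner v e \<noteq> 0 \<or> inner v (\<i> * e) \<noteq> 0" using v(1) eq_iff_coords[of v 0] by auto
    ultimately show "\<epsilon> \<in> {l1, l2}" by auto
  qed
  have "A e = l1 *\<^sub>R e" "A (\<i> * e) = l2 *\<^sub>R (\<i> * e)" by (simp_all add: eigen_coords)
  then show "{l1, l2} \<subseteq> eigvals A" unfolding eigvals_def using nonzero_e by blast
qed

lemma minsp: "minsp A = min \<bar>l1\<bar> \<bar>l2\<bar>"
  by (simp add: minsp_def eigvals cInf_eq_Min)

lemma pr_pos: "pr_pos A x = (if l1 > 0 then inner x e else 0) *\<^sub>R e + (if l2 > 0 then inner x (\<i> * e) else 0) *\<^sub>R (\<i> * e)"
  (is "_ = ?p")
  unfolding pr_pos_def
proof (rule orth_proj_eqI)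
  let ?V = "{v. \<exists>\<epsilon>>0. A v = \<epsilon> *\<^sub>R v}"
  have 1: "e \<in> ?V" if "l1 > 0" using that by (auto simp: eigen_coords intro!: exI[of _ l1])
  have 2: "\<i> * e \<in> ?V" if "l2 > 0" using that by (auto simp: eigen_coords intro!: exI[of _ l2])
  show "?p \<in> span ?V"
  proof (rule span_add)
    show "(if l1 > 0 then inner x e else 0) *\<^sub>R e \<in> span ?V"
      using span_mul[OF span_base[OF 1]] span_zero[of ?V] by simp
    show "(if l2 > 0 then inner x (\<i> * e) else 0) *\<^sub>R (\<i> * e) \<in> span ?V"
      using span_mul[OF span_base[OF 2]] span_zero[of ?V] by simp
  qed
  fix u assume "u \<in> span ?V"
  \<comment> \<open>An eigenvector with positive eigenvalue has coordinate 0 along each basis vector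
    whose own eigenvalue is not positive; this also covers \<open>l1 = l2\<close>.\<close>
  moreover have "orthogonal (x - ?p) v" if "v \<in> ?V" for v
  proof -
    obtain \<epsilon> where \<epsilon>0: "\<epsilon> > 0" "A v = \<epsilon> *\<^sub>R v" using \<open>v \<in> ?V\<close> by blast
    then have \<epsilon>: "\<epsilon> > 0" "(l1 - \<epsilon>) * inner v e = 0" "(l2 - \<epsilon>) * inner v (\<i> * e) = 0"
      unfolding eigen_coords by blast+
    have z: "inner v e = 0" if "\<not> l1 > 0" using \<epsilon>(1,2) that by auto
    have z': "inner v (\<i> * e) = 0" if "\<not> l2 > 0" using \<epsilon>(1,3) that by auto
    have "inner (x - ?p) v = inner (x - ?p) (inner v e *\<^sub>R e + inner v (\<i> * e) *\<^sub>R (\<i> * e))"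
      by (rule arg_cong[OF expand])
    also have "\<dots> = inner v e * (inner x e - (if l1 > 0 then inner x e else 0)) + inner v (\<i> * e) * (inner x (\<i> * e) - (if l2 > 0 then inner x (\<i> * e) else 0))"
      by (simp only: inner_add_right inner_add_left inner_diff_left inner_scaleR_left inner_scaleR_right inner_e) simp
    also have "\<dots> = 0" using z z' by auto
    finally show ?thesis by (simp add: orthogonal_def)
  qed
  ultimately show "inner (x - ?p) u = 0"
    using orthogonal_to_span[of u ?V "x - ?p"] by (simp add: orthogonal_def)
qed simp

lemma pr_neg: "pr_neg A x = (if l1 < 0 then inner x e else 0) *\<^sub>R e + (if l2 < 0 then inner x (\<i> * e) else 0) *\<^sub>R (\<i> * e)"
proof -
  interpret neg: symmetric_plane_map "\<lambda>h. - A h" e "- l1" "- l2"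
    by standard (simp_all only: e A minus_add_distrib mult_minus_left scaleR_minus_left add_uminus_conv_diff)
  have "(\<exists>\<epsilon><0. A v = \<epsilon> *\<^sub>R v) \<longleftrightarrow> (\<exists>\<epsilon>>0. - A v = \<epsilon> *\<^sub>R v)" for v
    by (metis add.inverse_inverse neg_0_less_iff_less scaleR_minus_left)
  then have "pr_neg A x = pr_pos (\<lambda>h. - A h) x"
    unfolding pr_neg_def pr_pos_def by simp
  then show ?thesis using neg.pr_pos[of x] by simp
qed

text \<open>Flipping the sign on the negative eigenspace replaces the inverse of \<open>A\<close> by
  the inverse of its absolute value \<open>|A|\<close>.\<close>

lemma reflected_solution:
  fixes g :: complex
  assumes nz: "l1 \<noteq> 0" "l2 \<noteq> 0"
  defines "v \<equiv> THE v. A v = g"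
  shows "pr_pos A v - pr_neg A v = (inner g e / \<bar>l1\<bar>) *\<^sub>R e + (inner g (\<i> * e) / \<bar>l2\<bar>) *\<^sub>R (\<i> * e)"
proof -
  have v: "v = (inner g e / l1) *\<^sub>R e + (inner g (\<i> * e) / l2) *\<^sub>R (\<i> * e)" (is "_ = ?v")
    unfolding v_def
  proof (rule the_equality)
    show "A ?v = g" using nz by (simp add: eq_iff_coords inner_add_left)
    show "u = ?v" if "A u = g" for u
      using nz that[symmetric] by (simp add: eq_iff_coords[of u] inner_add_left)
  qed
  have "inner v e = inner g e / l1" "inner v (\<i> * e) = inner g (\<i> * e) / l2"
    by (simp_all add: v inner_add_left)
  then show ?thesis
    unfolding pr_pos pr_neg using nz
    by (cases "l1 > 0"; cases "l2 > 0") (auto simp: algebra_simps)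
qed

lemma norm_square_coords: "(norm h)\<^sup>2 = (inner h e)\<^sup>2 + (inner h (\<i> * e))\<^sup>2"
proof -
  have "(norm h)\<^sup>2 = inner h h" by (rule power2_norm_eq_inner)
  also have "\<dots> = inner (inner h e *\<^sub>R e + inner h (\<i> * e) *\<^sub>R (\<i> * e)) (inner h e *\<^sub>R e + inner h (\<i> * e) *\<^sub>R (\<i> * e))"
    by (rule arg_cong2[where f = inner, OF expand expand])
  also have "\<dots> = (inner h e)\<^sup>2 + (inner h (\<i> * e))\<^sup>2"
    by (simp only: inner_add_right inner_add_left inner_scaleR_left inner_scaleR_right inner_e) (simp add: power2_eq_square)
  finally show ?thesis .
qed

text \<open>\<open>w\<close> is the inverse of \<open>|A|\<close> applied to \<open>g\<close>: small
  eigenvalues limit its length, large ones its slope against \<open>g\<close>. In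
  \<open>step_noncritical\<close> the lower bound \<open>m\<close> is a difference, so it may be
  negative.\<close>

lemma reflected_bounds:
  fixes g :: complex
  assumes nz: "l1 \<noteq> 0" "l2 \<noteq> 0"
  defines "w \<equiv> (inner g e / \<bar>l1\<bar>) *\<^sub>R e + (inner g (\<i> * e) / \<bar>l2\<bar>) *\<^sub>R (\<i> * e)"
  shows "\<And>m. m \<le> \<bar>l1\<bar> \<Longrightarrow> m \<le> \<bar>l2\<bar> \<Longrightarrow> norm w * m \<le> norm g"
    and "\<And>M. \<bar>l1\<bar> \<le> M \<Longrightarrow> \<bar>l2\<bar> \<le> M \<Longrightarrow> (norm g)\<^sup>2 \<le> M * inner w g"
proof -
  have w: "inner w e = inner g e / \<bar>l1\<bar>" "inner w (\<i> * e) = inner g (\<i> * e) / \<bar>l2\<bar>"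
    by (simp_all add: w_def inner_add_left)
  show "norm w * m \<le> norm g" if m: "m \<le> \<bar>l1\<bar>" "m \<le> \<bar>l2\<bar>" for m
  proof (cases "m > 0")
    case True
    have *: "(x / \<bar>l\<bar>)\<^sup>2 * m\<^sup>2 \<le> x\<^sup>2" if "m \<le> \<bar>l\<bar>" "l \<noteq> 0" for x l :: real
    proof -
      have "m\<^sup>2 \<le> \<bar>l\<bar>\<^sup>2" using True that by (intro power_mono) auto
      then have "x\<^sup>2 * m\<^sup>2 \<le> x\<^sup>2 * \<bar>l\<bar>\<^sup>2" by (intro mult_left_mono) auto
      then show ?thesis using that(2) by (simp add: power_divide field_simps)
    qed
    have "(norm w * m)\<^sup>2 \<le> (norm g)\<^sup>2"
      unfolding power_mult_distrib norm_square_coords[of w] norm_square_coords[of g] w distrib_right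
      by (intro add_mono * m nz)
    then show ?thesis by (rule power2_le_imp_le) simp
  next
    case False
    then have "norm w * m \<le> 0" by (simp add: mult_nonneg_nonpos)
    then show ?thesis using norm_ge_zero[of g] by linarith
  qed
  show "(norm g)\<^sup>2 \<le> M * inner w g" if M: "\<bar>l1\<bar> \<le> M" "\<bar>l2\<bar> \<le> M" for M
  proof -
    have *: "x\<^sup>2 \<le> M * (x / \<bar>l\<bar> * x)" if "\<bar>l\<bar> \<le> M" "l \<noteq> 0" for x l :: real
    proof -
      have "\<bar>l\<bar> * x\<^sup>2 \<le> M * x\<^sup>2" using that by (intro mult_right_mono) auto
      then show ?thesis using that(2) by (simp add: field_simps power2_eq_square)
    qed
    have "inner w g = inner g e / \<bar>l1\<bar> * inner g e + inner g (\<i> * e) / \<bar>l2\<bar> * inner g (\<i> * e)"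
      by (simp only: w_def inner_add_left inner_scaleR_left inner_commute[of g])
    then show ?thesis
      unfolding norm_square_coords[of g] by (simp only: distrib_left) (intro add_mono * M nz)
  qed
qed

end

text \<open>For a square root \<open>e\<close> of \<open>b / norm b\<close>, the map
  \<open>h -> b * cnj h\<close> multiplies \<open>e\<close> by \<open>norm b\<close> and
  \<open>i * e\<close> by \<open>- norm b\<close>.\<close>

lemma symmetric_plane_map_conj:
  fixes \<alpha> :: real and b :: complex
  obtains e where "symmetric_plane_map (\<lambda>h. of_real \<alpha> * h + b * cnj h) e (\<alpha> + norm b) (\<alpha> - norm b)"
proof -
  define e where "e = (if b = 0 then 1 else csqrt (b / of_real (norm b)))"
  have e2: "b = of_real (norm b) * e\<^sup>2" by (simp add: e_def)
  have "norm e = 1"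
    by (simp add: e_def norm_csqrt norm_divide)
  then have ee: "e * cnj e = 1" by (simp add: complex_norm_square[symmetric])
  have n: "(Re e)\<^sup>2 + (Im e)\<^sup>2 = 1" using \<open>norm e = 1\<close> by (simp add: cmod_def)
  have "symmetric_plane_map (\<lambda>h. of_real \<alpha> * h + b * cnj h) e (\<alpha> + norm b) (\<alpha> - norm b)"
  proof
    fix h
    define x y where "x = inner h e" and "y = inner h (\<i> * e)"
    have "Re h = Re h * ((Re e)\<^sup>2 + (Im e)\<^sup>2)" "Im h = Im h * ((Re e)\<^sup>2 + (Im e)\<^sup>2)" using n by simp_all
    then have h: "h = of_real x * e + of_real y * (\<i> * e)"
      by (simp add: x_def y_def complex_eq_iff inner_complex_def power2_eq_square algebra_simps)
    have "b * cnj h = of_real (norm b) * e * (e * cnj e) * (of_real x - \<i> * of_real y)"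
      by (subst h, subst e2) (simp add: power2_eq_square algebra_simps)
    then have "b * cnj h = of_real (norm b) * e * (of_real x - \<i> * of_real y)" by (simp add: ee)
    then have "of_real \<alpha> * h + b * cnj h = of_real \<alpha> * (of_real x * e + of_real y * (\<i> * e)) + of_real (norm b) * e * (of_real x - \<i> * of_real y)"
      using h by simp
    also have "\<dots> = ((\<alpha> + norm b) * x) *\<^sub>R e + ((\<alpha> - norm b) * y) *\<^sub>R (\<i> * e)"
      by (simp add: scaleR_conv_of_real algebra_simps)
    finally show "of_real \<alpha> * h + b * cnj h = ((\<alpha> + norm b) * inner h e) *\<^sub>R e + ((\<alpha> - norm b) * inner h (\<i> * e)) *\<^sub>R (\<i> * e)"
      by (simp add: x_def y_def)
  qed fact
  then show ?thesis by (rule that)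
qed

section \<open>Gradient and Hessian of half the squared modulus\<close>

lemma grad_half_norm_square:
  assumes "(f has_field_derivative f') (at z)"
  shows "grad (\<lambda>z. (cmod (f z))\<^sup>2 / 2) z = f z * cnj f'"
  unfolding grad_def frechet_derivative_at[OF half_norm_square_has_derivative[OF assms], symmetric]
  by (simp add: complex_eq_iff inner_complex_def)

lemma hess_half_norm_square:
  assumes f: "f holomorphic_on UNIV"
  shows "hess (\<lambda>z. (cmod (f z))\<^sup>2 / 2) z = (\<lambda>h. of_real ((cmod (deriv f z))\<^sup>2) * h + f z * cnj (deriv (deriv f) z) * cnj h)"
proof -
  have d1: "(f has_field_derivative deriv f z) (at z)" for z
    using f by (simp add: holomorphic_derivI)
  have d2: "(deriv f has_field_derivative deriv (deriv f) z) (at z)" for z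
    using holomorphic_deriv[OF f open_UNIV] by (simp add: holomorphic_derivI)
  have g: "grad (\<lambda>z. (cmod (f z))\<^sup>2 / 2) = (\<lambda>z. f z * cnj (deriv f z))"
    by (rule ext) (rule grad_half_norm_square[OF d1])
  have "((\<lambda>z. f z * cnj (deriv f z)) has_derivative (\<lambda>h. f z * cnj (deriv (deriv f) z * h) + deriv f z * h * cnj (deriv f z))) (at z)"
    using d1[of z] d2[of z] unfolding has_field_derivative_def by (auto intro!: derivative_eq_intros)
  from frechet_derivative_at[OF this]
  show ?thesis unfolding hess_def g
    by (auto simp: fun_eq_iff complex_norm_square algebra_simps simp del: of_real_power)
qed

section \<open>The dynamics of BNQN\<close>

text \<open>Both limits come from \<open>h = f / f'\<close>, which extends holomorphically over
  \<open>c\<close> with \<open>h c = 0\<close> and \<open>h' c = 1 / n\<close>, where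
  \<open>n\<close> is the order of the zero; indeed \<open>f * f'' / f'^2 = 1 - h'\<close>.\<close>

lemma zero_log_derivative_limits:
  fixes f :: "complex \<Rightarrow> complex"
  assumes f: "f holomorphic_on UNIV" "\<not> f constant_on UNIV" and c: "f c = 0"
  obtains n :: nat where "n > 0"
    and "((\<lambda>z. f z / deriv f z) \<longlongrightarrow> 0) (at c)"
    and "((\<lambda>z. f z * deriv (deriv f) z / (deriv f z)\<^sup>2) \<longlongrightarrow> 1 - 1 / of_nat n) (at c)"
    and "\<forall>\<^sub>F z in at c. f z \<noteq> 0 \<and> deriv f z \<noteq> 0"
proof -
  obtain g r n where n: "0 < n" and r: "0 < r" and g: "g holomorphic_on ball c r"
    and fg: "\<And>w. w \<in> ball c r \<Longrightarrow> f w = (w - c) ^ n * g w"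
    and gnz: "\<And>w. w \<in> ball c r \<Longrightarrow> g w \<noteq> 0"
    using holomorphic_factor_zero_nonconstant[OF f(1) open_UNIV connected_UNIV UNIV_I c f(2)] by metis
  \<comment> \<open>The cofactor of \<open>(z - c) ^ (n - 1)\<close> in \<open>deriv f\<close>; its
    value \<open>n * g c\<close> at \<open>c\<close> is nonzero.\<close>
  define u where "u z = of_nat n * g z + (z - c) * deriv g z" for z
  have uh: "u holomorphic_on ball c r"
    unfolding u_def by (intro holomorphic_intros g holomorphic_deriv) auto
  have uc: "u c \<noteq> 0" using gnz[of c] n r by (simp add: u_def)
  have f': "deriv f z = (z - c) ^ (n - 1) * u z" if z: "z \<in> ball c r" for z
  proof -
    have "(g has_field_derivative deriv g z) (at z)"
      using g z by (simp add: holomorphic_derivI)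
    then have "((\<lambda>w. (w - c) ^ n * g w) has_field_derivative (of_nat n * (z - c) ^ (n - 1) * g z + (z - c) ^ n * deriv g z)) (at z)"
      by (auto intro!: derivative_eq_intros)
    then have "(f has_field_derivative (of_nat n * (z - c) ^ (n - 1) * g z + (z - c) ^ n * deriv g z)) (at z)"
      by (rule has_field_derivative_transform_within_open[of _ _ _ "ball c r"]) (use z fg in auto)
    then have "deriv f z = of_nat n * (z - c) ^ (n - 1) * g z + (z - c) ^ n * deriv g z"
      by (rule DERIV_imp_deriv)
    also have "(z - c) ^ n = (z - c) ^ (n - 1) * (z - c)" using n by (metis Suc_diff_1 power_Suc2)
    finally show ?thesis by (simp add: u_def algebra_simps)
  qed
  have "continuous (at c) u"
    using holomorphic_on_imp_continuous_on[OF uh] r by (simp add: continuous_on_eq_continuous_at)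
  from continuous_at_avoid[OF this uc] obtain r1 where r1: "r1 > 0" "\<And>z. dist c z < r1 \<Longrightarrow> u z \<noteq> 0" by blast
  define \<rho> where "\<rho> = min r r1"
  define B where "B = ball c \<rho>"
  have B: "open B" "c \<in> B" "B \<subseteq> ball c r" and unz: "\<And>z. z \<in> B \<Longrightarrow> u z \<noteq> 0"
    using r r1 by (auto simp: B_def \<rho>_def)
  have fnz: "f z \<noteq> 0" "deriv f z \<noteq> 0" if "z \<in> B - {c}" for z
    using that B(3) fg[of z] f'[of z] gnz[of z] unz[of z] by auto
  define k where "k z = g z / u z" for z
  define h where "h z = (z - c) * k z" for z
  have kB: "k holomorphic_on B"
    unfolding k_def using unz by (intro holomorphic_intros holomorphic_on_subset[OF g B(3)] holomorphic_on_subset[OF uh B(3)])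
  have hB: "h holomorphic_on B"
    unfolding h_def by (intro holomorphic_intros kB)
  have hq: "f z / deriv f z = h z" if "z \<in> B - {c}" for z
  proof -
    have "z \<in> ball c r" using that B(3) by auto
    moreover have "(z - c) ^ n = (z - c) ^ (n - 1) * (z - c)" using n by (metis Suc_diff_1 power_Suc2)
    ultimately show ?thesis using that by (simp add: fg f' h_def k_def)
  qed
  have evB: "\<forall>\<^sub>F z in at c. z \<in> B - {c}"
    unfolding eventually_at_topological using B by auto
  have "isCont h c"
    using holomorphic_on_imp_continuous_on[OF hB] B by (simp add: continuous_on_eq_continuous_at)
  then have "(h \<longlongrightarrow> 0) (at c)" by (simp add: isCont_def h_def)
  then have lim1: "((\<lambda>z. f z / deriv f z) \<longlongrightarrow> 0) (at c)"
    by (rule Lim_transform_eventually) (use evB in \<open>eventually_elim, simp add: hq\<close>)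
  have dh: "deriv h z = k z + (z - c) * deriv k z" if "z \<in> B" for z
  proof -
    have "(k has_field_derivative deriv k z) (at z)"
      using kB B(1) that by (simp add: holomorphic_derivI)
    then have "(h has_field_derivative (k z + (z - c) * deriv k z)) (at z)"
      unfolding h_def[abs_def] by (auto intro!: derivative_eq_intros)
    then show ?thesis by (rule DERIV_imp_deriv)
  qed
  have "isCont (deriv h) c"
    using holomorphic_on_imp_continuous_on[OF holomorphic_deriv[OF hB B(1)]] B by (simp add: continuous_on_eq_continuous_at)
  moreover have "deriv h c = 1 / of_nat n"
    using dh[OF B(2)] gnz[of c] r by (simp add: k_def u_def)
  ultimately have "((\<lambda>z. 1 - deriv h z) \<longlongrightarrow> 1 - 1 / of_nat n) (at c)"
    by (intro tendsto_diff tendsto_const) (simp add: isCont_def)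
  moreover have "1 - deriv h z = f z * deriv (deriv f) z / (deriv f z)\<^sup>2" if "z \<in> B - {c}" for z
  proof -
    have d1: "(f has_field_derivative deriv f z) (at z)"
      using f(1) by (simp add: holomorphic_derivI)
    have d2: "(deriv f has_field_derivative deriv (deriv f) z) (at z)"
      using holomorphic_deriv[OF f(1) open_UNIV] by (simp add: holomorphic_derivI)
    have "((\<lambda>z. f z / deriv f z) has_field_derivative (deriv f z * deriv f z - f z * deriv (deriv f) z) / (deriv f z * deriv f z)) (at z)"
      by (rule DERIV_divide[OF d1 d2 fnz(2)[OF that]])
    then have "(h has_field_derivative (deriv f z * deriv f z - f z * deriv (deriv f) z) / (deriv f z * deriv f z)) (at z)"
      by (rule has_field_derivative_transform_within_open[of _ _ _ "B - {c}"]) (use that B(1) hq in auto)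
    then have "deriv h z = (deriv f z * deriv f z - f z * deriv (deriv f) z) / (deriv f z * deriv f z)"
      by (rule DERIV_imp_deriv)
    then show ?thesis using fnz(2)[OF that] by (simp add: power2_eq_square diff_divide_distrib)
  qed
  ultimately have lim2: "((\<lambda>z. f z * deriv (deriv f) z / (deriv f z)\<^sup>2) \<longlongrightarrow> 1 - 1 / of_nat n) (at c)"
    by (elim Lim_transform_eventually) (use evB in \<open>eventually_elim, simp\<close>)
  have "\<forall>\<^sub>F z in at c. f z \<noteq> 0 \<and> deriv f z \<noteq> 0"
    using evB by eventually_elim (use fnz in auto)
  with n lim1 lim2 show ?thesis by (rule that)
qed

section \<open>A single BNQN step for a nonconstant entire function\<close>

locale bnqn_entire =
  fixes f :: "complex \<Rightarrow> complex" and d0 d1 d2 \<theta> \<tau> :: real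
  assumes hol: "f holomorphic_on UNIV" and nonconst: "\<not> f constant_on UNIV"
    and distinct: "d0 \<noteq> d1" "d0 \<noteq> d2" "d1 \<noteq> d2" and \<theta>: "\<theta> > 0" and \<tau>: "\<tau> > 0"
begin

definition F :: "complex \<Rightarrow> real" where "F z = (cmod (f z))\<^sup>2 / 2"
definition G :: "complex \<Rightarrow> complex" where "G z = f z * cnj (deriv f z)"
definition \<phi> :: "complex \<Rightarrow> complex" where "\<phi> = bnqn_step d0 d1 d2 \<theta> \<tau> F"
definition shift_bound :: real where "shift_bound = max \<bar>d0\<bar> (max \<bar>d1\<bar> \<bar>d2\<bar>)"
text \<open>The constant \<kappa> of the method.\<close>

definition gap :: real where "gap = Min {\<bar>d0 - d1\<bar>, \<bar>d0 - d2\<bar>, \<bar>d1 - d2\<bar>} / 2"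
text \<open>\<open>H1\<close> and \<open>H2\<close> are the coefficients of the Hessian, whose
  eigenvalues are \<open>H1 z + norm (H2 z)\<close> and \<open>H1 z - norm (H2 z)\<close>.\<close>

definition H1 :: "complex \<Rightarrow> real" where "H1 z = (cmod (deriv f z))\<^sup>2"
definition H2 :: "complex \<Rightarrow> complex" where "H2 z = f z * cnj (deriv (deriv f) z)"

lemma deriv1: "(f has_field_derivative deriv f z) (at z)"
  using hol by (simp add: holomorphic_derivI)

lemma holomorphic_deriv_f: "deriv f holomorphic_on UNIV"
  by (rule holomorphic_deriv[OF hol open_UNIV])

lemma continuous_on_derivs: "continuous_on S f" "continuous_on S (deriv f)" "continuous_on S (deriv (deriv f))"
  using hol holomorphic_deriv_f holomorphic_deriv[OF holomorphic_deriv_f open_UNIV]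
  by (auto intro: holomorphic_on_imp_continuous_on holomorphic_on_subset)

lemma continuous_on_F: "continuous_on S F"
  unfolding F_def by (intro continuous_intros continuous_on_derivs) simp

lemma continuous_on_G: "continuous_on S G"
  unfolding G_def by (intro continuous_intros continuous_on_derivs)

lemma grad_F: "grad F = G"
proof
  show "grad F z = G z" for z
    using grad_half_norm_square[OF deriv1[of z]] by (simp add: F_def[abs_def] G_def)
qed

lemma hess_F: "hess F z = (\<lambda>h. of_real (H1 z) * h + H2 z * cnj h)"
  using hess_half_norm_square[OF hol, of z] by (simp add: F_def[abs_def] H1_def H2_def)

lemma gap_pos: "gap > 0"
  using distinct by (simp add: gap_def)

lemma gap_le: "2 * gap \<le> \<bar>d0 - d1\<bar>" "2 * gap \<le> \<bar>d0 - d2\<bar>" "2 * gap \<le> \<bar>d1 - d2\<bar>"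
  by (simp_all add: gap_def)

definition shifted :: "complex \<Rightarrow> real \<Rightarrow> complex \<Rightarrow> complex" where
  "shifted z s h = of_real (H1 z + s) * h + H2 z * cnj h"

lemma shifted_eq: "(of_real (H1 z) * h + H2 z * cnj h) + s *\<^sub>R h = shifted z s h"
  by (simp add: shifted_def scaleR_conv_of_real algebra_simps)

lemma shifted_plane_map:
  obtains e where "symmetric_plane_map (shifted z s) e (H1 z + s + norm (H2 z)) (H1 z + s - norm (H2 z))"
  unfolding shifted_def[abs_def] using symmetric_plane_map_conj[of "H1 z + s" "H2 z"] by blast

lemma minsp_shifted: "minsp (shifted z s) = min \<bar>H1 z + s + norm (H2 z)\<bar> \<bar>H1 z + s - norm (H2 z)\<bar>"
  using shifted_plane_map symmetric_plane_map.minsp by metis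

text \<open>If the Hessian vanishes, the solution \<open>THE v. A v = 0\<close> is unspecified, but both eigenspace
  projections of it are \<open>0\<close>.\<close>

lemma step_critical:
  assumes G: "G z = 0"
  shows "\<phi> z = z"
proof -
  obtain e where e: "symmetric_plane_map (shifted z 0) e (H1 z + 0 + norm (H2 z)) (H1 z + 0 - norm (H2 z))"
    by (rule shifted_plane_map)
  interpret symmetric_plane_map "shifted z 0" e "H1 z + 0 + norm (H2 z)" "H1 z + 0 - norm (H2 z)" by (rule e)
  let ?v = "THE v. shifted z 0 v = 0"
  have "f z = 0 \<or> deriv f z = 0" using G by (simp add: G_def)
  then have "H2 z = 0 \<or> H1 z = 0" by (auto simp: H1_def H2_def)
  \<comment> \<open>Either both eigenvalues vanish or neither does: they coincide if
    \<open>H2 z = 0\<close> and are opposite if \<open>H1 z = 0\<close>.\<close>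
  then consider "H1 z + 0 + norm (H2 z) = 0" "H1 z + 0 - norm (H2 z) = 0"
    | "H1 z + 0 + norm (H2 z) \<noteq> 0" "H1 z + 0 - norm (H2 z) \<noteq> 0" by fastforce
  then have w: "pr_pos (shifted z 0) ?v - pr_neg (shifted z 0) ?v = 0"
  proof cases
    case 1
    then show ?thesis unfolding pr_pos pr_neg by simp
  next
    case 2
    show ?thesis unfolding reflected_solution[OF 2] by simp
  qed
  show ?thesis
    unfolding \<phi>_def bnqn_step_def Let_def grad_F hess_F shifted_eq using w by (simp add: G)
qed

definition clip :: "complex \<Rightarrow> complex" where
  "clip w = (1 / max 1 (\<theta> * norm w)) *\<^sub>R w"

text \<open>The \<open>LEAST\<close> is meaningful only if some exponent satisfies Armijo's
  condition; at noncritical points \<open>uniform_decrease\<close> provides one.\<close>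

definition halvings :: "complex \<Rightarrow> complex \<Rightarrow> nat" where
  "halvings z v = (LEAST m. F (z - (1/2) ^ m *\<^sub>R v) - F z \<le> - ((1/2) ^ m) * inner v (G z) / 3)"

text \<open>All that is used of the direction. The two length bounds come from the eigenvalue test
  and from the Hessian itself, whose eigenvalue nearest to 0 has absolute value
  \<open>|H1 - norm H2|\<close> because \<open>H1 >= 0\<close>; the third property makes
  \<open>w\<close> a descent direction.\<close>

lemma step_noncritical:
  assumes G: "G z \<noteq> 0"
  obtains w where "norm w * (gap * norm (G z) powr \<tau>) \<le> norm (G z)"
    and "norm w * (\<bar>H1 z - norm (H2 z)\<bar> - shift_bound * norm (G z) powr \<tau>) \<le> norm (G z)"
    and "(norm (G z))\<^sup>2 \<le> (H1 z + norm (H2 z) + shift_bound * norm (G z) powr \<tau>) * inner w (G z)"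
    and "\<phi> z = z - (1/2) ^ halvings z (clip w) *\<^sub>R clip w"
proof -
  define c where "c = norm (G z) powr \<tau>"
  have c: "c > 0" using G by (simp add: c_def)
  define \<delta> where "\<delta> = (\<lambda>j::nat. if j = 0 then d0 else if j = 1 then d1 else d2)"
  define P where "P = (\<lambda>j. j \<in> {0,1,2} \<and> minsp (shifted z (\<delta> j * c)) \<ge> gap * c)"
  define j where "j = (LEAST j. P j)"
  \<comment> \<open>Two shifted copies of the same eigenvalue are at least
    \<open>2 * gap * c\<close> apart and cannot both fail the test. So each of the two eigenvalues
    excludes at most one of the three shifts.\<close>
  have far: "\<not> (\<bar>a + p * c\<bar> < gap * c \<and> \<bar>a + q * c\<bar> < gap * c)" if "2 * gap \<le> \<bar>p - q\<bar>" for a p q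
  proof
    assume "\<bar>a + p * c\<bar> < gap * c \<and> \<bar>a + q * c\<bar> < gap * c"
    then have "\<bar>p * c - q * c\<bar> < 2 * gap * c" by linarith
    moreover have "\<bar>p * c - q * c\<bar> = \<bar>p - q\<bar> * c" using c by (simp add: left_diff_distrib[symmetric] abs_mult)
    moreover have "2 * gap * c \<le> \<bar>p - q\<bar> * c" using that c by (intro mult_right_mono) auto
    ultimately show False by linarith
  qed
  have "\<exists>j. P j"
  proof (rule ccontr)
    let ?a = "H1 z + norm (H2 z)" and ?b = "H1 z - norm (H2 z)"
    assume "\<nexists>j. P j"
    then have "\<not> P 0" "\<not> P 1" "\<not> P 2" by blast+
    then have "\<bar>?a + d0 * c\<bar> < gap * c \<or> \<bar>?b + d0 * c\<bar> < gap * c"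
      "\<bar>?a + d1 * c\<bar> < gap * c \<or> \<bar>?b + d1 * c\<bar> < gap * c"
      "\<bar>?a + d2 * c\<bar> < gap * c \<or> \<bar>?b + d2 * c\<bar> < gap * c"
      unfolding P_def minsp_shifted \<delta>_def by (simp_all add: min_le_iff_disj not_le algebra_simps)
    then show False
      using far[OF gap_le(1)] far[OF gap_le(2)] far[OF gap_le(3)] by blast
  qed
  then have Pj: "P j" unfolding j_def by (rule LeastI_ex)
  define s where "s = \<delta> j * c"
  obtain e where e: "symmetric_plane_map (shifted z s) e (H1 z + s + norm (H2 z)) (H1 z + s - norm (H2 z))"
    by (rule shifted_plane_map)
  define l1 l2 where "l1 = H1 z + s + norm (H2 z)" and "l2 = H1 z + s - norm (H2 z)"
  interpret symmetric_plane_map "shifted z s" e l1 l2 using e by (simp add: l1_def l2_def)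
  have l: "gap * c \<le> \<bar>l1\<bar>" "gap * c \<le> \<bar>l2\<bar>"
    using Pj unfolding P_def s_def[symmetric] minsp by auto
  then have nz: "l1 \<noteq> 0" "l2 \<noteq> 0" using mult_pos_pos[OF gap_pos c] by auto
  define w where "w = pr_pos (shifted z s) (THE v. shifted z s v = G z) - pr_neg (shifted z s) (THE v. shifted z s v = G z)"
  have w: "w = (inner (G z) e / \<bar>l1\<bar>) *\<^sub>R e + (inner (G z) (\<i> * e) / \<bar>l2\<bar>) *\<^sub>R (\<i> * e)"
    unfolding w_def by (rule reflected_solution[OF nz])
  have "\<bar>\<delta> j\<bar> \<le> shift_bound" by (simp add: \<delta>_def shift_bound_def le_max_iff_disj)
  then have s: "\<bar>s\<bar> \<le> shift_bound * c" using c by (simp add: s_def abs_mult mult_right_mono)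
  have H1: "H1 z \<ge> 0" by (simp add: H1_def)
  have \<phi>: "\<phi> z = z - (1/2) ^ halvings z (clip w) *\<^sub>R clip w"
    unfolding \<phi>_def bnqn_step_def Let_def grad_F hess_F shifted_eq if_not_P[OF G]
      c_def[symmetric] \<delta>_def[symmetric] gap_def[symmetric] P_def[symmetric] j_def[symmetric] s_def[symmetric] w_def[symmetric]
      clip_def[symmetric] halvings_def[symmetric] ..
  show ?thesis
  proof (rule that[OF _ _ _ \<phi>])
    show "norm w * (gap * norm (G z) powr \<tau>) \<le> norm (G z)"
      unfolding w c_def[symmetric] by (rule reflected_bounds(1)[OF nz l])
    show "norm w * (\<bar>H1 z - norm (H2 z)\<bar> - shift_bound * norm (G z) powr \<tau>) \<le> norm (G z)"
      unfolding w c_def[symmetric]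
      by (rule reflected_bounds(1)[OF nz]) (use s H1 norm_ge_zero[of "H2 z"] in \<open>unfold l1_def l2_def, linarith+\<close>)
    show "(norm (G z))\<^sup>2 \<le> (H1 z + norm (H2 z) + shift_bound * norm (G z) powr \<tau>) * inner w (G z)"
      unfolding w c_def[symmetric]
      by (rule reflected_bounds(2)[OF nz]) (use s H1 norm_ge_zero[of "H2 z"] in \<open>unfold l1_def l2_def, linarith+\<close>)
  qed
qed

lemma continuous_on_H: "continuous_on S H1" "continuous_on S H2"
  unfolding H1_def H2_def by (intro continuous_intros continuous_on_derivs)+

lemma F_line_derivative:
  "((\<lambda>t. F (z - t *\<^sub>R v)) has_real_derivative - inner v (G (z - t *\<^sub>R v))) (at t)"
proof -
  have "(F has_derivative (\<lambda>h. inner h (G (z - t *\<^sub>R v)))) (at (z - t *\<^sub>R v))"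
    using half_norm_square_has_derivative[OF deriv1[of "z - t *\<^sub>R v"]] by (simp add: F_def[abs_def] G_def)
  moreover have "((\<lambda>t. z - t *\<^sub>R v) has_derivative (\<lambda>h. - (h *\<^sub>R v))) (at t)"
    by (auto intro!: derivative_eq_intros)
  ultimately have "((\<lambda>t. F (z - t *\<^sub>R v)) has_derivative (\<lambda>h. inner (- (h *\<^sub>R v)) (G (z - t *\<^sub>R v)))) (at t)"
    by (rule has_derivative_compose[rotated])
  moreover have "(\<lambda>h. inner (- (h *\<^sub>R v)) (G (z - t *\<^sub>R v))) = (*) (- inner v (G (z - t *\<^sub>R v)))"
    by (auto simp: mult.commute)
  ultimately show ?thesis by (simp add: has_field_derivative_def)
qed

text \<open>Near a noncritical point the direction is bounded and uniformly a descent direction, and the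
  gradient is uniformly continuous, so that the backtracking stops after a bounded number of halvings.\<close>

lemma uniform_decrease:
  assumes z0: "G z0 \<noteq> 0"
  obtains r \<eta> where "r > 0" "\<eta> > 0" "\<And>z. dist z0 z < r \<Longrightarrow> F (\<phi> z) \<le> F z - \<eta>"
proof -
  define \<epsilon> where "\<epsilon> = norm (G z0) / 2"
  have \<epsilon>: "\<epsilon> > 0" using z0 by (simp add: \<epsilon>_def)
  have "continuous (at z0) G"
    using continuous_on_G[of UNIV] by (simp add: continuous_on_eq_continuous_at)
  then obtain r0 where r0: "r0 > 0" "\<And>z. dist z z0 < r0 \<Longrightarrow> dist (G z) (G z0) < \<epsilon>"
    using \<epsilon> unfolding continuous_at_eps_delta by blast
  define r where "r = min r0 1"
  have r: "r > 0" using r0 by (simp add: r_def)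
  have Glow: "norm (G z) \<ge> \<epsilon>" and Gup: "norm (G z) \<le> 3 * \<epsilon>" if "dist z0 z < r" for z
  proof -
    have "norm (G z - G z0) < \<epsilon>" using r0(2)[of z] that by (simp add: r_def dist_norm norm_minus_commute)
    moreover have "norm (G z0) = 2 * \<epsilon>" by (simp add: \<epsilon>_def)
    ultimately show "norm (G z) \<ge> \<epsilon>" "norm (G z) \<le> 3 * \<epsilon>"
      using norm_triangle_ineq2[of "G z" "G z0"] norm_triangle_ineq3[of "G z" "G z0"] by linarith+
  qed
  have "bounded ((\<lambda>z. H1 z + norm (H2 z) + shift_bound * (3 * \<epsilon>) powr \<tau>) ` cball z0 1)"
    by (intro compact_imp_bounded compact_continuous_image continuous_intros continuous_on_H) simp
  then obtain M0 where M0: "\<And>z. z \<in> cball z0 1 \<Longrightarrow> norm (H1 z + norm (H2 z) + shift_bound * (3 * \<epsilon>) powr \<tau>) \<le> M0"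
    unfolding bounded_iff by blast
  define M where "M = max M0 1"
  have sb: "shift_bound \<ge> 0" by (simp add: shift_bound_def)
  \<comment> \<open>With \<open>norm (G z)\<close> between \<epsilon> and 3 \<epsilon>,
    \<open>W\<close> bounds the direction by the eigenvalue test, \<open>M\<close> bounds the
    shifted eigenvalues, and \<eta> is the resulting lower bound of \<open>inner v (G z)\<close> for
    the clipped direction.\<close>
  define W where "W = 3 * \<epsilon> / (gap * \<epsilon> powr \<tau>)"
  have W: "W \<ge> 0" using \<epsilon> gap_pos by (simp add: W_def)
  define \<eta> where "\<eta> = \<epsilon>\<^sup>2 / M / max 1 (\<theta> * W)"
  have M1: "M \<ge> 1" by (simp add: M_def)
  have \<eta>: "\<eta> > 0" using \<epsilon> M1 by (simp add: \<eta>_def)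
  have "uniformly_continuous_on (cball z0 (1 + W)) G"
    by (rule compact_uniformly_continuous[OF continuous_on_G]) simp
  moreover have "\<eta> / (2 * (W + 1)) > 0" using \<eta> W by simp
  ultimately obtain \<delta> where \<delta>: "\<delta> > 0" "\<And>x y. x \<in> cball z0 (1 + W) \<Longrightarrow> y \<in> cball z0 (1 + W) \<Longrightarrow> dist y x < \<delta> \<Longrightarrow> dist (G y) (G x) < \<eta> / (2 * (W + 1))"
    unfolding uniformly_continuous_on_def by metis
  \<comment> \<open>So many halvings that a step along any direction of length at most
    \<open>W\<close> moves by less than \<delta>.\<close>
  obtain m0 where m0: "(1/2) ^ m0 < \<delta> / (W + 1)"
    using real_arch_pow_inv[of "\<delta> / (W + 1)" "1/2"] \<delta>(1) W by auto
  have dec: "F (\<phi> z) \<le> F z - (1/2) ^ m0 * \<eta> / 3" if z: "dist z0 z < r" for z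
  proof -
    have Gz: "G z \<noteq> 0" using Glow[OF z] \<epsilon> by auto
    obtain w where w1: "norm w * (gap * norm (G z) powr \<tau>) \<le> norm (G z)"
      and "norm w * (\<bar>H1 z - norm (H2 z)\<bar> - shift_bound * norm (G z) powr \<tau>) \<le> norm (G z)"
      and w3: "(norm (G z))\<^sup>2 \<le> (H1 z + norm (H2 z) + shift_bound * norm (G z) powr \<tau>) * inner w (G z)"
      and \<phi>z: "\<phi> z = z - (1/2) ^ halvings z (clip w) *\<^sub>R clip w"
      by (rule step_noncritical[OF Gz])
    define v where "v = clip w"
    define armijo where "armijo m \<longleftrightarrow> F (z - (1/2) ^ m *\<^sub>R v) - F z \<le> - ((1/2) ^ m) * inner v (G z) / 3" for m :: nat
    have \<phi>z: "\<phi> z = z - (1/2) ^ (LEAST m. armijo m) *\<^sub>R v"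
      using \<phi>z unfolding v_def[symmetric] halvings_def armijo_def[symmetric] .
    have "norm w * (gap * \<epsilon> powr \<tau>) \<le> norm w * (gap * norm (G z) powr \<tau>)"
      using Glow[OF z] \<epsilon> gap_pos \<tau> by (intro mult_left_mono powr_mono2) auto
    also have "\<dots> \<le> 3 * \<epsilon>" using w1 Gup[OF z] by linarith
    finally have wW: "norm w \<le> W"
      using gap_pos \<epsilon> by (simp add: W_def pos_le_divide_eq)
    have "z \<in> cball z0 1" using z by (simp add: r_def)
    have K: "H1 z + norm (H2 z) + shift_bound * norm (G z) powr \<tau> \<le> M"
    proof -
      have "shift_bound * norm (G z) powr \<tau> \<le> shift_bound * (3 * \<epsilon>) powr \<tau>"
        using Gup[OF z] \<tau> sb by (intro mult_left_mono powr_mono2) auto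
      then show ?thesis using M0[OF \<open>z \<in> cball z0 1\<close>] by (simp add: M_def)
    qed
    have K0: "H1 z + norm (H2 z) + shift_bound * norm (G z) powr \<tau> \<ge> 0"
      using sb by (simp add: H1_def)
    have wpos: "inner w (G z) > 0"
    proof (rule ccontr)
      assume "\<not> inner w (G z) > 0"
      then have "(H1 z + norm (H2 z) + shift_bound * norm (G z) powr \<tau>) * inner w (G z) \<le> 0"
        using K0 by (intro mult_nonneg_nonpos) auto
      moreover have "(norm (G z))\<^sup>2 > 0" using Gz by simp
      ultimately show False using w3 by linarith
    qed
    have "\<epsilon>\<^sup>2 \<le> (norm (G z))\<^sup>2" using Glow[OF z] \<epsilon> by (intro power_mono) auto
    also have "\<dots> \<le> M * inner w (G z)"
      using w3 mult_right_mono[OF K, of "inner w (G z)"] wpos by linarith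
    finally have "\<epsilon>\<^sup>2 / M \<le> inner w (G z)" using M1 by (simp add: pos_divide_le_eq mult.commute)
    moreover have "max 1 (\<theta> * norm w) \<le> max 1 (\<theta> * W)"
      using wW \<theta> by (intro max.mono) auto
    ultimately have "\<eta> \<le> inner w (G z) / max 1 (\<theta> * norm w)"
      unfolding \<eta>_def using \<epsilon> M1 wpos by (intro frac_le) auto
    then have vG: "\<eta> \<le> inner v (G z)" by (simp add: v_def clip_def)
    have "norm v \<le> norm w"
    proof -
      have "norm v = norm w / max 1 (\<theta> * norm w)" by (simp add: v_def clip_def)
      also have "\<dots> \<le> norm w / 1" by (rule divide_left_mono) auto
      finally show ?thesis by simp
    qed
    with wW have vW: "norm v \<le> W" by linarith
    have "armijo m0"
    proof -
      define s where "s = (1/2::real) ^ m0"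
      have s: "0 < s" "s \<le> 1" "s < \<delta> / (W + 1)" using m0 by (auto simp: s_def power_le_one)
      obtain t where t: "0 < t" "t < s" "F (z - s *\<^sub>R v) - F (z - 0 *\<^sub>R v) = (s - 0) * (- inner v (G (z - t *\<^sub>R v)))"
        using MVT2[OF s(1), of "\<lambda>t. F (z - t *\<^sub>R v)" "\<lambda>t. - inner v (G (z - t *\<^sub>R v))"] F_line_derivative by blast
      have tv: "norm (t *\<^sub>R v) \<le> t * W" using t vW by (simp add: mult_left_mono)
      have "t * W \<le> 1 * W" using t s W by (intro mult_right_mono) auto
      then have "norm (t *\<^sub>R v) \<le> W" using tv by linarith
      then have "dist z0 (z - t *\<^sub>R v) \<le> dist z0 z + W"
        using dist_triangle[of z0 "z - t *\<^sub>R v" z] by (simp add: dist_norm)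
      then have i1: "z - t *\<^sub>R v \<in> cball z0 (1 + W)" using z by (simp add: r_def)
      have i2: "z \<in> cball z0 (1 + W)" using z W by (simp add: r_def)
      have "t * W \<le> s * (W + 1)" using t s W by (intro mult_mono) auto
      also have "\<dots> < \<delta>" using s(3) W by (simp add: pos_less_divide_eq)
      finally have "dist (z - t *\<^sub>R v) z < \<delta>" using tv by (simp add: dist_norm)
      then have "norm (G (z - t *\<^sub>R v) - G z) < \<eta> / (2 * (W + 1))"
        using \<delta>(2)[OF i2 i1] by (simp add: dist_norm)
      then have "norm v * norm (G (z - t *\<^sub>R v) - G z) \<le> (W + 1) * (\<eta> / (2 * (W + 1)))"
        using vW W by (intro mult_mono) auto
      also have "\<dots> = \<eta> / 2"
      proof -
        have "x * (\<eta> / (2 * x)) = \<eta> / 2" if "x \<noteq> 0" for x using that by simp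
        then show ?thesis using W by (metis add_nonneg_pos less_irrefl zero_less_one)
      qed
      finally have "\<bar>inner v (G (z - t *\<^sub>R v) - G z)\<bar> \<le> \<eta> / 2"
        using Cauchy_Schwarz_ineq2[of v "G (z - t *\<^sub>R v) - G z"] by linarith
      \<comment> \<open>Along the segment the slope loses at most \<eta> / 2, at most half of its
        initial value, and so stays above the third that Armijo's condition asks for.\<close>
      then have "inner v (G (z - t *\<^sub>R v)) \<ge> inner v (G z) / 3"
        using vG \<eta> unfolding inner_diff_right by linarith
      then have "s * (- inner v (G (z - t *\<^sub>R v))) \<le> s * (- (inner v (G z) / 3))"
        using s by (intro mult_left_mono) auto
      with t(3) show ?thesis by (simp add: armijo_def s_def[symmetric])
    qed
    then have "armijo (LEAST m. armijo m)" and le: "(LEAST m. armijo m) \<le> m0"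
      by (rule LeastI, rule Least_le)
    then have "F (\<phi> z) - F z \<le> - ((1/2) ^ (LEAST m. armijo m)) * inner v (G z) / 3"
      unfolding \<phi>z armijo_def[of "LEAST m. armijo m"] by simp
    moreover have "(1/2) ^ m0 * \<eta> \<le> (1/2) ^ (LEAST m. armijo m) * inner v (G z)"
      using le vG \<eta> by (intro mult_mono power_decreasing) auto
    ultimately show ?thesis by simp
  qed
  show ?thesis by (rule that[OF r _ dec]) (use \<eta> in auto)
qed

lemma F_step_le: "F (\<phi> z) \<le> F z"
proof (cases "G z = 0")
  case False
  then obtain r \<eta> where "r > 0" "\<eta> > 0" "\<And>x. dist z x < r \<Longrightarrow> F (\<phi> x) \<le> F x - \<eta>"
    by (rule uniform_decrease) blast
  from this(3)[of z] this(1,2) show ?thesis by simp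
qed (simp add: step_critical)

section \<open>Steps near critical points\<close>

lemma G_eq_0_iff: "G z = 0 \<longleftrightarrow> f z = 0 \<or> deriv f z = 0"
  by (simp add: G_def)

text \<open>Admits \<open>deriv f\<close> to \<open>zero_log_derivative_limits\<close>. The zero is
  essential, since \<open>f\<close> may be affine.\<close>

lemma deriv_nonconst_at_zero:
  assumes "deriv f c = 0"
  shows "\<not> deriv f constant_on UNIV"
proof
  assume "deriv f constant_on UNIV"
  then have d: "deriv f z = 0" for z using assms by (metis constant_on_def UNIV_I)
  have "\<exists>k. \<forall>z\<in>UNIV. f z = k"
    by (rule has_field_derivative_zero_constant) (use deriv1 d in \<open>simp, metis\<close>)
  with nonconst show False by (auto simp: constant_on_def)
qed

lemma eventually_at_nonzero:
  assumes "continuous_on UNIV h" "h c \<noteq> (0::complex)"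
  shows "\<forall>\<^sub>F z in at c. h z \<noteq> 0"
proof -
  have "(h \<longlongrightarrow> h c) (at c)" using assms(1) by (simp add: continuous_on_def)
  then show ?thesis using assms(2) by (rule tendsto_imp_eventually_ne)
qed

lemma critical_isolated: "\<forall>\<^sub>F z in at c. G z \<noteq> 0"
proof -
  have "\<forall>\<^sub>F z in at c. f z \<noteq> 0"
  proof (cases "f c = 0")
    case True
    then show ?thesis by (rule zero_log_derivative_limits[OF hol nonconst]) (elim eventually_mono, simp)
  qed (rule eventually_at_nonzero[OF continuous_on_derivs(1)])
  moreover have "\<forall>\<^sub>F z in at c. deriv f z \<noteq> 0"
  proof (cases "deriv f c = 0")
    case True
    show ?thesis by (rule zero_log_derivative_limits[OF holomorphic_deriv_f deriv_nonconst_at_zero[OF True] True]) (elim eventually_mono, simp)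
  qed (rule eventually_at_nonzero[OF continuous_on_derivs(2)])
  ultimately show ?thesis by eventually_elim (simp add: G_eq_0_iff)
qed

text \<open>At a zero of order \<open>n\<close> the ratio of \<open>\<bar>f f''\<bar>\<close> to \<open>\<bar>f'\<bar>\<^sup>2\<close> tends to \<open>1 - 1 / n \<noteq> 1\<close>; at the other critical
  points \<open>\<bar>f f''\<bar>\<close> dominates. Either way the Hessian is large compared with the gradient.\<close>

lemma gradient_hessian_quotient:
  assumes c: "G c = 0"
  shows "((\<lambda>z. norm (G z) / \<bar>H1 z - norm (H2 z)\<bar>) \<longlongrightarrow> 0) (at c)"
    and "\<forall>\<^sub>F z in at c. H1 z - norm (H2 z) \<noteq> 0"
proof -
  \<comment> \<open>Common form of both cases, with \<open>p\<close> tending to 0 and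
    \<open>q\<close> to a nonzero \<open>L\<close>: at a zero of order \<open>n\<close>,
    \<open>N = |f'|^2\<close> and \<open>L = 1 / n\<close>; at the other critical points,
    \<open>N = |f f''|\<close> and \<open>L = -1\<close>.\<close>
  obtain N p q :: "complex \<Rightarrow> real" and L where p: "(p \<longlongrightarrow> 0) (at c)" and q: "(q \<longlongrightarrow> L) (at c)" "L \<noteq> 0"
    and N: "\<forall>\<^sub>F z in at c. N z > 0 \<and> norm (G z) = N z * p z \<and> H1 z - norm (H2 z) = N z * q z"
  proof (cases "f c = 0")
    case True
    obtain n :: nat where n: "n > 0" and l1: "((\<lambda>z. f z / deriv f z) \<longlongrightarrow> 0) (at c)"
      and l2: "((\<lambda>z. f z * deriv (deriv f) z / (deriv f z)\<^sup>2) \<longlongrightarrow> 1 - 1 / of_nat n) (at c)"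
      and ev: "\<forall>\<^sub>F z in at c. f z \<noteq> 0 \<and> deriv f z \<noteq> 0"
      by (rule zero_log_derivative_limits[OF hol nonconst True])
    show ?thesis
    proof (rule that[of "\<lambda>z. norm (f z / deriv f z)" "\<lambda>z. 1 - norm (f z * deriv (deriv f) z / (deriv f z)\<^sup>2)"
          "1 / real n" "\<lambda>z. (norm (deriv f z))\<^sup>2"])
      have "(1 - 1 / of_nat n :: complex) = of_real (1 - 1 / real n)" by simp
      then have "norm (1 - 1 / of_nat n :: complex) = \<bar>1 - 1 / real n\<bar>" by (simp only: norm_of_real)
      then have "norm (1 - 1 / of_nat n :: complex) = 1 - 1 / real n" using n by simp
      then show "((\<lambda>z. 1 - norm (f z * deriv (deriv f) z / (deriv f z)\<^sup>2)) \<longlongrightarrow> 1 / real n) (at c)"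
        using tendsto_diff[OF tendsto_const tendsto_norm[OF l2], of 1] by simp
      show "\<forall>\<^sub>F z in at c. (norm (deriv f z))\<^sup>2 > 0 \<and> norm (G z) = (norm (deriv f z))\<^sup>2 * norm (f z / deriv f z)
          \<and> H1 z - norm (H2 z) = (norm (deriv f z))\<^sup>2 * (1 - norm (f z * deriv (deriv f) z / (deriv f z)\<^sup>2))"
        using ev
        by eventually_elim (simp add: G_def H1_def H2_def norm_mult norm_divide norm_power right_diff_distrib power2_eq_square)
    qed (use n in \<open>auto intro: tendsto_norm_zero[OF l1]\<close>)
  next
    case False
    then have d0: "deriv f c = 0" using c by (simp add: G_eq_0_iff)
    obtain n :: nat where l1: "((\<lambda>z. deriv f z / deriv (deriv f) z) \<longlongrightarrow> 0) (at c)"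
      and ev: "\<forall>\<^sub>F z in at c. deriv f z \<noteq> 0 \<and> deriv (deriv f) z \<noteq> 0"
      by (rule zero_log_derivative_limits[OF holomorphic_deriv_f deriv_nonconst_at_zero[OF d0] d0])
    have evf: "\<forall>\<^sub>F z in at c. f z \<noteq> 0" by (rule eventually_at_nonzero[OF continuous_on_derivs(1) False])
    have t: "(f \<longlongrightarrow> f c) (at c)" "(deriv f \<longlongrightarrow> deriv f c) (at c)"
      using continuous_on_derivs[of UNIV] by (simp_all add: continuous_on_def)
    let ?q = "\<lambda>z. norm (deriv f z / deriv (deriv f) z) * (norm (deriv f z) / norm (f z)) - 1"
    have "(?q \<longlongrightarrow> 0 * (norm (deriv f c) / norm (f c)) - 1) (at c)"
      by (intro tendsto_diff tendsto_mult tendsto_divide tendsto_norm t tendsto_const tendsto_norm_zero l1) (use False in simp)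
    then have lq: "(?q \<longlongrightarrow> -1) (at c)" by simp
    show ?thesis
    proof (rule that[OF tendsto_norm_zero[OF l1] lq])
      show "\<forall>\<^sub>F z in at c. norm (f z) * norm (deriv (deriv f) z) > 0
          \<and> norm (G z) = norm (f z) * norm (deriv (deriv f) z) * norm (deriv f z / deriv (deriv f) z)
          \<and> H1 z - norm (H2 z) = norm (f z) * norm (deriv (deriv f) z) * ?q z"
        using ev evf
        by eventually_elim (simp add: G_def H1_def H2_def norm_mult norm_divide power2_eq_square right_diff_distrib)
    qed simp
  qed
  have "((\<lambda>z. p z / \<bar>q z\<bar>) \<longlongrightarrow> 0 / \<bar>L\<bar>) (at c)"
    by (intro tendsto_divide tendsto_rabs p q) (use q in simp)
  then have "((\<lambda>z. p z / \<bar>q z\<bar>) \<longlongrightarrow> 0) (at c)" by simp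
  moreover have "\<forall>\<^sub>F z in at c. p z / \<bar>q z\<bar> = norm (G z) / \<bar>H1 z - norm (H2 z)\<bar>"
    using N by eventually_elim (simp add: abs_mult)
  ultimately show "((\<lambda>z. norm (G z) / \<bar>H1 z - norm (H2 z)\<bar>) \<longlongrightarrow> 0) (at c)"
    by (rule Lim_transform_eventually)
  have "\<forall>\<^sub>F z in at c. q z \<noteq> 0" by (rule tendsto_imp_eventually_ne[OF q])
  with N show "\<forall>\<^sub>F z in at c. H1 z - norm (H2 z) \<noteq> 0" by eventually_elim auto
qed

lemma step_length:
  assumes "G z \<noteq> 0"
  obtains w :: complex where "norm w * (gap * norm (G z) powr \<tau>) \<le> norm (G z)"
    and "norm w * (\<bar>H1 z - norm (H2 z)\<bar> - shift_bound * norm (G z) powr \<tau>) \<le> norm (G z)"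
    and "dist (\<phi> z) z \<le> norm w"
proof -
  obtain w where w: "norm w * (gap * norm (G z) powr \<tau>) \<le> norm (G z)"
    "norm w * (\<bar>H1 z - norm (H2 z)\<bar> - shift_bound * norm (G z) powr \<tau>) \<le> norm (G z)"
    and "(norm (G z))\<^sup>2 \<le> (H1 z + norm (H2 z) + shift_bound * norm (G z) powr \<tau>) * inner w (G z)"
    and \<phi>: "\<phi> z = z - (1/2) ^ halvings z (clip w) *\<^sub>R clip w"
    by (rule step_noncritical[OF assms])
  have "dist (\<phi> z) z = (1/2) ^ halvings z (clip w) * ((1 / max 1 (\<theta> * norm w)) * norm w)"
    unfolding \<phi> dist_norm by (simp add: clip_def abs_mult)
  also have "\<dots> \<le> 1 * (1 * norm w)"
    by (intro mult_mono power_le_one) auto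
  finally have "dist (\<phi> z) z \<le> norm w" by simp
  then show ?thesis using that[of w] w(1) w(2) by blast
qed

text \<open>For \<tau> < 1 the eigenvalue test bounds the step by
  \<open>norm (G z) powr (1 - \<tau>) / gap\<close>. Otherwise the shift is at most of the order of
  the gradient, hence negligible against the eigenvalues of the Hessian, and the second length bound
  applies.\<close>

lemma step_length_tendsto_0:
  assumes c: "G c = 0"
  shows "((\<lambda>z. dist (\<phi> z) z) \<longlongrightarrow> 0) (at c)"
proof -
  have Gc: "((\<lambda>z. norm (G z)) \<longlongrightarrow> 0) (at c)"
    using continuous_on_G[of UNIV] c tendsto_norm_zero[of G "at c"] by (simp add: continuous_on_def) (metis)
  show ?thesis
  proof (cases "\<tau> < 1")
    case True
    have "((\<lambda>z. norm (G z) powr (1 - \<tau>)) \<longlongrightarrow> 0) (at c)"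
      by (rule tendsto_zero_powrI[OF Gc tendsto_const]) (use True in auto)
    then have lim: "((\<lambda>z. norm (G z) powr (1 - \<tau>) / gap) \<longlongrightarrow> 0) (at c)"
      by (rule tendsto_divide_zero)
    show ?thesis
    proof (rule tendsto_sandwich[OF _ _ tendsto_const lim])
      show "\<forall>\<^sub>F z in at c. dist (\<phi> z) z \<le> norm (G z) powr (1 - \<tau>) / gap"
        using critical_isolated[of c]
      proof eventually_elim
        case (elim z)
        then obtain w :: complex where w: "norm w * (gap * norm (G z) powr \<tau>) \<le> norm (G z)"
          "norm w * (\<bar>H1 z - norm (H2 z)\<bar> - shift_bound * norm (G z) powr \<tau>) \<le> norm (G z)"
          "dist (\<phi> z) z \<le> norm w"
          by (rule step_length)
        have "norm w \<le> norm (G z) powr (1 - \<tau>) / gap"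
          using w(1) elim gap_pos by (simp add: powr_diff field_simps)
        with w(3) show ?case by linarith
      qed
    qed simp
  next
    case False
    define q where "q z = norm (G z) / \<bar>H1 z - norm (H2 z)\<bar>" for z
    have q0: "(q \<longlongrightarrow> 0) (at c)" unfolding q_def by (rule gradient_hessian_quotient(1)[OF c])
    have lim: "((\<lambda>z. 2 * q z) \<longlongrightarrow> 0) (at c)" by (rule tendsto_mult_right_zero[OF q0])
    have "((\<lambda>z. shift_bound * q z) \<longlongrightarrow> 0) (at c)" by (rule tendsto_mult_right_zero[OF q0])
    then have e1: "\<forall>\<^sub>F z in at c. shift_bound * q z < 1/2" by (rule order_tendstoD(2)) simp
    have e2: "\<forall>\<^sub>F z in at c. norm (G z) < 1" using Gc by (rule order_tendstoD(2)) simp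
    show ?thesis
    proof (rule tendsto_sandwich[OF _ _ tendsto_const lim])
      show "\<forall>\<^sub>F z in at c. dist (\<phi> z) z \<le> 2 * q z"
        using critical_isolated[of c] gradient_hessian_quotient(2)[OF c] e1 e2
      proof eventually_elim
        case (elim z)
        obtain w :: complex where "norm w * (gap * norm (G z) powr \<tau>) \<le> norm (G z)"
          and w: "norm w * (\<bar>H1 z - norm (H2 z)\<bar> - shift_bound * norm (G z) powr \<tau>) \<le> norm (G z)"
          and dw: "dist (\<phi> z) z \<le> norm w"
          using elim(1) by (rule step_length)
        let ?N = "\<bar>H1 z - norm (H2 z)\<bar>"
        have N: "?N > 0" using elim(2) by simp
        have "norm (G z) powr \<tau> \<le> norm (G z) powr 1"
          using elim(1,4) False by (intro powr_mono') auto
        then have "norm (G z) powr \<tau> \<le> q z * ?N" using N by (simp add: q_def)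
        then have "shift_bound * norm (G z) powr \<tau> \<le> shift_bound * (q z * ?N)"
          by (rule mult_left_mono) (simp add: shift_bound_def)
        also have "\<dots> = (shift_bound * q z) * ?N" by simp
        also have "\<dots> \<le> 1/2 * ?N" using elim(3) N by (intro mult_right_mono) auto
        finally have "?N / 2 \<le> ?N - shift_bound * norm (G z) powr \<tau>" by simp
        then have "norm w * (?N / 2) \<le> norm w * (?N - shift_bound * norm (G z) powr \<tau>)"
          by (rule mult_left_mono) simp
        with w have "norm w * (?N / 2) \<le> norm (G z)" by linarith
        then have "norm w \<le> 2 * q z" using N by (simp add: q_def field_simps)
        with dw show ?case by linarith
      qed
    qed simp
  qed
qed

lemma isCont_step_at_critical:
  assumes c: "G c = 0"
  shows "isCont \<phi> c"
proof -
  have "((\<lambda>z. dist (\<phi> z) c) \<longlongrightarrow> 0) (at c)"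
  proof (rule tendsto_sandwich[OF _ _ tendsto_const])
    have "((\<lambda>z. dist z c) \<longlongrightarrow> dist c c) (at c)" by (intro tendsto_intros)
    from tendsto_add[OF step_length_tendsto_0[OF c] this]
    show "((\<lambda>z. dist (\<phi> z) z + dist z c) \<longlongrightarrow> 0) (at c)" by (simp only: dist_self add_0)
    show "\<forall>\<^sub>F z in at c. dist (\<phi> z) c \<le> dist (\<phi> z) z + dist z c"
      by (simp add: dist_triangle)
  qed simp
  then show ?thesis unfolding isCont_def step_critical[OF c] by (rule tendsto_dist_iff[THEN iffD2])
qed

section \<open>Limits of orbits\<close>

lemma cluster_point_critical:
  assumes r: "strict_mono r" and l: "(\<lambda>k. (\<phi> ^^ r k) z) \<longlonglongrightarrow> l"
  shows "G l = 0"
proof (rule ccontr)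
  assume "G l \<noteq> 0"
  then obtain \<rho> \<eta> where \<rho>: "\<rho> > 0" "\<eta> > 0" "\<And>x. dist l x < \<rho> \<Longrightarrow> F (\<phi> x) \<le> F x - \<eta>"
    by (rule uniform_decrease) blast
  \<comment> \<open>\<open>F\<close> is nonincreasing along the orbit and bounded below, so its
    increments tend to 0, whereas every visit near \<open>l\<close> lowers it by at least
    \<eta>.\<close>
  let ?a = "\<lambda>n. F ((\<phi> ^^ n) z)"
  have "decseq ?a"
    by (rule decseq_SucI) (simp add: F_step_le)
  moreover have "\<forall>n. 0 \<le> ?a n" by (simp add: F_def)
  ultimately obtain L where L: "?a \<longlonglongrightarrow> L" using decseq_convergent by blast
  have "(\<lambda>n. ?a n - ?a (Suc n)) \<longlonglongrightarrow> L - L"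
    by (intro tendsto_diff L LIMSEQ_Suc)
  then have "(\<lambda>n. ?a n - ?a (Suc n)) \<longlonglongrightarrow> 0" by simp
  then have "(\<lambda>k. ?a (r k) - ?a (Suc (r k))) \<longlonglongrightarrow> 0"
    using LIMSEQ_subseq_LIMSEQ[OF _ r] by (force simp: o_def)
  then have "\<forall>\<^sub>F k in sequentially. ?a (r k) - ?a (Suc (r k)) < \<eta>"
    using \<rho>(2) by (rule order_tendstoD(2))
  moreover have "\<forall>\<^sub>F k in sequentially. dist ((\<phi> ^^ r k) z) l < \<rho>"
    using l \<rho>(1) by (rule tendstoD)
  ultimately have "\<forall>\<^sub>F k in sequentially. False"
  proof eventually_elim
    case (elim k)
    then show ?case using \<rho>(3)[of "(\<phi> ^^ r k) z"] by (simp add: dist_commute)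
  qed
  then show False by simp
qed

lemma frequently_compact_cluster_point:
  assumes K: "compact K" and fr: "\<exists>\<^sub>F n in sequentially. (\<phi> ^^ n) z \<in> K"
  obtains l r where "l \<in> K" "strict_mono r" "(\<lambda>k. (\<phi> ^^ r k) z) \<longlonglongrightarrow> l"
proof -
  have inf: "infinite {n. (\<phi> ^^ n) z \<in> K}"
    using fr by (simp add: frequently_cofinite[symmetric] cofinite_eq_sequentially)
  define s where "s = enumerate {n. (\<phi> ^^ n) z \<in> K}"
  have s: "strict_mono s" unfolding s_def by (rule strict_mono_enumerate[OF inf])
  have "\<forall>k. (\<phi> ^^ s k) z \<in> K" using enumerate_in_set[OF inf] by (auto simp: s_def)
  then obtain l t where l: "l \<in> K" "strict_mono t" "((\<lambda>k. (\<phi> ^^ s k) z) \<circ> t) \<longlonglongrightarrow> l"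
    using K unfolding compact_def by meson
  have "strict_mono (s \<circ> t)" using s l(2) by (rule strict_mono_o)
  with l show ?thesis by (intro that[of l "s \<circ> t"]) (auto simp: o_def)
qed

lemma isolating_radius:
  assumes "e > 0"
  obtains r where "0 < r" "r \<le> e" "\<And>z. dist z c \<le> r \<Longrightarrow> G z = 0 \<Longrightarrow> z = c"
proof -
  obtain d where d: "d > 0" "\<And>z. z \<noteq> c \<Longrightarrow> dist z c < d \<Longrightarrow> G z \<noteq> 0"
    using critical_isolated[of c] unfolding eventually_at by auto
  show ?thesis
    by (rule that[of "min e (d/2)"]) (use d assms in \<open>auto, force\<close>)
qed

lemma step_stays_near_critical:
  assumes c: "G c = 0" and r: "r > 0"
  obtains r' where "0 < r'" "r' \<le> r" "\<And>z. dist z c < r' \<Longrightarrow> dist (\<phi> z) c < r"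
proof -
  obtain d where d: "d > 0" "\<And>z. dist z c < d \<Longrightarrow> dist (\<phi> z) (\<phi> c) < r"
    using isCont_step_at_critical[OF c] r unfolding continuous_at_eps_delta by blast
  show ?thesis
    by (rule that[of "min r d"]) (use d r step_critical[OF c] in auto)
qed

text \<open>An orbit that visits a neighbourhood of a critical point \<open>c\<close> infinitely often but does not
  converge to \<open>c\<close> would, by the continuity of \<open>\<phi>\<close> at \<open>c\<close>, cross an annulus around \<open>c\<close> without critical
  points infinitely often.\<close>

theorem orbit_dichotomy:
  "(\<exists>c. G c = 0 \<and> (\<lambda>n. (\<phi> ^^ n) z) \<longlonglongrightarrow> c) \<or> filterlim (\<lambda>n. norm ((\<phi> ^^ n) z)) at_top sequentially"
proof (rule disjCI)
  let ?z = "\<lambda>n. (\<phi> ^^ n) z"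
  assume "\<not> filterlim (\<lambda>n. norm (?z n)) at_top sequentially"
  then obtain B where "\<not> (\<forall>\<^sub>F n in sequentially. B \<le> norm (?z n))"
    unfolding filterlim_at_top by blast
  then have "\<exists>\<^sub>F n in sequentially. \<not> B \<le> norm (?z n)"
    by (simp only: not_eventually)
  then have "\<exists>\<^sub>F n in sequentially. ?z n \<in> cball 0 B"
    by (rule frequently_elim1) simp
  then obtain c r where c: "strict_mono r" "(\<lambda>k. ?z (r k)) \<longlonglongrightarrow> c"
    using frequently_compact_cluster_point[OF compact_cball] by metis
  have Gc: "G c = 0" by (rule cluster_point_critical[OF c])
  have "?z \<longlonglongrightarrow> c"
  proof (rule ccontr)
    assume "\<not> ?z \<longlonglongrightarrow> c"
    then obtain e where e: "e > 0" "\<exists>\<^sub>F n in sequentially. \<not> dist (?z n) c < e"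
      unfolding tendsto_iff not_all not_imp not_eventually by blast
    obtain r1 where r1: "0 < r1" "r1 \<le> e" "\<And>z. dist z c \<le> r1 \<Longrightarrow> G z = 0 \<Longrightarrow> z = c"
      using isolating_radius[OF e(1)] by blast
    obtain r' where r': "0 < r'" "r' \<le> r1" "\<And>z. dist z c < r' \<Longrightarrow> dist (\<phi> z) c < r1"
      using step_stays_near_critical[OF Gc r1(1)] by blast
    define K where "K = cball c r1 - ball c r'"
    have "\<exists>\<^sub>F n in sequentially. ?z n \<in> K"
      unfolding frequently_sequentially
    proof
      fix N
      have "\<forall>\<^sub>F k in sequentially. dist (?z (r k)) c < r'" using c(2) r'(1) by (rule tendstoD)
      moreover have "\<forall>\<^sub>F k in sequentially. k \<ge> N" by (rule eventually_ge_at_top)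
      ultimately have "\<forall>\<^sub>F k in sequentially. dist (?z (r k)) c < r' \<and> k \<ge> N" by (rule eventually_conj)
      then obtain k where k: "dist (?z (r k)) c < r'" "k \<ge> N" by (auto simp: eventually_sequentially)
      define n1 where "n1 = r k"
      have n1: "n1 \<ge> N" using k(2) seq_suble[OF c(1), of k] by (simp add: n1_def)
      obtain n2 where n2: "n2 \<ge> n1" "\<not> dist (?z n2) c < e"
        using e(2) unfolding frequently_sequentially by blast
      \<comment> \<open>The first exit from \<open>ball c r'\<close> after time \<open>n1\<close>:
        the preceding point is still in that ball, so the exit step ends inside
        \<open>ball c r1\<close>, hence in the annulus \<open>K\<close>.\<close>
      define P where "P j \<longleftrightarrow> n1 \<le> j \<and> \<not> dist (?z j) c < r'" for j
      have "P n2" using n2 r1(2) r'(2) by (auto simp: P_def)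
      define n where "n = (LEAST j. P j)"
      have Pn: "P n" unfolding n_def by (rule LeastI[of P, OF \<open>P n2\<close>])
      have "n \<noteq> n1" using Pn k(1) by (auto simp: P_def n1_def)
      then obtain j where j: "n = Suc j" "n1 \<le> j" using Pn by (cases n) (auto simp: P_def)
      have "\<not> P j" using not_less_Least[of j P] j by (simp add: n_def)
      then have "dist (?z j) c < r'" using j by (simp add: P_def)
      then have "dist (?z n) c < r1" using r'(3) j by simp
      then have "?z n \<in> K" using Pn by (simp add: K_def P_def dist_commute)
      moreover have "n \<ge> N" using Pn n1 by (simp add: P_def)
      ultimately show "\<exists>n\<ge>N. ?z n \<in> K" by blast
    qed
    moreover have "compact K" unfolding K_def by (intro compact_diff) auto
    ultimately obtain l s where l: "l \<in> K" "strict_mono s" "(\<lambda>k. ?z (s k)) \<longlonglongrightarrow> l"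
      using frequently_compact_cluster_point by metis
    have "G l = 0" by (rule cluster_point_critical[OF l(2,3)])
    then have "l = c" using l(1) r1(3)[of l] by (simp add: K_def dist_commute)
    with l(1) r'(1) show False by (simp add: K_def)
  qed
  with Gc show "\<exists>c. G c = 0 \<and> ?z \<longlonglongrightarrow> c" by blast
qed

lemma bounded_orbit_converges:
  assumes "\<forall>\<^sub>F n in sequentially. norm ((\<phi> ^^ n) z) \<le> B"
  obtains c where "G c = 0" "(\<lambda>n. (\<phi> ^^ n) z) \<longlonglongrightarrow> c"
proof -
  have "\<not> filterlim (\<lambda>n. norm ((\<phi> ^^ n) z)) at_top sequentially"
  proof
    assume "filterlim (\<lambda>n. norm ((\<phi> ^^ n) z)) at_top sequentially"
    then have "\<forall>\<^sub>F n in sequentially. B < norm ((\<phi> ^^ n) z)"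
      by (simp add: filterlim_at_top_dense)
    with assms have "\<forall>\<^sub>F n in sequentially. False" by eventually_elim simp
    then show False by simp
  qed
  with orbit_dichotomy[of z] that show ?thesis by blast
qed

section \<open>Attractors\<close>

lemma F_orbit_le: "F ((\<phi> ^^ n) z) \<le> F z"
  by (induction n) (auto intro: order_trans[OF F_step_le])

text \<open>Trapping region: a step from \<open>ball \<rho> r'\<close> stays in
  \<open>ball \<rho> r\<close> and, started with \<open>F < \<mu>\<close>, cannot land in the
  annulus between, where \<open>F >= \<mu>\<close>. So this part of the small ball is invariant, and
  its orbits converge to a critical point within distance \<open>r\<close>, which can only be
  \<rho>.\<close>

lemma zero_attracting:
  assumes \<rho>: "f \<rho> = 0"
  shows "attracting_set \<phi> {\<rho>}"
proof -
  have G\<rho>: "G \<rho> = 0" using \<rho> by (simp add: G_def)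
  obtain r where r: "0 < r" "r \<le> 1" "\<And>z. dist z \<rho> \<le> r \<Longrightarrow> G z = 0 \<Longrightarrow> z = \<rho>"
    using isolating_radius[of 1] by (metis zero_less_one)
  obtain r' where r': "0 < r'" "r' \<le> r" "\<And>z. dist z \<rho> < r' \<Longrightarrow> dist (\<phi> z) \<rho> < r"
    using step_stays_near_critical[OF G\<rho> r(1)] by blast
  define K where "K = cball \<rho> r - ball \<rho> r'"
  have Kc: "compact K" unfolding K_def by (intro compact_diff) auto
  have Kpos: "F z > 0" if "z \<in> K" for z
  proof -
    have "z \<noteq> \<rho>" using that r'(1) by (auto simp: K_def)
    then have "G z \<noteq> 0" using r(3)[of z] that by (auto simp: K_def dist_commute)
    then show ?thesis by (simp add: F_def G_eq_0_iff)
  qed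
  obtain \<mu> where \<mu>: "\<mu> > 0" "\<And>z. z \<in> K \<Longrightarrow> F z \<ge> \<mu>"
  proof (cases "K = {}")
    case True
    then show ?thesis by (intro that[of 1]) auto
  next
    case False
    then obtain x where "x \<in> K" "\<And>y. y \<in> K \<Longrightarrow> F x \<le> F y"
      using continuous_attains_inf[OF Kc _ continuous_on_F] by blast
    then show ?thesis using Kpos by (intro that[of "F x"]) auto
  qed
  define U where "U = ball \<rho> r' \<inter> {z. F z < \<mu>}"
  have "open U"
    unfolding U_def by (intro open_Int open_ball open_Collect_less continuous_on_F continuous_on_const)
  moreover have "\<rho> \<in> U" using r'(1) \<mu>(1) \<rho> by (simp add: U_def F_def)
  moreover have "(\<lambda>n. infdist ((\<phi> ^^ n) x) {\<rho>}) \<longlonglongrightarrow> 0" if x: "x \<in> U" for x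
  proof -
    have inU: "(\<phi> ^^ n) x \<in> U" for n
    proof (induction n)
      case (Suc n)
      let ?y = "(\<phi> ^^ n) x"
      have y: "dist ?y \<rho> < r'" "F ?y < \<mu>" using Suc by (auto simp: U_def dist_commute)
      have F: "F (\<phi> ?y) < \<mu>" using F_step_le[of ?y] y(2) by linarith
      have "\<phi> ?y \<notin> K" using \<mu>(2) F by force
      then have "\<phi> ?y \<in> ball \<rho> r'" using r'(3)[OF y(1)] by (auto simp: K_def dist_commute)
      with F show ?case by (simp add: U_def)
    qed (use x in simp)
    have near: "dist ((\<phi> ^^ n) x) \<rho> \<le> r" for n
      using inU[of n] r'(2) by (auto simp: U_def dist_commute)
    have "norm ((\<phi> ^^ n) x) \<le> norm \<rho> + r" for n
      using norm_triangle_ineq[of \<rho> "(\<phi> ^^ n) x - \<rho>"] near[of n] by (simp add: dist_norm)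
    then obtain c where c: "G c = 0" "(\<lambda>n. (\<phi> ^^ n) x) \<longlonglongrightarrow> c"
      using bounded_orbit_converges[of x "norm \<rho> + r"] by auto
    have "(\<lambda>n. dist ((\<phi> ^^ n) x) \<rho>) \<longlonglongrightarrow> dist c \<rho>" by (intro tendsto_intros c)
    then have "dist c \<rho> \<le> r" by (rule LIMSEQ_le_const2) (use near in auto)
    then have "c = \<rho>" using r(3) c(1) by blast
    then show ?thesis using c(2) by (simp add: tendsto_dist_iff[symmetric])
  qed
  ultimately show ?thesis
    unfolding attracting_set_def using step_critical[OF G\<rho>] by (intro conjI exI[of _ U]) auto
qed

lemma smaller_value_nearby:
  assumes "f x \<noteq> 0" "open U" "x \<in> U"
  obtains y where "y \<in> U" "F y < F x"
proof -
  have "open (f ` U)"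
    by (rule open_mapping_thm[OF hol open_UNIV connected_UNIV assms(2) subset_UNIV nonconst])
  then obtain e where e: "e > 0" "ball (f x) e \<subseteq> f ` U"
    using assms(3) by (meson imageI open_contains_ball)
  \<comment> \<open>Moves the value \<open>f x\<close> towards 0 by less than \<open>e\<close>, so
    that the smaller value is still attained in \<open>U\<close>.\<close>
  define t where "t = min (1/2) (e / (2 * norm (f x)))"
  have t: "0 < t" "t \<le> 1/2" using e(1) assms(1) by (auto simp: t_def)
  have "t * norm (f x) \<le> e / (2 * norm (f x)) * norm (f x)"
    by (intro mult_right_mono) (auto simp: t_def)
  then have te: "t * norm (f x) < e" using assms(1) e(1) by simp
  have "dist (f x) (of_real (1 - t) * f x) = norm (of_real t * f x)"
    by (simp add: dist_norm algebra_simps)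
  also have "\<dots> < e" using te t by (simp add: norm_mult)
  finally have "of_real (1 - t) * f x \<in> f ` U" using e(2) by auto
  then obtain y where y: "y \<in> U" "f y = of_real (1 - t) * f x" by (metis imageE)
  have "norm (f y) = (1 - t) * norm (f x)" unfolding y(2) norm_mult norm_of_real using t by simp
  also have "\<dots> < 1 * norm (f x)" using t assms(1) by (intro mult_strict_right_mono) auto
  finally have "F y < F x" by (simp add: F_def power_strict_mono)
  with y(1) show ?thesis by (rule that)
qed

text \<open>From a point of the basin where \<open>F\<close> is below its minimum on the set, the
  orbit converges to a point of the set. As \<open>F\<close> is continuous and does not increase
  along the orbit, that point would lie below the minimum.\<close>

lemma attracting_set_contains_zero:
  assumes S: "attracting_set \<phi> S"
  obtains \<rho> where "\<rho> \<in> S" "f \<rho> = 0"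
proof -
  from S obtain U where U: "S \<noteq> {}" "compact S" "\<phi> ` S = S" "open U" "S \<subseteq> U"
    "\<And>x. x \<in> U \<Longrightarrow> (\<lambda>n. infdist ((\<phi> ^^ n) x) S) \<longlonglongrightarrow> 0"
    unfolding attracting_set_def by blast
  obtain x where x: "x \<in> S" "\<And>y. y \<in> S \<Longrightarrow> F x \<le> F y"
    using continuous_attains_inf[OF U(2,1) continuous_on_F] by blast
  have "f x = 0"
  proof (rule ccontr)
    assume "f x \<noteq> 0"
    then obtain y where y: "y \<in> U" "F y < F x"
      using smaller_value_nearby[OF _ U(4)] U(5) x(1) by blast
    obtain B where B: "\<And>s. s \<in> S \<Longrightarrow> norm s \<le> B"
      using compact_imp_bounded[OF U(2)] unfolding bounded_iff by blast
    have "\<forall>\<^sub>F n in sequentially. infdist ((\<phi> ^^ n) y) S < 1"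
      using U(6)[OF y(1)] by (rule order_tendstoD(2)) simp
    then have "\<forall>\<^sub>F n in sequentially. norm ((\<phi> ^^ n) y) \<le> B + 1"
    proof eventually_elim
      case (elim n)
      obtain s where s: "s \<in> S" "infdist ((\<phi> ^^ n) y) S = dist ((\<phi> ^^ n) y) s"
        using infdist_attains_inf[OF compact_imp_closed[OF U(2)] U(1)] by blast
      then show ?case
        using elim B[OF s(1)] norm_triangle_ineq[of s "(\<phi> ^^ n) y - s"] by (simp add: dist_norm)
    qed
    then obtain c where c: "(\<lambda>n. (\<phi> ^^ n) y) \<longlonglongrightarrow> c"
      by (rule bounded_orbit_converges)
    have "(\<lambda>n. infdist ((\<phi> ^^ n) y) S) \<longlonglongrightarrow> infdist c S" by (rule tendsto_infdist[OF c])
    with U(6)[OF y(1)] have "infdist c S = 0" by (rule LIMSEQ_unique[rotated])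
    then have "c \<in> S" using in_closed_iff_infdist_zero[OF compact_imp_closed[OF U(2)] U(1)] by simp
    have "(\<lambda>n. F ((\<phi> ^^ n) y)) \<longlonglongrightarrow> F c"
      using continuous_on_F[of UNIV] by (intro isCont_tendsto_compose[OF _ c]) (simp add: continuous_on_eq_continuous_at)
    then have "F c \<le> F y" by (rule LIMSEQ_le_const2) (use F_orbit_le in auto)
    with y(2) x(2)[OF \<open>c \<in> S\<close>] show False by linarith
  qed
  with x(1) show ?thesis by (rule that)
qed

theorem attractor_iff_zero: "attractor \<phi> S \<longleftrightarrow> (\<exists>\<rho>. f \<rho> = 0 \<and> S = {\<rho>})"
proof
  assume S: "attractor \<phi> S"
  then have "attracting_set \<phi> S" by (simp add: attractor_def)
  then obtain \<rho> where \<rho>: "\<rho> \<in> S" "f \<rho> = 0" by (rule attracting_set_contains_zero)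
  then have "\<not> {\<rho>} \<subset> S" using S zero_attracting[OF \<rho>(2)] by (auto simp: attractor_def)
  with \<rho> show "\<exists>\<rho>. f \<rho> = 0 \<and> S = {\<rho>}" by blast
next
  assume "\<exists>\<rho>. f \<rho> = 0 \<and> S = {\<rho>}"
  then obtain \<rho> where \<rho>: "f \<rho> = 0" "S = {\<rho>}" by blast
  moreover have "\<not> attracting_set \<phi> {}" by (simp add: attracting_set_def)
  ultimately show "attractor \<phi> S"
    using zero_attracting[OF \<rho>(1)] by (auto simp: attractor_def psubset_eq subset_singleton_iff)
qed

lemma orbit_of_zero: "f z = 0 \<Longrightarrow> (\<phi> ^^ n) z = z"
  by (induction n) (simp_all add: step_critical G_def)

end

theorem theorem3:
  fixes d0 d1 d2 \<theta> \<tau> :: real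
  assumes "d0 \<noteq> d1" and "d0 \<noteq> d2" and "d1 \<noteq> d2" and "\<theta> > 0" and "\<tau> > 0"
  defines "\<phi> \<equiv> bnqn_step d0 d1 d2 \<theta> \<tau> xiF"
  shows "((\<forall>s. riemann_xi s = 0 \<longrightarrow> Re s = 1/2) \<longleftrightarrow>
            (\<forall>S. attractor \<phi> S \<longrightarrow> S \<subseteq> {s. Re s = 1/2}))
       \<and> ((\<forall>S. attractor \<phi> S \<longrightarrow> S \<subseteq> {s. Re s = 1/2}) \<longleftrightarrow>
            (\<forall>z0. (\<exists>L. Re L = 1/2 \<and> (\<lambda>n. (\<phi> ^^ n) z0) \<longlonglongrightarrow> L) \<or>
                   filterlim (\<lambda>n. norm ((\<phi> ^^ n) z0)) at_top sequentially))"
proof -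
  interpret dyn: bnqn_entire riemann_xi d0 d1 d2 \<theta> \<tau>
  proof
    show "riemann_xi holomorphic_on UNIV" by (rule holomorphic_riemann_xi)
    show "\<not> riemann_xi constant_on UNIV"
    proof
      assume "riemann_xi constant_on UNIV"
      then have "riemann_xi 2 = riemann_xi 0" by (metis constant_on_def UNIV_I)
      then have "complex_of_real (pi / 6) = of_real (1/2)" using riemann_xi_2 riemann_xi_0 by simp
      then have "pi / 6 = 1/2" by (simp only: of_real_eq_iff)
      then show False using pi_gt3 by simp
    qed
  qed (use assms in auto)
  have \<phi>: "\<phi> = dyn.\<phi>"
    by (simp add: \<phi>_def dyn.\<phi>_def xiF_def[abs_def] dyn.F_def[abs_def])
  let ?RH = "\<forall>s. riemann_xi s = 0 \<longrightarrow> Re s = 1/2"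
  have 12: "?RH \<longleftrightarrow> (\<forall>S. attractor \<phi> S \<longrightarrow> S \<subseteq> {s. Re s = 1/2})"
    unfolding \<phi> dyn.attractor_iff_zero by auto
  have 13: "?RH \<longleftrightarrow> (\<forall>z0. (\<exists>L. Re L = 1/2 \<and> (\<lambda>n. (\<phi> ^^ n) z0) \<longlonglongrightarrow> L) \<or>
                   filterlim (\<lambda>n. norm ((\<phi> ^^ n) z0)) at_top sequentially)"
  proof (intro iffI allI impI)
    fix z0 assume RH: ?RH
    then have "Re L = 1/2" if "dyn.G L = 0" for L
      using that riemann_hypothesis_imp_deriv_zeros[of L] by (auto simp: dyn.G_eq_0_iff)
    then show "(\<exists>L. Re L = 1/2 \<and> (\<lambda>n. (\<phi> ^^ n) z0) \<longlonglongrightarrow> L) \<or>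
                   filterlim (\<lambda>n. norm ((\<phi> ^^ n) z0)) at_top sequentially"
      using dyn.orbit_dichotomy[of z0] unfolding \<phi> by blast
  next
    fix s
    assume conv: "\<forall>z0. (\<exists>L. Re L = 1/2 \<and> (\<lambda>n. (\<phi> ^^ n) z0) \<longlonglongrightarrow> L) \<or>
                   filterlim (\<lambda>n. norm ((\<phi> ^^ n) z0)) at_top sequentially"
      and s: "riemann_xi s = 0"
    have const: "(\<lambda>n. (\<phi> ^^ n) s) = (\<lambda>n. s)"
      unfolding \<phi> using dyn.orbit_of_zero[OF s] by auto
    have "\<not> filterlim (\<lambda>n::nat. norm s) at_top sequentially"
      by (auto simp: filterlim_at_top_dense)
    then obtain L where "Re L = 1/2" "(\<lambda>n::nat. s) \<longlonglongrightarrow> L"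
      using conv[rule_format, of s] const by (auto simp: fun_eq_iff)
    then show "Re s = 1/2" by (simp add: LIMSEQ_const_iff)
  qed
  from 12 13 show ?thesis by blast
qed

end
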